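(* Let $\mathcal V=\{L_1,L_2\}$ be a veering pair. Given a subgroup $G$ of $\operatorname{Aut}(\mathcal V)$, the set $$M(G):=\{s\in S(\mathcal V): g(s)=s\text{ for some order }2\text{ elliptic element }g\in G\}$$ is a marking. Furthermore, $M(G)$ is $G$-invariant.
   Context: Lamination systems. $S^1$ is the unit circle with its counter-clockwise circular order. For distinct $u,v\in S^1$, $(u,v)_{S^1}$ is the set of $z$ with $(u,z,v)$ counter-clockwise; such sets are called good intervals, and $(u,v)_{S^1}^*:=(v,u)_{S^1}$. For a good interval $I$ put $\ell(I)=\{I,I^*\}$; $\ell(I)$ lies on an open interval $J$ if $I\subseteq J$ or $I^*\subseteq J$. A lamination system is a nonempty set $L$ of good intervals such that (i) $I\in L\Rightarrow I^*\in L$; (ii) for $I,J\in L$, $\ell(I)$ lies on $J$ or on $J^*$; (iii) if $I_1\subseteq I_2\subseteq\cdots$ are in $L$ and $\bigcup_k I_k$ is a good interval, then $\bigcup_k I_k\in L$. The leaves of $L$ are the $\ell(I)$, $I\in L$. A gap of $L$ is a subset $\mathcal G\subseteq L$ whose distinct elements are disjoint and such that every leaf of $L$ lies on some element of $\mathcal G$. Each leaf is itself a gap; a non-leaf gap is a gap which is not a leaf. The vertex set of $\mathcal G$ is $v(\mathcal G)=S^1\setminus\bigcup\mathcal G$. $E(L)=\bigcup_{I\in L}v(\ell(I))$. An ideal polygon is a gap with finitely many vertices (leaves included). A crown is a gap $\{(t_k,t_{k+1})_{S^1}:k\in\mathbb Z\}$ with vertex set $\{t_k:k\in\mathbb Z\}\cup\{p\}$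 and $p\neq t_k$ for all $k$. $L$ is quite full if every gap is an ideal polygon or a crown; a quite full $L$ is loose if distinct non-leaf gaps have disjoint vertex sets. A sequence of leaves $\ell_k$ converges to a good interval $I$ if there are $I_k\in L$ with $\ell_k=\ell(I_k)$ and $I\subseteq\liminf I_k\subseteq\limsup I_k\subseteq\overline I$. $I\in L$ is isolated if there is no sequence of leaves $\ell_k\ne\ell(I)$ of $L$ lying on $I$ and converging to $I$. A gap is real if none of its elements is isolated. Veering pairs. Gaps $\mathcal G_1$ of $L_1$ and $\mathcal G_2$ of $L_2$ interleave if for each $i\in\{1,2\}$ (cyclic indices) $I\cap v(\mathcal G_{i+1})$ is a singleton for every $I\in\mathcal G_i$; then $(\mathcal G_1,\mathcal G_2)$ is an interleaving pair. A stitch is an interleaving pair of leaves; it is genuine if both leaves are real. A pair $\{L_1,L_2\}$ of lamination systems is a veering pair if both are quite full and loose, $E(L_1)\cap E(L_2)=\emptyset$, and each non-leaf gap of $L_1$ or $L_2$ has an interleaving gap in the other system. The leaf space of $L_i$ is topologized so that $\ell((x,y)_{S^1})\mapsto\{x,y\}$ is a homeomorphism onto its image in the space of two-point subsets of $S^1$; the stitch space $S(\mathcal V)$ is the set of stitches with the subspace topology of the product of the two leaf spaces; $\eta_i$ is the projection of $S(\mathcal V)$ to the $i$-th coordinate. A marking on $\mathcal V$ is a subset $M\subseteq S(\mathcal V)$ such that (1) each stitch in $M$ is genuine; (2) $M$ is discrete and closed in $S(\mathcal V)$; (3) $\eta_1|_M$ and $\eta_2|_M$ are injective. Automorphisms.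 $\operatorname{Aut}(\mathcal V)$ is the group of orientation preserving homeomorphisms $g$ of $S^1$ with $g(L_1)=L_1$ and $g(L_2)=L_2$; it acts diagonally on $S(\mathcal V)$. An elliptic element is a non-trivial element of finite order. *)

theory Defs
  imports "HOL-Analysis.Analysis" "HOL-Algebra.Multiplicative_Group" "HOL-Algebra.Bij"
begin

section \<open>The circle and good intervals\<close>

abbreviation S1 :: "complex set" where
  "S1 \<equiv> sphere 0 1"

text \<open>\<open>Arg2pi (b / a) \<in> [0, 2\<pi>)\<close> is the angle travelled counter-clockwise from \<open>a\<close> to \<open>b\<close>.\<close>

definition ccw :: "complex \<Rightarrow> complex \<Rightarrow> complex \<Rightarrow> bool" where
  "ccw a b c \<longleftrightarrow> 0 < Arg2pi (b / a) \<and> Arg2pi (b / a) < Arg2pi (c / a)"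

definition ivl :: "complex \<Rightarrow> complex \<Rightarrow> complex set" where
  "ivl u v = {z \<in> S1. ccw u z v}"

definition good_interval :: "complex set \<Rightarrow> bool" where
  "good_interval I \<longleftrightarrow> (\<exists>u\<in>S1. \<exists>v\<in>S1. u \<noteq> v \<and> I = ivl u v)"

text \<open>The operation \<open>(u,v)\<^sup>* = (v,u)\<close>. A good interval determines its endpoints, so this is
  well defined; see \<open>dual_ivl\<close> below.\<close>

definition dual :: "complex set \<Rightarrow> complex set" where
  "dual I = (THE J. \<exists>u\<in>S1. \<exists>v\<in>S1. u \<noteq> v \<and> I = ivl u v \<and> J = ivl v u)"

definition leaf :: "complex set \<Rightarrow> complex set set" where
  "leaf I = {I, dual I}"

definition lies_on :: "complex set set \<Rightarrow> complex set \<Rightarrow> bool" where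
  "lies_on l J \<longleftrightarrow> (\<exists>I\<in>l. I \<subseteq> J)"

section \<open>Lamination systems\<close>

definition lamination_system :: "complex set set \<Rightarrow> bool" where
  "lamination_system L \<longleftrightarrow>
     L \<noteq> {} \<and> (\<forall>I\<in>L. good_interval I) \<and>
     (\<forall>I\<in>L. dual I \<in> L) \<and>
     (\<forall>I\<in>L. \<forall>J\<in>L. lies_on (leaf I) J \<or> lies_on (leaf I) (dual J)) \<and>
     (\<forall>I :: nat \<Rightarrow> complex set. (\<forall>k. I k \<in> L) \<and> (\<forall>k. I k \<subseteq> I (Suc k)) \<and>
        good_interval (\<Union>k. I k) \<longrightarrow> (\<Union>k. I k) \<in> L)"

definition leaves :: "complex set set \<Rightarrow> complex set set set" where
  "leaves L = leaf ` L"

definition gap :: "complex set set \<Rightarrow> complex set set \<Rightarrow> bool" where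
  "gap L G \<longleftrightarrow> G \<subseteq> L \<and> pairwise disjnt G \<and> (\<forall>l\<in>leaves L. \<exists>J\<in>G. lies_on l J)"

definition nonleaf_gap :: "complex set set \<Rightarrow> complex set set \<Rightarrow> bool" where
  "nonleaf_gap L G \<longleftrightarrow> gap L G \<and> G \<notin> leaves L"

definition vertices :: "complex set set \<Rightarrow> complex set" where
  "vertices G = S1 - \<Union>G"

definition endpoints :: "complex set set \<Rightarrow> complex set" where
  "endpoints L = (\<Union>I\<in>L. vertices (leaf I))"

definition ideal_polygon :: "complex set set \<Rightarrow> complex set set \<Rightarrow> bool" where
  "ideal_polygon L G \<longleftrightarrow> gap L G \<and> finite (vertices G)"

definition crown :: "complex set set \<Rightarrow> complex set set \<Rightarrow> bool" where
  "crown L G \<longleftrightarrow> gap L G \<and>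
     (\<exists>(t :: int \<Rightarrow> complex) p. range t \<subseteq> S1 \<and> G = range (\<lambda>k. ivl (t k) (t (k + 1))) \<and>
        vertices G = range t \<union> {p} \<and> (\<forall>k. p \<noteq> t k))"

definition quite_full :: "complex set set \<Rightarrow> bool" where
  "quite_full L \<longleftrightarrow> (\<forall>G. gap L G \<longrightarrow> ideal_polygon L G \<or> crown L G)"

definition loose :: "complex set set \<Rightarrow> bool" where
  "loose L \<longleftrightarrow>
     (\<forall>G H. nonleaf_gap L G \<and> nonleaf_gap L H \<and> G \<noteq> H \<longrightarrow> vertices G \<inter> vertices H = {})"

definition converges_to ::
    "complex set set \<Rightarrow> (nat \<Rightarrow> complex set set) \<Rightarrow> complex set \<Rightarrow> bool" where
  "converges_to L l I \<longleftrightarrow>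
     (\<exists>J. (\<forall>k. J k \<in> L \<and> l k = leaf (J k)) \<and>
        I \<subseteq> liminf J \<and> liminf J \<subseteq> limsup J \<and> limsup J \<subseteq> closure I)"

definition isolated :: "complex set set \<Rightarrow> complex set \<Rightarrow> bool" where
  "isolated L I \<longleftrightarrow>
     \<not> (\<exists>l. (\<forall>k. l k \<in> leaves L \<and> l k \<noteq> leaf I \<and> lies_on (l k) I) \<and> converges_to L l I)"

definition real_gap :: "complex set set \<Rightarrow> complex set set \<Rightarrow> bool" where
  "real_gap L G \<longleftrightarrow> gap L G \<and> (\<forall>I\<in>G. \<not> isolated L I)"

section \<open>Veering pairs, stitches and markings\<close>

definition interleave :: "complex set set \<Rightarrow> complex set set \<Rightarrow> bool" where
  "interleave G1 G2 \<longleftrightarrow>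
     (\<forall>I\<in>G1. is_singleton (I \<inter> vertices G2)) \<and> (\<forall>I\<in>G2. is_singleton (I \<inter> vertices G1))"

definition veering_pair :: "complex set set \<Rightarrow> complex set set \<Rightarrow> bool" where
  "veering_pair L1 L2 \<longleftrightarrow>
     lamination_system L1 \<and> lamination_system L2 \<and>
     quite_full L1 \<and> quite_full L2 \<and> loose L1 \<and> loose L2 \<and>
     endpoints L1 \<inter> endpoints L2 = {} \<and>
     (\<forall>G1. nonleaf_gap L1 G1 \<longrightarrow> (\<exists>G2. gap L2 G2 \<and> interleave G1 G2)) \<and>
     (\<forall>G2. nonleaf_gap L2 G2 \<longrightarrow> (\<exists>G1. gap L1 G1 \<and> interleave G1 G2))"

type_synonym stitch = "complex set set \<times> complex set set"

definition stitches :: "complex set set \<Rightarrow> complex set set \<Rightarrow> stitch set" where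
  "stitches L1 L2 = {(l1, l2). l1 \<in> leaves L1 \<and> l2 \<in> leaves L2 \<and> interleave l1 l2}"

definition genuine :: "complex set set \<Rightarrow> complex set set \<Rightarrow> stitch \<Rightarrow> bool" where
  "genuine L1 L2 s \<longleftrightarrow> s \<in> stitches L1 L2 \<and> real_gap L1 (fst s) \<and> real_gap L2 (snd s)"

abbreviation ordered_pairs :: "(complex \<times> complex) set" where
  "ordered_pairs \<equiv> {(x, y). x \<in> S1 \<and> y \<in> S1 \<and> x \<noteq> y}"

text \<open>The space of two-point subsets of the circle, with the quotient topology of the space of
  ordered pairs of distinct points; see \<open>quotient_map_two_point_space\<close> below.\<close>

definition two_point_space :: "complex set topology" where
  "two_point_space = topology (\<lambda>U. U \<subseteq> (\<lambda>(x, y). {x, y}) ` ordered_pairs \<and>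
     openin (top_of_set ordered_pairs) {p \<in> ordered_pairs. (case p of (x, y) \<Rightarrow> {x, y}) \<in> U})"

text \<open>As \<open>vertices (leaf (ivl x y)) = {x, y}\<close> (see \<open>vertices_leaf_ivl\<close>) and a leaf is determined
  by its two endpoints, the pullback topology is the one making \<open>vertices\<close> an embedding of the set of
  leaves into \<open>two_point_space\<close>.\<close>

definition leaf_space :: "complex set set \<Rightarrow> complex set set topology" where
  "leaf_space L = pullback_topology (leaves L) vertices two_point_space"

definition stitch_space :: "complex set set \<Rightarrow> complex set set \<Rightarrow> stitch topology" where
  "stitch_space L1 L2 =
     subtopology (prod_topology (leaf_space L1) (leaf_space L2)) (stitches L1 L2)"

definition marking :: "complex set set \<Rightarrow> complex set set \<Rightarrow> stitch set \<Rightarrow> bool" where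
  "marking L1 L2 M \<longleftrightarrow>
     M \<subseteq> stitches L1 L2 \<and>
     (\<forall>s\<in>M. genuine L1 L2 s) \<and>
     subtopology (stitch_space L1 L2) M = discrete_topology M \<and>
     closedin (stitch_space L1 L2) M \<and>
     inj_on fst M \<and> inj_on snd M"

section \<open>Automorphisms\<close>

definition orientation_preserving :: "(complex \<Rightarrow> complex) \<Rightarrow> bool" where
  "orientation_preserving g \<longleftrightarrow>
     (\<forall>a\<in>S1. \<forall>b\<in>S1. \<forall>c\<in>S1. ccw a b c \<longrightarrow> ccw (g a) (g b) (g c))"

text \<open>Self-maps of the circle are represented by functions that are \<open>undefined\<close> outside of it, as
  in the library's group of bijections, which makes equality of maps agree with equality in HOL.\<close>

definition veering_Aut :: "complex set set \<Rightarrow> complex set set \<Rightarrow> (complex \<Rightarrow> complex) monoid" where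
  "veering_Aut L1 L2 = BijGroup S1
     \<lparr>carrier := {g \<in> extensional S1. (\<exists>h. homeomorphism S1 S1 g h) \<and> orientation_preserving g \<and>
                    (`) g ` L1 = L1 \<and> (`) g ` L2 = L2}\<rparr>"

definition stitch_act :: "(complex \<Rightarrow> complex) \<Rightarrow> stitch \<Rightarrow> stitch" where
  "stitch_act g = map_prod ((`) ((`) g)) ((`) ((`) g))"

definition elliptic :: "complex set set \<Rightarrow> complex set set \<Rightarrow> (complex \<Rightarrow> complex) \<Rightarrow> bool" where
  "elliptic L1 L2 g \<longleftrightarrow> g \<in> carrier (veering_Aut L1 L2) \<and> g \<noteq> \<one>\<^bsub>veering_Aut L1 L2\<^esub> \<and>
     (\<exists>n>0. g [^]\<^bsub>veering_Aut L1 L2\<^esub> (n::nat) = \<one>\<^bsub>veering_Aut L1 L2\<^esub>)"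

definition fixed_stitches ::
    "complex set set \<Rightarrow> complex set set \<Rightarrow> (complex \<Rightarrow> complex) set \<Rightarrow> stitch set" where
  "fixed_stitches L1 L2 G =
     {s \<in> stitches L1 L2. \<exists>g\<in>G. elliptic L1 L2 g \<and> group.ord (veering_Aut L1 L2) g = 2 \<and>
        stitch_act g s = s}"

section \<open>The definitions are well formed\<close>

lemma Arg2pi_cis: "0 \<le> t \<Longrightarrow> t < 2 * pi \<Longrightarrow> Arg2pi (cis t) = t"
  by (rule Arg2pi_unique[of 1]) (simp_all add: cis_conv_exp)

lemma cis_Arg2pi: "z \<in> S1 \<Longrightarrow> cis (Arg2pi z) = z"
  using complex_norm_eq_1_exp[of z] by (simp add: cis_conv_exp)

lemma S1_divide: "a \<in> S1 \<Longrightarrow> b \<in> S1 \<Longrightarrow> b / a \<in> S1"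
  by (simp add: norm_divide)

lemma Arg2pi_change_base:
  assumes "a \<in> S1" "b \<in> S1" "c \<in> S1"
  shows "Arg2pi (c / b) = (if Arg2pi (b / a) \<le> Arg2pi (c / a)
           then Arg2pi (c / a) - Arg2pi (b / a) else Arg2pi (c / a) - Arg2pi (b / a) + 2 * pi)"
proof -
  let ?s = "Arg2pi (b / a)" and ?t = "Arg2pi (c / a)"
  have "c / b = (c / a) / (b / a)" using assms by (auto simp: field_simps)
  also have "\<dots> = cis (?t - ?s)"
    using cis_Arg2pi[OF S1_divide[OF assms(1,2)]] cis_Arg2pi[OF S1_divide[OF assms(1,3)]]
    by (metis cis_divide)
  finally have 1: "c / b = cis (?t - ?s)" .
  have 2: "cis (?t - ?s) = cis (?t - ?s + 2 * pi)"
    by (simp add: complex_eq_iff)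
  show ?thesis
  proof (cases "?s \<le> ?t")
    case True
    then show ?thesis
      using Arg2pi_cis[of "?t - ?s"] 1 Arg2pi_lt_2pi[of "c / a"] Arg2pi_ge_0[of "b / a"] by simp
  next
    case False
    then show ?thesis
      using Arg2pi_cis[of "?t - ?s + 2 * pi"] 1 2 Arg2pi_lt_2pi[of "b / a"] Arg2pi_ge_0[of "c / a"]
      by simp
  qed
qed

lemma Arg2pi_divide_inj:
  assumes "a \<in> S1" "b \<in> S1" "c \<in> S1" "Arg2pi (b / a) = Arg2pi (c / a)"
  shows "b = c"
proof -
  have "b / a = c / a" using assms by (metis S1_divide cis_Arg2pi)
  then show ?thesis using assms by auto
qed

lemma ccw_distinct:
  assumes "a \<in> S1" "b \<in> S1" "c \<in> S1" "ccw a b c"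
  shows "a \<noteq> b \<and> b \<noteq> c \<and> a \<noteq> c"
proof -
  have "Arg2pi (a / a) = 0" using assms by (auto simp: Arg2pi_eq_0)
  then show ?thesis
    using assms(4) unfolding ccw_def by (metis Arg2pi_ge_0 less_irrefl not_le)
qed

lemma ccw_total:
  assumes "a \<in> S1" "b \<in> S1" "c \<in> S1" "a \<noteq> b" "b \<noteq> c" "a \<noteq> c"
  shows "ccw a b c \<longleftrightarrow> \<not> ccw a c b"
proof -
  have "Arg2pi (a / a) = 0" using assms by (auto simp: Arg2pi_eq_0)
  then have "Arg2pi (b / a) \<noteq> 0" "Arg2pi (c / a) \<noteq> 0" "Arg2pi (b / a) \<noteq> Arg2pi (c / a)"
    using assms Arg2pi_divide_inj by metis+
  then show ?thesis
    unfolding ccw_def using Arg2pi_ge_0[of "b / a"] Arg2pi_ge_0[of "c / a"] by linarith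
qed

lemma ccw_rotate:
  assumes "a \<in> S1" "b \<in> S1" "c \<in> S1" "ccw a b c"
  shows "ccw b c a"
proof -
  have "Arg2pi (a / a) = 0" using assms by (auto simp: Arg2pi_eq_0)
  then show ?thesis
    using assms(4) Arg2pi_change_base[OF assms(1,2,3)] Arg2pi_change_base[OF assms(1,2,1)]
      Arg2pi_lt_2pi[of "c / a"] unfolding ccw_def by simp
qed

lemma ivl_inject:
  assumes "u \<in> S1" "v \<in> S1" "x \<in> S1" "y \<in> S1" "u \<noteq> v" "x \<noteq> y" and eq: "ivl u v = ivl x y"
  shows "u = x \<and> v = y"
proof -
  define V X Y where "V = Arg2pi (v / u)" and "X = Arg2pi (x / u)" and "Y = Arg2pi (y / u)"
  have u0: "Arg2pi (u / u) = 0" using assms by (auto simp: Arg2pi_eq_0)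
  have bounds: "0 \<le> V" "V < 2 * pi" "0 \<le> X" "X < 2 * pi" "0 \<le> Y" "Y < 2 * pi"
    unfolding V_def X_def Y_def using Arg2pi_ge_0 Arg2pi_lt_2pi by auto
  have V: "V > 0" using assms u0 Arg2pi_divide_inj[of u u v] bounds unfolding V_def by force
  have XY: "X \<noteq> Y" using assms Arg2pi_divide_inj[of u x y] unfolding X_def Y_def by blast
  have mem: "0 < t \<and> t < V \<longleftrightarrow>
      (let d = (if X \<le> t then t - X else t - X + 2 * pi);
           e = (if X \<le> Y then Y - X else Y - X + 2 * pi) in 0 < d \<and> d < e)"
    if t: "0 \<le> t" "t < 2 * pi" for t
  proof -
    define z where "z = u * cis t"
    have z: "z \<in> S1" using assms by (simp add: z_def norm_mult)
    have zt: "Arg2pi (z / u) = t" using assms t Arg2pi_cis by (auto simp: z_def)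
    have "z \<in> ivl u v \<longleftrightarrow> z \<in> ivl x y" using eq by simp
    then show ?thesis
      using z zt Arg2pi_change_base[OF assms(1,3) z] Arg2pi_change_base[OF assms(1,3,4)]
      unfolding ivl_def ccw_def V_def[symmetric] X_def[symmetric] Y_def[symmetric]
      by (simp add: Let_def)
  qed
  have X0: "X = 0"
  proof (rule ccontr)
    assume "X \<noteq> 0"
    then have X: "X > 0" using bounds by simp
    define t where "t = min X V / 2"
    have t: "0 < t" "t < X" "t < V" "t < 2 * pi"
      using X V bounds by (auto simp: t_def min_def)
    from mem[of t] mem[of 0] t X XY bounds show False
      by (simp add: Let_def split: if_splits)
  qed
  have "V = Y"
  proof (rule ccontr)
    assume "V \<noteq> Y"
    then show False
      using mem[of "(V + Y) / 2"] X0 XY V bounds by (cases "V < Y") (simp_all add: Let_def)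
  qed
  then show ?thesis
    using X0 u0 assms Arg2pi_divide_inj[of u u x] Arg2pi_divide_inj[of u v y]
    unfolding V_def X_def Y_def by metis
qed

lemma dual_ivl:
  assumes "u \<in> S1" "v \<in> S1" "u \<noteq> v"
  shows "dual (ivl u v) = ivl v u"
  unfolding dual_def
proof (rule the_equality)
  show "\<exists>u'\<in>S1. \<exists>v'\<in>S1. u' \<noteq> v' \<and> ivl u v = ivl u' v' \<and> ivl v u = ivl v' u'"
    using assms by blast
  fix J assume "\<exists>u'\<in>S1. \<exists>v'\<in>S1. u' \<noteq> v' \<and> ivl u v = ivl u' v' \<and> J = ivl v' u'"
  then show "J = ivl v u" using assms ivl_inject by blast
qed

lemma vertices_leaf_ivl:
  assumes "u \<in> S1" "v \<in> S1" "u \<noteq> v"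
  shows "vertices (leaf (ivl u v)) = {u, v}"
proof -
  have "z \<in> ivl u v \<or> z \<in> ivl v u" if "z \<in> S1" "z \<noteq> u" "z \<noteq> v" for z
    using that assms ccw_total[of u z v] ccw_rotate[of u v z] unfolding ivl_def by auto
  moreover have "u \<notin> ivl u v" "v \<notin> ivl u v" "u \<notin> ivl v u" "v \<notin> ivl v u"
    using assms ccw_distinct unfolding ivl_def by blast+
  ultimately show ?thesis
    using assms unfolding vertices_def leaf_def dual_ivl[OF assms] by blast
qed

lemma openin_two_point_space:
  "openin two_point_space U \<longleftrightarrow> U \<subseteq> (\<lambda>(x, y). {x, y}) ` ordered_pairs \<and>
     openin (top_of_set ordered_pairs) {p \<in> ordered_pairs. (case p of (x, y) \<Rightarrow> {x, y}) \<in> U}"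
proof -
  let ?f = "\<lambda>(x::complex, y). {x, y}"
  let ?P = "\<lambda>U. U \<subseteq> ?f ` ordered_pairs \<and>
     openin (top_of_set ordered_pairs) {p \<in> ordered_pairs. ?f p \<in> U}"
  have "istopology ?P"
    unfolding istopology_def
  proof (intro conjI allI impI)
    fix S T assume "?P S" "?P T"
    moreover have "{p \<in> ordered_pairs. ?f p \<in> S \<inter> T} =
        {p \<in> ordered_pairs. ?f p \<in> S} \<inter> {p \<in> ordered_pairs. ?f p \<in> T}" by blast
    ultimately show "S \<inter> T \<subseteq> ?f ` ordered_pairs"
      "openin (top_of_set ordered_pairs) {p \<in> ordered_pairs. ?f p \<in> S \<inter> T}"
      by (auto intro: openin_Int)
  next
    fix K assume K: "\<forall>S\<in>K. ?P S"
    have "{p \<in> ordered_pairs. ?f p \<in> \<Union>K} = (\<Union>S\<in>K. {p \<in> ordered_pairs. ?f p \<in> S})" by blast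
    moreover have "openin (top_of_set ordered_pairs) (\<Union>S\<in>K. {p \<in> ordered_pairs. ?f p \<in> S})"
      using K by blast
    ultimately show "openin (top_of_set ordered_pairs) {p \<in> ordered_pairs. ?f p \<in> \<Union>K}" by metis
    show "\<Union>K \<subseteq> ?f ` ordered_pairs" using K by blast
  qed
  then show ?thesis unfolding two_point_space_def by (simp add: topology_inverse')
qed

lemma quotient_map_two_point_space:
  "quotient_map (top_of_set ordered_pairs) two_point_space (\<lambda>(x, y). {x, y})"
proof -
  let ?f = "\<lambda>(x::complex, y). {x, y}"
  have "{p \<in> ordered_pairs. ?f p \<in> ?f ` ordered_pairs} = ordered_pairs" by blast
  then have "openin two_point_space (?f ` ordered_pairs)"
    unfolding openin_two_point_space by simp
  then have "?f ` ordered_pairs \<subseteq> topspace two_point_space"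
    by (rule openin_subset)
  moreover have "topspace two_point_space \<subseteq> ?f ` ordered_pairs"
    using openin_topspace[of two_point_space] unfolding openin_two_point_space by (rule conjunct1)
  ultimately have "?f ` ordered_pairs = topspace two_point_space"
    by (rule subset_antisym)
  then show ?thesis
    unfolding quotient_map_def topspace_euclidean_subtopology openin_two_point_space by blast
qed



lemma orientation_preserving_inverse:
  assumes h: "homeomorphism S1 S1 g h" and g: "orientation_preserving g"
  shows "orientation_preserving h"
  unfolding orientation_preserving_def
proof (intro ballI impI)
  fix a b c assume abc: "a \<in> S1" "b \<in> S1" "c \<in> S1" "ccw a b c"
  have S: "h a \<in> S1" "h b \<in> S1" "h c \<in> S1" and gh: "g (h a) = a" "g (h b) = b" "g (h c) = c"
    using h abc(1-3) unfolding homeomorphism_def by blast+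
  have "a \<noteq> b \<and> b \<noteq> c \<and> a \<noteq> c" by (rule ccw_distinct[OF abc])
  then have ne: "h a \<noteq> h b" "h b \<noteq> h c" "h a \<noteq> h c" using gh by auto
  show "ccw (h a) (h b) (h c)"
  proof (rule ccontr)
    assume "\<not> ccw (h a) (h b) (h c)"
    then have "ccw (h a) (h c) (h b)" using ccw_total[OF S ne] by blast
    then have "ccw a c b" using g S gh unfolding orientation_preserving_def by metis
    then show False
      using abc ccw_total[of a b c] ccw_distinct[OF abc] by blast
  qed
qed

lemma group_veering_Aut:
  assumes "lamination_system L1" "lamination_system L2"
  shows "group (veering_Aut L1 L2)"
proof -
  define H where "H = {g \<in> extensional S1. (\<exists>h. homeomorphism S1 S1 g h) \<and>
      orientation_preserving g \<and> (`) g ` L1 = L1 \<and> (`) g ` L2 = L2}"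
  have sub: "I \<subseteq> S1" if "I \<in> L1 \<or> I \<in> L2" for I
  proof -
    have "good_interval I" using that assms unfolding lamination_system_def by metis
    then show ?thesis unfolding good_interval_def ivl_def by auto
  qed
  have H_Bij: "g \<in> Bij S1" if "g \<in> H" for g
  proof -
    obtain h where "homeomorphism S1 S1 g h" using \<open>g \<in> H\<close> unfolding H_def by blast
    then have "bij_betw g S1 S1"
      unfolding homeomorphism_def by (intro bij_betw_byWitness[where f' = h]) auto
    then show ?thesis using that unfolding H_def Bij_def by blast
  qed
  interpret B: group "BijGroup S1" by (rule group_BijGroup)
  have "subgroup H (BijGroup S1)"
  proof (rule B.subgroupI)
    show "H \<subseteq> carrier (BijGroup S1)" using H_Bij by (auto simp: BijGroup_def)
    have id: "(`) (\<lambda>x\<in>S1. x) ` L = L" if "L = L1 \<or> L = L2" for L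
    proof -
      have "(\<lambda>x\<in>S1. x) ` I = I" if "I \<in> L" for I
        using sub[of I] \<open>L = L1 \<or> L = L2\<close> that by force
      then show ?thesis by force
    qed
    have "homeomorphism S1 S1 (\<lambda>x\<in>S1. x) (\<lambda>x. x)"
      by (rule homeomorphism_cong[OF homeomorphism_ident]) auto
    then have "(\<lambda>x\<in>S1. x) \<in> H"
      using id unfolding H_def orientation_preserving_def by auto
    then show "H \<noteq> {}" by blast
  next
    fix g assume g: "g \<in> H"
    then obtain h where h: "homeomorphism S1 S1 g h" unfolding H_def by blast
    define k where "k = restrict h S1"
    have hk: "homeomorphism S1 S1 g k"
      by (rule homeomorphism_cong[OF h]) (auto simp: k_def)
    then have kg: "\<And>x. x \<in> S1 \<Longrightarrow> k (g x) = x" and gk: "\<And>x. x \<in> S1 \<Longrightarrow> g (k x) = x"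
      unfolding homeomorphism_def by auto
    have inv: "(`) k ` L = L" if L: "L = L1 \<or> L = L2" for L
    proof -
      have gL: "(`) g ` L = L" using g L unfolding H_def by blast
      have "k ` g ` I = I" if "I \<in> L" for I
      proof -
        have "I \<subseteq> S1" using sub L that by blast
        then have "k ` g ` I = (\<lambda>x. x) ` I"
          unfolding image_image by (intro image_cong refl kg) blast
        then show ?thesis by simp
      qed
      then have "(`) k ` (`) g ` L = (\<lambda>x. x) ` L"
        unfolding image_image[of "(`) k"] by (intro image_cong refl)
      then have "(`) k ` (`) g ` L = L" by simp
      then show ?thesis using gL by simp
    qed
    have kH: "k \<in> H"
      using inv orientation_preserving_inverse[OF hk] homeomorphism_symD[OF hk] g
      unfolding H_def k_def by auto
    have "compose S1 k g = (\<lambda>x\<in>S1. x)" using kg by (auto simp: compose_def)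
    then have "k \<otimes>\<^bsub>BijGroup S1\<^esub> g = \<one>\<^bsub>BijGroup S1\<^esub>"
      using H_Bij[OF g] H_Bij[OF kH] by (simp add: BijGroup_def)
    then have "inv\<^bsub>BijGroup S1\<^esub> g = k"
      using H_Bij[OF g] H_Bij[OF kH] by (intro B.inv_equality) (simp_all add: BijGroup_def)
    then show "inv\<^bsub>BijGroup S1\<^esub> g \<in> H" using kH by simp
  next
    fix g f assume gf: "g \<in> H" "f \<in> H"
    obtain g' f' where h: "homeomorphism S1 S1 g g'" "homeomorphism S1 S1 f f'"
      using gf unfolding H_def by auto
    have "homeomorphism S1 S1 (compose S1 g f) (f' \<circ> g')"
      by (rule homeomorphism_cong[OF homeomorphism_compose[OF h(2,1)]]) (simp_all add: compose_def)
    moreover have "f x \<in> S1" if "x \<in> S1" for x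
      using h(2) that unfolding homeomorphism_def by blast
    then have "orientation_preserving (compose S1 g f)"
      using gf unfolding H_def orientation_preserving_def compose_def
      by (simp del: mem_sphere_0)
    moreover have im: "(`) (compose S1 g f) ` L = L" if L: "L = L1 \<or> L = L2" for L
    proof -
      have "(`) g ` L = L" "(`) f ` L = L" using gf L unfolding H_def mem_Collect_eq by metis+
      then have "(`) g ` (`) f ` L = L" by simp
      have "compose S1 g f ` I = g ` f ` I" if "I \<in> L" for I
      proof -
        have "I \<subseteq> S1" using sub L that by blast
        then show ?thesis
          unfolding image_image by (intro image_cong refl) (auto simp: compose_def)
      qed
      then have "(`) (compose S1 g f) ` L = (`) g ` (`) f ` L"
        unfolding image_image[of "(`) g" "(`) f" L] by (rule image_cong[OF refl])
      with \<open>(`) g ` (`) f ` L = L\<close> show ?thesis by simp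
    qed
    ultimately have "compose S1 g f \<in> H"
      unfolding H_def mem_Collect_eq
      by (intro conjI exI[of _ "f' \<circ> g'"] im disjI1 disjI2 refl compose_extensional)
    then show "g \<otimes>\<^bsub>BijGroup S1\<^esub> f \<in> H"
      using gf H_Bij by (simp add: BijGroup_def)
  qed
  then show ?thesis
    unfolding veering_Aut_def H_def[symmetric] by (rule B.subgroup_imp_group)
qed

end

theory Submission
  imports Defs
begin

text \<open>
  An order 2 automorphism has no fixed point on the circle, so it flips every leaf it preserves. If
  such a leaf were isolated, the non-leaf gap next to it and its image would be different gaps sharing
  vertices, against looseness; hence the fixed stitches are genuine.

  Leaves of \<open>L2\<close> nest down to every endpoint of \<open>L1\<close> and vice versa. Therefore an automorphism with two
  fixed points on either side of a leaf fixes this leaf: otherwise some complementary arc of its fixed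
  point set would have an endpoint belonging to both laminations. This is applied to the product of
  two involutions flipping different stitches. If the stitches share a leaf, this leaf is real and
  the product fixes a further point on each of its sides. If infinitely many flipped stitches
  accumulate, the involutions flipping them agree on the ends of two consecutive leaves crossing the
  limit stitch, which provides the fixed points. Both cases force the stitches to be equal, so the set
  of fixed stitches is discrete and closed, and both projections are injective on it.
\<close>

subsection \<open>The cyclic order of the circle\<close>

text \<open>Every stitch of the stitch space, flipped or not, is shown to have a neighbourhood
  containing no other flipped stitch; this gives discreteness and closedness at once. The obstacle
  is that the involutions flipping nearby stitches need not be equicontinuous. Only a pointwise
  limit is at hand, obtained from compactness of a product over all points of the circle (hence
  filters in place of subsequences), and it may collapse whole arcs. It is therefore evaluated only
  at ends of leaves, and the danger is that such an end is sent to an end of the limit stitch. For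
  each lamination one of the two opposite directions is free of this danger; the four possible
  combinations are quarter turns of one picture, a turn exchanging the two laminations. Two fixed
  points on each side of a leaf are asked for because an increasing union of elements of a
  lamination system is known to be an element only if at least two points stay outside: otherwise it
  may be the circle minus a point.\<close>

definition cyc :: "real \<Rightarrow> real \<Rightarrow> real \<Rightarrow> bool" where
  "cyc a b c \<longleftrightarrow> a < b \<and> b < c \<or> b < c \<and> c < a \<or> c < a \<and> a < b"

text \<open>Measuring angles from any base point turns a question about the circular order of
  finitely many points into linear arithmetic on reals. Together with \<open>S1_eq_iff\<close> for
  equality and \<open>mem_ivl_cyc\<close> for intervals, this settles all later order
  configurations.\<close>

lemma ccw_cyc:
  assumes "o' \<in> S1" "x \<in> S1" "y \<in> S1" "z \<in> S1"
  shows "ccw x y z \<longleftrightarrow> cyc (Arg2pi (x / o')) (Arg2pi (y / o')) (Arg2pi (z / o'))"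
  using Arg2pi_change_base[OF assms(1,2,3)] Arg2pi_change_base[OF assms(1,2,4)]
    Arg2pi_ge_0[of "x / o'"] Arg2pi_ge_0[of "y / o'"] Arg2pi_ge_0[of "z / o'"]
    Arg2pi_lt_2pi[of "x / o'"] Arg2pi_lt_2pi[of "y / o'"] Arg2pi_lt_2pi[of "z / o'"]
  unfolding ccw_def cyc_def by (auto split: if_splits)

lemma S1_eq_iff:
  assumes "o' \<in> S1" "x \<in> S1" "y \<in> S1"
  shows "x = y \<longleftrightarrow> Arg2pi (x / o') = Arg2pi (y / o')"
  using Arg2pi_divide_inj[OF assms] by blast

lemma mem_ivl_cyc:
  assumes "o' \<in> S1" "x \<in> S1" "y \<in> S1" "z \<in> S1"
  shows "y \<in> ivl x z \<longleftrightarrow> cyc (Arg2pi (x / o')) (Arg2pi (y / o')) (Arg2pi (z / o'))"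
  using ccw_cyc[OF assms] assms(3) by (simp add: ivl_def)

lemma mem_ivl_ccw: "y \<in> ivl x z \<longleftrightarrow> y \<in> S1 \<and> ccw x y z"
  by (simp add: ivl_def)

lemma ivl_subset_S1: "ivl x y \<subseteq> S1"
  by (auto simp: ivl_def)

lemma Arg2pi_surj:
  assumes "o' \<in> S1" "0 \<le> t" "t < 2 * pi"
  obtains z where "z \<in> S1" "Arg2pi (z / o') = t"
proof
  show "o' * cis t \<in> S1" using assms by (simp add: norm_mult)
  show "Arg2pi (o' * cis t / o') = t" using assms Arg2pi_cis by auto
qed

lemma Arg2pi_self: "x \<in> S1 \<Longrightarrow> Arg2pi (x / x) = 0"
  by (auto simp: Arg2pi_eq_0)

lemma ivl_nonempty:
  assumes "x \<in> S1" "y \<in> S1" "x \<noteq> y"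
  obtains z where "z \<in> ivl x y"
proof -
  let ?t = "Arg2pi (y / x)"
  have t: "0 < ?t"
    using Arg2pi_divide_inj[of x x y] Arg2pi_self[of x] Arg2pi_ge_0[of "y / x"] assms by force
  have "0 \<le> ?t / 2" "?t / 2 < 2 * pi" using t Arg2pi_lt_2pi[of "y / x"] by auto
  then obtain z where z: "z \<in> S1" "Arg2pi (z / x) = ?t / 2"
    using Arg2pi_surj[OF assms(1)] by blast
  have "z \<in> ivl x y"
    unfolding mem_ivl_cyc[OF assms(1,1) z(1) assms(2)] using z t Arg2pi_self[OF assms(1)]
    by (simp add: cyc_def)
  then show thesis using that by blast
qed

lemma not_ccw_iff:
  assumes "a \<in> S1" "b \<in> S1" "c \<in> S1"
  shows "\<not> ccw a b c \<longleftrightarrow> a = b \<or> b = c \<or> a = c \<or> ccw a c b"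
  using assms ccw_total ccw_distinct by blast

lemma ivl_cases:
  assumes "x \<in> S1" "y \<in> S1" "z \<in> S1"
  obtains "z = x" | "z = y" | "x = y" | "z \<in> ivl x y" | "z \<in> ivl y x"
  using assms not_ccw_iff[of x z y] ccw_rotate unfolding ivl_def by blast

lemma disjoint_ivl_swap: "x \<in> S1 \<Longrightarrow> y \<in> S1 \<Longrightarrow> ivl x y \<inter> ivl y x = {}"
  unfolding ivl_def using ccw_rotate ccw_total ccw_distinct by blast

lemma endpoints_notin_ivl [simp]:
  assumes "x \<in> S1" "y \<in> S1"
  shows "x \<notin> ivl x y" "y \<notin> ivl x y"
  using assms ccw_distinct unfolding ivl_def by blast+

lemma ivl_refl: "x \<in> S1 \<Longrightarrow> ivl x x = {}"
  unfolding ivl_def using ccw_distinct by blast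

subsection \<open>Good intervals\<close>

lemma good_ivl: "x \<in> S1 \<Longrightarrow> y \<in> S1 \<Longrightarrow> x \<noteq> y \<Longrightarrow> good_interval (ivl x y)"
  unfolding good_interval_def by blast

lemma good_cases:
  assumes "good_interval I"
  obtains x y where "x \<in> S1" "y \<in> S1" "x \<noteq> y" "I = ivl x y" "dual I = ivl y x"
  using assms dual_ivl unfolding good_interval_def by metis

lemma good_subset_S1: "good_interval I \<Longrightarrow> I \<subseteq> S1"
  by (metis good_cases ivl_subset_S1)

lemma good_dual [simp]: "good_interval I \<Longrightarrow> good_interval (dual I)"
  by (metis good_cases good_ivl)

lemma dual_dual [simp]: "good_interval I \<Longrightarrow> dual (dual I) = I"
  by (metis good_cases dual_ivl)

lemma good_nonempty: "good_interval I \<Longrightarrow> I \<noteq> {}"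
  by (metis good_cases ivl_nonempty empty_iff)

lemma dual_disjoint: "good_interval I \<Longrightarrow> I \<inter> dual I = {}"
  by (metis good_cases disjoint_ivl_swap)

lemma good_neq_dual: "good_interval I \<Longrightarrow> I \<noteq> dual I"
  using dual_disjoint good_nonempty by fastforce

lemma ivl_subset_ivl_dual:
  assumes S: "x \<in> S1" "y \<in> S1" "u \<in> S1" "v \<in> S1" and ne: "x \<noteq> y" "u \<noteq> v"
    and disj: "ivl x y \<inter> ivl u v = {}"
  shows "ivl x y \<subseteq> ivl v u"
proof
  fix z assume z: "z \<in> ivl x y"
  then have zS: "z \<in> S1" and xzy: "ccw x z y" by (simp_all add: ivl_def)
  have "z \<notin> ivl u v" using z disj by blast
  moreover have "z \<noteq> u"
  proof
    assume zu: "z = u"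
    have "u \<noteq> y" using z zu S by auto
    \<comment> \<open>The first of \<open>y\<close> and \<open>v\<close> met counter-clockwise from
      \<open>u\<close>, so that \<open>ivl u e\<close> lies in both intervals.\<close>
    define e where "e = (if ccw u y v then y else v)"
    have e: "e \<in> S1" "u \<noteq> e" using S ne \<open>u \<noteq> y\<close> by (auto simp: e_def)
    then obtain w where "w \<in> ivl u e" using ivl_nonempty S by blast
    then have wS: "w \<in> S1" and "ccw u w e" by (simp_all add: ivl_def)
    then have "ccw u w v \<and> ccw x w y"
      using xzy S ne \<open>u \<noteq> y\<close> unfolding zu e_def
      by (cases "ccw u y v"; simp only: if_True if_False ccw_cyc[OF S(3)] S1_eq_iff[OF S(3)] cyc_def; smt (verit))
    then show False using disj wS by (auto simp: ivl_def)
  qed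
  moreover have "z \<noteq> v"
  proof
    assume zv: "z = v"
    have "v \<noteq> x" using z zv S by auto
    define e where "e = (if ccw u x v then x else u)"
    have e: "e \<in> S1" "e \<noteq> v" using S ne \<open>v \<noteq> x\<close> by (auto simp: e_def)
    then obtain w where "w \<in> ivl e v" using ivl_nonempty S by blast
    then have wS: "w \<in> S1" and "ccw e w v" by (simp_all add: ivl_def)
    then have "ccw u w v \<and> ccw x w y"
      using xzy S ne \<open>v \<noteq> x\<close> unfolding zv e_def
      by (cases "ccw u x v"; simp only: if_True if_False ccw_cyc[OF S(3)] S1_eq_iff[OF S(3)] cyc_def; smt (verit))
    then show False using disj wS by (auto simp: ivl_def)
  qed
  ultimately show "z \<in> ivl v u" using ivl_cases[OF S(3,4) zS] ne by blast
qed

lemma good_disjoint_imp_subset_dual: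
  assumes "good_interval I" "good_interval J" "I \<inter> J = {}"
  shows "I \<subseteq> dual J"
  using assms ivl_subset_ivl_dual by (metis good_cases)

lemma dual_antimono:
  assumes "good_interval I" "good_interval J" "I \<subseteq> J"
  shows "dual J \<subseteq> dual I"
  using assms dual_disjoint[OF assms(2)] by (intro good_disjoint_imp_subset_dual) auto

lemma dual_subset_iff:
  assumes "good_interval I" "good_interval J"
  shows "dual J \<subseteq> dual I \<longleftrightarrow> I \<subseteq> J"
  using assms dual_antimono[of I J] dual_antimono[of "dual J" "dual I"] by auto

lemma ivl_around_subset:
  assumes S: "p \<in> S1" "x \<in> S1" "y \<in> S1" "u \<in> S1" "v \<in> S1"
    and "p \<in> ivl x y" "p \<in> ivl u v" "u \<notin> ivl x y" "v \<notin> ivl x y"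
  shows "ivl x y \<subseteq> ivl u v"
proof
  fix z assume z: "z \<in> ivl x y"
  then have "z \<in> S1" using ivl_subset_S1 by blast
  then show "z \<in> ivl u v"
    using z assms
    by (simp only: mem_ivl_cyc[OF S(1)] cyc_def) (smt (verit))
qed

lemma vertices_leaf_good:
  assumes "good_interval I"
  shows "vertices (leaf I) = S1 - I - dual I"
  unfolding vertices_def leaf_def by auto

lemma leaf_dual [simp]: "good_interval I \<Longrightarrow> leaf (dual I) = leaf I"
  unfolding leaf_def by auto

lemma leaf_eq_iff:
  assumes "good_interval I" "good_interval J"
  shows "leaf I = leaf J \<longleftrightarrow> I = J \<or> I = dual J"
  using assms dual_dual unfolding leaf_def by (metis doubleton_eq_iff)

subsection \<open>Limits and the cyclic order\<close>

text \<open>\<open>Arg2pi\<close> jumps only along the nonnegative real axis, which the unit circle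
  meets only at 1; this is where \<open>a \<noteq> b\<close> enters.\<close>

lemma tendsto_Arg2pi_divide:
  assumes "(x \<longlongrightarrow> a) F" "(y \<longlongrightarrow> b) F" "a \<in> S1" "b \<in> S1" "a \<noteq> b"
  shows "((\<lambda>k. Arg2pi (y k / x k)) \<longlongrightarrow> Arg2pi (b / a)) F"
proof -
  have "b / a \<notin> \<real>\<^sub>\<ge>\<^sub>0"
  proof
    assume "b / a \<in> \<real>\<^sub>\<ge>\<^sub>0"
    then obtain r where r: "b / a = of_real r" "r \<ge> 0" by (auto simp: nonneg_Reals_def)
    have "norm (b / a) = 1" using assms by (simp add: norm_divide)
    then have "r = 1" using r by simp
    then show False using r assms by auto
  qed
  then have "isCont Arg2pi (b / a)" using continuous_at_Arg2pi by blast
  moreover have "((\<lambda>k. y k / x k) \<longlongrightarrow> b / a) F"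
    using assms by (intro tendsto_divide) auto
  ultimately show ?thesis using isCont_tendsto_compose by blast
qed

lemma eventually_ccw:
  assumes "(x \<longlongrightarrow> a) F" "(y \<longlongrightarrow> b) F" "(z \<longlongrightarrow> c) F" "a \<in> S1" "b \<in> S1" "c \<in> S1" "ccw a b c"
  shows "\<forall>\<^sub>F k in F. ccw (x k) (y k) (z k)"
proof -
  have ne: "a \<noteq> b" "a \<noteq> c" using assms ccw_distinct by blast+
  have 1: "((\<lambda>k. Arg2pi (y k / x k)) \<longlongrightarrow> Arg2pi (b / a)) F"
    and 2: "((\<lambda>k. Arg2pi (z k / x k)) \<longlongrightarrow> Arg2pi (c / a)) F"
    using assms ne by (auto intro!: tendsto_Arg2pi_divide)
  have 3: "((\<lambda>k. Arg2pi (z k / x k) - Arg2pi (y k / x k)) \<longlongrightarrow> Arg2pi (c / a) - Arg2pi (b / a)) F"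
    by (intro tendsto_diff 1 2)
  have "\<forall>\<^sub>F k in F. 0 < Arg2pi (y k / x k)"
    using order_tendstoD(1)[OF 1] assms(7) unfolding ccw_def by blast
  moreover have "\<forall>\<^sub>F k in F. 0 < Arg2pi (z k / x k) - Arg2pi (y k / x k)"
    by (rule order_tendstoD(1)[OF 3]) (use assms(7) in \<open>simp add: ccw_def\<close>)
  ultimately show ?thesis by eventually_elim (simp add: ccw_def)
qed

lemma openin_good:
  assumes "good_interval I"
  shows "openin (top_of_set S1) I"
proof (subst openin_subopen, intro ballI)
  fix z assume z: "z \<in> I"
  obtain x y where I: "x \<in> S1" "y \<in> S1" "I = ivl x y" using assms good_cases by metis
  then have zS: "z \<in> S1" "ccw x z y" using z by (auto simp: ivl_def)
  have "\<forall>\<^sub>F w in nhds z. ccw x w y"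
    by (rule eventually_ccw[where a = x and b = z and c = y])
      (use I zS in \<open>auto simp: filterlim_ident simp del: mem_sphere_0\<close>)
  then obtain T where T: "open T" "z \<in> T" "\<forall>w\<in>T. ccw x w y"
    unfolding eventually_nhds by blast
  show "\<exists>T. openin (top_of_set S1) T \<and> z \<in> T \<and> T \<subseteq> I"
    using T zS(1) I(3) by (intro exI[of _ "S1 \<inter> T"]) (auto simp: ivl_def openin_open)
qed

section \<open>Unions of chains of good intervals, seen after cutting the circle open at a
  point\<close>

lemma good_angles:
  assumes "good_interval J" "q \<in> S1" "q \<notin> J"
  obtains \<alpha> \<beta> where "0 \<le> \<alpha>" "\<alpha> < \<beta>" "\<beta> \<le> 2 * pi"
    "J = {z \<in> S1. \<alpha> < Arg2pi (z / q) \<and> Arg2pi (z / q) < \<beta>}"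
proof -
  obtain x y where J: "x \<in> S1" "y \<in> S1" "x \<noteq> y" "J = ivl x y" using assms good_cases by metis
  let ?A = "\<lambda>z. Arg2pi (z / q)"
  have b: "0 \<le> ?A z" "?A z < 2 * pi" for z using Arg2pi_ge_0 Arg2pi_lt_2pi by auto
  have "?A q = 0" using assms Arg2pi_self by blast
  moreover have "?A x \<noteq> ?A y" using J S1_eq_iff assms by blast
  moreover have "\<not> cyc (?A x) (?A q) (?A y)" using assms J mem_ivl_cyc by blast
  ultimately have "?A y = 0 \<or> ?A x < ?A y"
    using b[of x] b[of y] unfolding cyc_def by linarith
  moreover have "J = {z \<in> S1. cyc (?A x) (?A z) (?A y)}"
    using J mem_ivl_cyc[OF assms(2) J(1) _ J(2)] ivl_subset_S1[of x y] by blast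
  \<comment> \<open>An interval that ends at the cut point has right end at angle 0; recording it as
    \<open>2 * pi\<close> makes the interval linear.\<close>
  moreover define \<beta> where "\<beta> = (if ?A y = 0 then 2 * pi else ?A y)"
  ultimately have "cyc (?A x) (?A z) (?A y) \<longleftrightarrow> ?A x < ?A z \<and> ?A z < \<beta>" for z
    using b[of z] b[of x] b[of y] \<open>?A x \<noteq> ?A y\<close> by (auto simp: cyc_def)
  moreover have "?A x < \<beta>" "\<beta> \<le> 2 * pi"
    using \<open>?A y = 0 \<or> ?A x < ?A y\<close> b[of x] b[of y] by (auto simp: \<beta>_def)
  ultimately show thesis
    using that[of "?A x" \<beta>] b[of x] \<open>J = {z \<in> S1. cyc (?A x) (?A z) (?A y)}\<close> by presburger
qed

text \<open>Only the full range from 0 to \<open>2 * pi\<close> fails to be a good interval: both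
  its ends are the cut point.\<close>

lemma angles_good:
  assumes "q \<in> S1" "0 \<le> \<alpha>" "\<alpha> < \<beta>" "\<beta> \<le> 2 * pi"
    and "J = {z \<in> S1. \<alpha> < Arg2pi (z / q) \<and> Arg2pi (z / q) < \<beta>}"
  shows "good_interval J \<or> J = S1 - {q}"
proof -
  let ?A = "\<lambda>z. Arg2pi (z / q)"
  have b: "0 \<le> ?A z" "?A z < 2 * pi" for z using Arg2pi_ge_0 Arg2pi_lt_2pi by auto
  have q0: "?A q = 0" using assms Arg2pi_self by blast
  show ?thesis
  proof (cases "\<alpha> = 0 \<and> \<beta> = 2 * pi")
    case True
    have "z \<noteq> q \<longleftrightarrow> 0 < ?A z" if "z \<in> S1" for z
      using S1_eq_iff[OF assms(1) that assms(1)] b[of z] q0 by auto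
    then have "z \<in> J \<longleftrightarrow> z \<in> S1 - {q}" for z
      using True b(2)[of z] unfolding assms(5) by (simp del: mem_sphere_0) blast
    then have "J = S1 - {q}" by (simp only: set_eq_iff simp_thms)
    then show ?thesis ..
  next
    case False
    have "\<alpha> < 2 * pi" using assms(3,4) by linarith
    then obtain x where x: "x \<in> S1" "?A x = \<alpha>" using Arg2pi_surj[OF assms(1,2)] by blast
    define \<beta>' where "\<beta>' = (if \<beta> = 2 * pi then 0 else \<beta>)"
    have "0 \<le> \<beta>'" "\<beta>' < 2 * pi" using assms(2-4) by (auto simp: \<beta>'_def)
    then obtain y where y: "y \<in> S1" "?A y = \<beta>'" using Arg2pi_surj[OF assms(1)] by metis
    have "\<alpha> < ?A z \<and> ?A z < \<beta> \<longleftrightarrow> cyc (?A x) (?A z) (?A y)" for z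
      unfolding x(2) y(2) \<beta>'_def using assms(2-4) b[of z] False by (auto simp: cyc_def)
    then have "J = ivl x y"
      using mem_ivl_cyc[OF assms(1) x(1) _ y(1)] ivl_subset_S1[of x y] unfolding assms(5) by blast
    moreover have "\<alpha> \<noteq> \<beta>'" using assms(2-4) False by (auto simp: \<beta>'_def)
    then have "x \<noteq> y" using x(2) y(2) by auto
    ultimately show ?thesis using good_ivl x y by blast
  qed
qed

text \<open>After cutting at \<open>q\<close>, the union runs from the infimum of the left ends to
  the supremum of the right ends. The chain condition is needed to find one member beyond both
  bounds of a given point.\<close>

lemma good_Union_chain:
  assumes good: "\<And>J. J \<in> \<K> \<Longrightarrow> good_interval J" and "\<K> \<noteq> {}"
    and chain: "\<And>I J. I \<in> \<K> \<Longrightarrow> J \<in> \<K> \<Longrightarrow> I \<subseteq> J \<or> J \<subseteq> I"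
    and q: "q \<in> S1" "q \<notin> \<Union>\<K>"
  shows "good_interval (\<Union>\<K>) \<or> \<Union>\<K> = S1 - {q}"
proof -
  let ?A = "\<lambda>z. Arg2pi (z / q)"
  have "\<exists>\<alpha> \<beta>. (0 \<le> \<alpha> \<and> \<alpha> < \<beta> \<and> \<beta> \<le> 2 * pi) \<and> (\<forall>z. z \<in> J \<longleftrightarrow> z \<in> S1 \<and> \<alpha> < ?A z \<and> ?A z < \<beta>)"
    if JK: "J \<in> \<K>" for J
  proof -
    have "q \<notin> J" using JK q(2) by blast
    then obtain \<alpha> \<beta> where "0 \<le> \<alpha>" "\<alpha> < \<beta>" "\<beta> \<le> 2 * pi"
      and J: "J = {z \<in> S1. \<alpha> < ?A z \<and> ?A z < \<beta>}"
      by (rule good_angles[OF good[OF JK] q(1)])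
    then show ?thesis by (intro exI[of _ \<alpha>] exI[of _ \<beta>]) (simp only: J mem_Collect_eq simp_thms)
  qed
  then obtain \<alpha> \<beta>
    where ab: "\<And>J. J \<in> \<K> \<Longrightarrow> 0 \<le> \<alpha> J \<and> \<alpha> J < \<beta> J \<and> \<beta> J \<le> 2 * pi"
      and mem: "\<And>J w. J \<in> \<K> \<Longrightarrow> w \<in> J \<longleftrightarrow> w \<in> S1 \<and> \<alpha> J < ?A w \<and> ?A w < \<beta> J"
    by metis
  define a where "a = Inf (\<alpha> ` \<K>)"
  define b where "b = Sup (\<beta> ` \<K>)"
  have bdd: "bdd_below (\<alpha> ` \<K>)" "bdd_above (\<beta> ` \<K>)"
    using ab by (auto intro!: bdd_belowI2[where m = 0] bdd_aboveI2[where M = "2 * pi"])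
  have le: "a \<le> \<alpha> J" "\<beta> J \<le> b" if "J \<in> \<K>" for J
    using that cINF_lower[OF bdd(1)] cSUP_upper[OF _ bdd(2)] unfolding a_def b_def by fast+
  obtain J0 where J0: "J0 \<in> \<K>" using \<open>\<K> \<noteq> {}\<close> by blast
  have "0 \<le> a" unfolding a_def using \<open>\<K> \<noteq> {}\<close> ab by (intro cINF_greatest) auto
  moreover have "b \<le> 2 * pi" unfolding b_def using \<open>\<K> \<noteq> {}\<close> ab by (intro cSUP_least) auto
  moreover have "a < b" using le[OF J0] ab[OF J0] by linarith
  moreover have "\<Union>\<K> = {z \<in> S1. a < ?A z \<and> ?A z < b}"
  proof (intro equalityI subsetI)
    fix z assume "z \<in> \<Union>\<K>"
    then obtain J where J: "J \<in> \<K>" "z \<in> J" by blast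
    then have "z \<in> S1 \<and> \<alpha> J < ?A z \<and> ?A z < \<beta> J" using mem by blast
    then show "z \<in> {z \<in> S1. a < ?A z \<and> ?A z < b}" using le[OF J(1)] by auto
  next
    fix z assume "z \<in> {z \<in> S1. a < ?A z \<and> ?A z < b}"
    then have z: "z \<in> S1" "a < ?A z" "?A z < b" by auto
    obtain I where I: "I \<in> \<K>" "\<alpha> I < ?A z"
      using z(2) \<open>\<K> \<noteq> {}\<close> cINF_less_iff[OF _ bdd(1)] unfolding a_def by blast
    obtain J where J: "J \<in> \<K>" "?A z < \<beta> J"
      using z(3) \<open>\<K> \<noteq> {}\<close> less_cSUP_iff[OF _ bdd(2)] unfolding b_def by blast
    obtain v w where vw: "v \<in> I" "w \<in> J" using good good_nonempty I(1) J(1) by blast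
    consider "I \<subseteq> J" | "J \<subseteq> I" using chain I(1) J(1) by blast
    then have "z \<in> I \<or> z \<in> J"
    proof cases
      case 1
      then have "v \<in> J" using vw by blast
      then show ?thesis using vw mem[OF I(1)] mem[OF J(1)] I J z by force
    next
      case 2
      then have "w \<in> I" using vw by blast
      then show ?thesis using vw mem[OF I(1)] mem[OF J(1)] I J z by force
    qed
    then show "z \<in> \<Union>\<K>" using I J by blast
  qed
  ultimately show ?thesis by (intro angles_good[OF q(1)])
qed

text \<open>The closure axiom speaks of increasing sequences; the Lindelof property replaces an
  arbitrary chain by a sequence with the same union.\<close>

lemma chain_sequence:
  assumes good: "\<And>J. J \<in> \<K> \<Longrightarrow> good_interval J" and "\<K> \<noteq> {}"
    and chain: "\<And>I J. I \<in> \<K> \<Longrightarrow> J \<in> \<K> \<Longrightarrow> I \<subseteq> J \<or> J \<subseteq> I"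
  shows "\<exists>f :: nat \<Rightarrow> complex set.
    (\<forall>n. f n \<in> \<K>) \<and> (\<forall>n. f n \<subseteq> f (Suc n)) \<and> (\<Union>n. f n) = \<Union>\<K>"
proof -
  obtain \<K>' where K': "\<K>' \<subseteq> \<K>" "countable \<K>'" "\<Union>\<K>' = \<Union>\<K>"
    using Lindelof_openin[of \<K> S1] openin_good good by blast
  have "\<Union>\<K> \<noteq> {}" using good good_nonempty \<open>\<K> \<noteq> {}\<close> by fastforce
  then have ne: "\<K>' \<noteq> {}" using K' by blast
  define f where "f n = (\<Union>i\<le>n. from_nat_into \<K>' i)" for n
  have e: "from_nat_into \<K>' i \<in> \<K>" for i using from_nat_into[OF ne] K' by blast
  have fS: "f (Suc n) = f n \<union> from_nat_into \<K>' (Suc n)" for n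
    unfolding f_def by (auto simp: atMost_Suc)
  have fK: "f n \<in> \<K>" for n
  proof (induction n)
    case 0 then show ?case using e by (simp add: f_def)
  next
    case (Suc n)
    then show ?case using chain[OF Suc e[of "Suc n"]] e[of "Suc n"]
      unfolding fS by (metis sup.absorb1 sup.absorb2)
  qed
  have "(\<Union>n. f n) = \<Union>(range (from_nat_into \<K>'))"
    unfolding f_def by blast
  then have fU: "(\<Union>n. f n) = \<Union>\<K>" by (simp only: range_from_nat_into[OF ne K'(2)] K'(3))
  have "f n \<subseteq> f (Suc n)" for n unfolding fS by (rule Un_upper1)
  then show ?thesis using fK fU by (intro exI[of _ f]) (simp only: simp_thms)
qed

subsection \<open>Lamination systems\<close>

lemma lam_good: "lamination_system L \<Longrightarrow> I \<in> L \<Longrightarrow> good_interval I"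
  unfolding lamination_system_def by blast

lemma lam_dual: "lamination_system L \<Longrightarrow> I \<in> L \<Longrightarrow> dual I \<in> L"
  unfolding lamination_system_def by blast

lemma lam_Union:
  assumes "lamination_system L" "\<And>k::nat. f k \<in> L" "\<And>k. f k \<subseteq> f (Suc k)" "good_interval (\<Union>k. f k)"
  shows "(\<Union>k. f k) \<in> L"
  using assms unfolding lamination_system_def by blast

lemma lam_cases:
  assumes L: "lamination_system L" and IJ: "I \<in> L" "J \<in> L"
  obtains "I \<subseteq> J" | "J \<subseteq> I" | "I \<subseteq> dual J" | "dual I \<subseteq> J"
proof -
  have g: "good_interval I" "good_interval J" using lam_good assms by blast+
  have "lies_on (leaf I) J \<or> lies_on (leaf I) (dual J)"
    using assms unfolding lamination_system_def by blast
  then show thesis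
    using that dual_subset_iff[OF g(2,1)] unfolding lies_on_def leaf_def by blast
qed

text \<open>Of the four positions of two elements, the common point \<open>p\<close> excludes
  \<open>I \<subseteq> dual J\<close>, and \<open>q\<close>, outside \<open>J\<close> but in
  \<open>dual I\<close>, excludes \<open>dual I \<subseteq> J\<close>.\<close>

lemma lam_nested:
  assumes "lamination_system L" "I \<in> L" "J \<in> L" "p \<in> I" "p \<in> J" "q \<in> dual I" "q \<notin> J"
  shows "I \<subseteq> J \<or> J \<subseteq> I"
  using lam_cases[OF assms(1-3)] assms(4-) dual_disjoint[OF lam_good[OF assms(1,3)]] by blast

lemma lam_Union_chain:
  assumes L: "lamination_system L" and K: "\<K> \<subseteq> L" "\<K> \<noteq> {}"
    and chain: "\<And>I J. I \<in> \<K> \<Longrightarrow> J \<in> \<K> \<Longrightarrow> I \<subseteq> J \<or> J \<subseteq> I"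
    and q: "q \<in> S1" "q \<notin> \<Union>\<K>"
  shows "\<Union>\<K> \<in> L \<or> \<Union>\<K> = S1 - {q}"
proof -
  have good: "\<And>J. J \<in> \<K> \<Longrightarrow> good_interval J" using lam_good[OF L] K by blast
  have "\<exists>f :: nat \<Rightarrow> complex set.
      (\<forall>n. f n \<in> \<K>) \<and> (\<forall>n. f n \<subseteq> f (Suc n)) \<and> (\<Union>n. f n) = \<Union>\<K>"
    by (rule chain_sequence[OF good K(2) chain])
  then obtain f :: "nat \<Rightarrow> complex set"
    where "(\<forall>n. f n \<in> \<K>) \<and> (\<forall>n. f n \<subseteq> f (Suc n)) \<and> (\<Union>n. f n) = \<Union>\<K>" ..
  note f = this[THEN conjunct1, THEN spec] this[THEN conjunct2, THEN conjunct1, THEN spec]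
    this[THEN conjunct2, THEN conjunct2]
  have "good_interval (\<Union>\<K>) \<or> \<Union>\<K> = S1 - {q}"
    by (rule good_Union_chain[OF good K(2) chain q])
  then show ?thesis
  proof
    assume "good_interval (\<Union>\<K>)"
    then have "good_interval (\<Union>n. f n)" by (simp only: f(3))
    then have "(\<Union>n. f n) \<in> L" using f(1,2) K(1) by (intro lam_Union[OF L]) blast+
    then have "\<Union>\<K> \<in> L" by (simp only: f(3))
    then show ?thesis ..
  qed blast
qed

text \<open>A second point outside the union rules out the punctured circle. This is the form in
  which the closure axiom is applied to chains.\<close>

lemma lam_Union_chain_mem:
  assumes L: "lamination_system L" and K: "\<K> \<subseteq> L" "\<K> \<noteq> {}"
    and chain: "\<And>I J. I \<in> \<K> \<Longrightarrow> J \<in> \<K> \<Longrightarrow> I \<subseteq> J \<or> J \<subseteq> I"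
    and q: "q \<in> S1" "q \<notin> \<Union>\<K>" and r: "r \<in> S1" "r \<notin> \<Union>\<K>" "q \<noteq> r"
  shows "\<Union>\<K> \<in> L"
proof -
  have "\<Union>\<K> \<in> L \<or> \<Union>\<K> = S1 - {q}" by (rule lam_Union_chain[OF L K chain q])
  moreover have "\<Union>\<K> \<noteq> S1 - {q}" using r by (metis DiffI singletonD)
  ultimately show ?thesis by (simp only: simp_thms)
qed

lemma endpoints_iff:
  assumes "lamination_system L"
  shows "p \<in> endpoints L \<longleftrightarrow> p \<in> S1 \<and> (\<exists>I\<in>L. p \<notin> I \<and> p \<notin> dual I)"
  unfolding endpoints_def using vertices_leaf_good[OF lam_good[OF assms]] by auto

lemma endpoints_ivl:
  assumes "lamination_system L" "ivl x y \<in> L" "x \<in> S1" "y \<in> S1" "x \<noteq> y"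
  shows "x \<in> endpoints L" "y \<in> endpoints L"
  using UN_I[OF assms(2), of _ "\<lambda>I. vertices (leaf I)"] vertices_leaf_ivl[OF assms(3-5)]
  unfolding endpoints_def by simp_all

lemma endpointsE:
  assumes "lamination_system L" "p \<in> endpoints L"
  obtains x where "x \<in> S1" "x \<noteq> p" "p \<in> S1" "ivl p x \<in> L" "ivl x p \<in> L"
proof -
  obtain I where I: "I \<in> L" "p \<in> S1" "p \<notin> I" "p \<notin> dual I"
    using assms endpoints_iff by blast
  obtain x y where xy: "x \<in> S1" "y \<in> S1" "x \<noteq> y" "I = ivl x y" "dual I = ivl y x"
    using good_cases[OF lam_good[OF assms(1) I(1)]] by metis
  have "p = x \<or> p = y" using I xy ivl_cases[OF xy(1,2) I(2)] by blast
  then show thesis using that xy I lam_dual[OF assms(1) I(1)] by metis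
qed

lemma not_endpoint_cases:
  assumes "lamination_system L" "I \<in> L" "p \<in> S1" "p \<notin> endpoints L" "p \<notin> I"
  shows "p \<in> dual I"
  using assms endpoints_iff by blast

text \<open>The common source of all gaps constructed below: if any two members of a family are
  nested or disjoint and each member lies in a largest one, then distinct largest members are
  disjoint, since neither can contain the other.\<close>

lemma maximal_gap:
  assumes L: "lamination_system L" and F: "\<F> \<subseteq> L"
    and tree: "\<And>I J. I \<in> \<F> \<Longrightarrow> J \<in> \<F> \<Longrightarrow> I \<subseteq> J \<or> J \<subseteq> I \<or> I \<inter> J = {}"
    and Un: "\<And>I. I \<in> \<F> \<Longrightarrow> \<Union>{J \<in> \<F>. I \<subseteq> J} \<in> \<F>"
    and meets: "\<And>I. I \<in> L \<Longrightarrow> \<exists>J\<in>\<F>. I \<subseteq> J \<or> dual I \<subseteq> J"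
  shows "gap L ((\<lambda>I. \<Union>{J \<in> \<F>. I \<subseteq> J}) ` \<F>)"
proof -
  define m where "m I = \<Union>{J \<in> \<F>. I \<subseteq> J}" for I
  have sub: "I \<subseteq> m I" if "I \<in> \<F>" for I using that unfolding m_def by blast
  have up: "J \<subseteq> m I" if "J \<in> \<F>" "I \<subseteq> J" for I J using that unfolding m_def by blast
  have mF: "m I \<in> \<F>" if "I \<in> \<F>" for I using Un[OF that] unfolding m_def .
  have "disjnt (m I) (m J)" if "I \<in> \<F>" "J \<in> \<F>" "m I \<noteq> m J" for I J
  proof -
    have "\<not> m I \<subseteq> m J" using up[OF mF[OF that(2)], of I] sub[OF that(1)] that(3) by blast
    moreover have "\<not> m J \<subseteq> m I" using up[OF mF[OF that(1)], of J] sub[OF that(2)] that(3) by blast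
    ultimately show ?thesis using tree[OF mF mF] that(1,2) unfolding disjnt_def by blast
  qed
  then have "pairwise disjnt (m ` \<F>)" by (simp add: pairwise_image pairwise_def)
  moreover have "\<exists>J\<in>m ` \<F>. lies_on l J" if "l \<in> leaves L" for l
  proof -
    obtain I where I: "I \<in> L" "l = leaf I" using \<open>l \<in> leaves L\<close> unfolding leaves_def by blast
    then obtain K where K: "K \<in> \<F>" "I \<subseteq> K \<or> dual I \<subseteq> K" using meets[of I] by blast
    then have "lies_on l (m K)" using sub[of K] I(2) unfolding lies_on_def leaf_def by blast
    then show ?thesis using K by blast
  qed
  moreover have "m ` \<F> \<subseteq> L" using mF F by blast
  ultimately show ?thesis unfolding gap_def m_def by simp
qed

subsection \<open>Veering pairs\<close>

lemma veering_sym: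
  assumes "veering_pair L1 L2" shows "veering_pair L2 L1"
proof -
  have "interleave A B \<longleftrightarrow> interleave B A" for A B unfolding interleave_def by blast
  then show ?thesis using assms unfolding veering_pair_def by (simp add: Int_commute)
qed

lemma veering_lam: "veering_pair L1 L2 \<Longrightarrow> lamination_system L1" "veering_pair L1 L2 \<Longrightarrow> lamination_system L2"
  unfolding veering_pair_def by blast+

lemma veering_endpoints: "veering_pair L1 L2 \<Longrightarrow> p \<in> endpoints L1 \<Longrightarrow> p \<notin> endpoints L2"
  unfolding veering_pair_def by blast

lemma veering_interleave:
  "veering_pair L1 L2 \<Longrightarrow> nonleaf_gap L2 G \<Longrightarrow> \<exists>G'. gap L1 G' \<and> interleave G' G"
  unfolding veering_pair_def by blast

section \<open>Leaves of one lamination nesting down to an endpoint of the other\<close>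

lemma nested_avoiding:
  assumes L: "lamination_system L" and "I \<in> L" "J \<in> L" "z \<in> I" "z \<in> J" "p \<in> S1" "p \<notin> endpoints L"
    "p \<notin> I" "p \<notin> J"
  shows "I \<subseteq> J \<or> J \<subseteq> I"
  using lam_nested[OF assms(1-5)] not_endpoint_cases[OF L] assms by blast

text \<open>An arc is connected: if a member \<open>K\<close> of the cover stopped strictly inside
  the arc that starts at \<open>p\<close>, its end would lie in another, open member, which would
  then meet \<open>K\<close>.\<close>

lemma disjoint_cover_endpoint:
  assumes disj: "pairwise disjnt G" and good: "\<And>K. K \<in> G \<Longrightarrow> good_interval K"
    and px: "p \<in> S1" "x \<in> S1" "p \<noteq> x" and K: "K \<in> G" "z \<in> K" "p \<notin> K"
  shows "z \<in> ivl p x \<Longrightarrow> ivl p x \<subseteq> \<Union>G \<Longrightarrow> \<exists>y\<in>S1. y \<noteq> p \<and> K = ivl p y"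
    and "z \<in> ivl x p \<Longrightarrow> ivl x p \<subseteq> \<Union>G \<Longrightarrow> \<exists>y\<in>S1. y \<noteq> p \<and> K = ivl y p"
proof -
  obtain e f where ef: "e \<in> S1" "f \<in> S1" "e \<noteq> f" "K = ivl e f" using good good_cases K by metis
  have nK: "e \<notin> K" "f \<notin> K" using ef endpoints_notin_ivl by blast+
  have zS: "z \<in> S1" using K ef ivl_subset_S1 by blast
  have meet: False if "w \<in> K'" "K' \<in> G" "w \<notin> K" "\<exists>t. t \<in> K \<and> t \<in> K'" for w K'
    using that K disj unfolding pairwise_def disjnt_def by (metis IntI emptyE)
  {
    assume z: "z \<in> ivl p x" and cov: "ivl p x \<subseteq> \<Union>G"
    have "e = p"
    proof (rule ccontr)
      assume "e \<noteq> p"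
      then have "e \<in> ivl p x"
        using z K ef(4) px(1,2) ef(1,2) zS
        by (simp only: mem_ivl_cyc[OF px(1)] S1_eq_iff[OF px(1)] cyc_def) (smt (verit))
      then obtain K' where K': "K' \<in> G" "e \<in> K'" using cov by blast
      obtain a b where ab: "a \<in> S1" "b \<in> S1" "a \<noteq> b" "K' = ivl a b" using good good_cases K' by metis
      have eb: "e \<noteq> b" using K'(2) ab endpoints_notin_ivl by blast
      \<comment> \<open>The first right end of \<open>K\<close> and \<open>K'\<close> met from
        \<open>e\<close>; hence \<open>ivl e m\<close> lies in both, against disjointness.\<close>
      define m where "m = (if b \<in> K then b else f)"
      have m: "m \<in> S1" "e \<noteq> m" using ab ef eb by (auto simp: m_def)
      then obtain t where t: "t \<in> ivl e m" using ivl_nonempty ef(1) by metis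
      then have tS: "t \<in> S1" using ivl_subset_S1 by blast
      have "t \<in> K \<and> t \<in> K'"
        using t K'(2) ab(1,2) ef(1-3) eb tS unfolding ef(4) ab(4) m_def
        by (cases "b \<in> ivl e f"; simp only: if_True if_False mem_ivl_cyc[OF ef(1)] S1_eq_iff[OF ef(1)] cyc_def; smt (verit))
      then show False using meet K' nK(1) by blast
    qed
    then show "\<exists>y\<in>S1. y \<noteq> p \<and> K = ivl p y" using ef by metis
  }
  {
    assume z: "z \<in> ivl x p" and cov: "ivl x p \<subseteq> \<Union>G"
    have "f = p"
    proof (rule ccontr)
      assume "f \<noteq> p"
      then have "f \<in> ivl x p"
        using z K ef(4) px(1,2) ef(1,2) zS
        by (simp only: mem_ivl_cyc[OF px(1)] S1_eq_iff[OF px(1)] cyc_def) (smt (verit))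
      then obtain K' where K': "K' \<in> G" "f \<in> K'" using cov by blast
      obtain a b where ab: "a \<in> S1" "b \<in> S1" "a \<noteq> b" "K' = ivl a b" using good good_cases K' by metis
      have eb: "f \<noteq> a" using K'(2) ab endpoints_notin_ivl by blast
      define m where "m = (if a \<in> K then a else e)"
      have m: "m \<in> S1" "m \<noteq> f" using ab ef eb by (auto simp: m_def)
      then obtain t where t: "t \<in> ivl m f" using ivl_nonempty ef(2) by metis
      then have tS: "t \<in> S1" using ivl_subset_S1 by blast
      have "t \<in> K \<and> t \<in> K'"
        using t K'(2) ab(1,2) ef(1-3) eb tS unfolding ef(4) ab(4) m_def
        by (cases "a \<in> ivl e f"; simp only: if_True if_False mem_ivl_cyc[OF ef(1)] S1_eq_iff[OF ef(1)] cyc_def; smt (verit))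
      then show False using meet K' nK(2) by blast
    qed
    then show "\<exists>y\<in>S1. y \<noteq> p \<and> K = ivl y p" using ef by metis
  }
qed

lemma subset_vertices_cover: "A \<subseteq> S1 \<Longrightarrow> A \<inter> vertices G = {} \<Longrightarrow> A \<subseteq> \<Union>G"
  unfolding vertices_def by blast

text \<open>If the leaves separating \<open>p\<close> from a given set did not accumulate at \<open>p\<close>, the maximal intervals
  avoiding \<open>p\<close> would form a non-leaf gap; an interleaving gap leaves no room for a leaf ending at \<open>p\<close>.\<close>

lemma rainbow:
  assumes V: "veering_pair L1 L2" and p: "p \<in> endpoints L1"
    and F: "finite F" "F \<subseteq> S1 - {p}"
  obtains K where "K \<in> L2" "p \<in> K" "F \<subseteq> dual K"
proof -
  note L1 = veering_lam(1)[OF V] and L2 = veering_lam(2)[OF V]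
  have pE: "p \<notin> endpoints L2" using veering_endpoints[OF V p] .
  obtain x where x: "x \<in> S1" "x \<noteq> p" "p \<in> S1" "ivl p x \<in> L1" "ivl x p \<in> L1"
    using endpointsE[OF L1 p] by metis
  define \<F> where "\<F> = {J \<in> L2. p \<notin> J}"
  define U where "U I = \<Union>{J \<in> \<F>. I \<subseteq> J}" for I
  have chain: "J \<subseteq> K \<or> K \<subseteq> J" if "I \<in> \<F>" "J \<in> \<F>" "K \<in> \<F>" "I \<subseteq> J" "I \<subseteq> K" for I J K
  proof -
    obtain z where "z \<in> I" using good_nonempty lam_good[OF L2] \<open>I \<in> \<F>\<close> unfolding \<F>_def by blast
    then show ?thesis using nested_avoiding[OF L2, of J K z p] that pE x unfolding \<F>_def by blast
  qed
  have pU: "p \<notin> U I" for I unfolding U_def \<F>_def by blast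
  have U: "U I \<in> L2 \<or> U I = S1 - {p}" if I: "I \<in> \<F>" for I
    unfolding U_def
  proof (rule lam_Union_chain[OF L2])
    show "{J \<in> \<F>. I \<subseteq> J} \<subseteq> L2" unfolding \<F>_def by blast
    show "{J \<in> \<F>. I \<subseteq> J} \<noteq> {}" using I by blast
    show "p \<in> S1" by fact
    show "p \<notin> \<Union>{J \<in> \<F>. I \<subseteq> J}" unfolding \<F>_def by blast
  qed (use chain I in blast)
  \<comment> \<open>If every \<open>U I\<close> is an element of \<open>L2\<close>, the maximal ones
    form a non-leaf gap, and an interleaving gap of \<open>L1\<close> forces one of them to end at
    \<open>p\<close>. This would make \<open>p\<close> an endpoint of \<open>L2\<close>.\<close>
  have "\<exists>I\<in>\<F>. U I = S1 - {p}"
  proof (rule ccontr)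
    assume "\<not> (\<exists>I\<in>\<F>. U I = S1 - {p})"
    then have UF: "U I \<in> \<F>" if "I \<in> \<F>" for I using U that pU unfolding \<F>_def by blast
    define G where "G = U ` \<F>"
    have gap: "gap L2 G"
      unfolding G_def U_def
    proof (rule maximal_gap[OF L2])
      show "\<F> \<subseteq> L2" unfolding \<F>_def by blast
      show "I \<subseteq> J \<or> J \<subseteq> I \<or> I \<inter> J = {}" if "I \<in> \<F>" "J \<in> \<F>" for I J
        using nested_avoiding[OF L2, of I J _ p] that pE x unfolding \<F>_def by blast
      show "\<Union>{J \<in> \<F>. I \<subseteq> J} \<in> \<F>" if "I \<in> \<F>" for I using UF[OF that] unfolding U_def .
      show "\<exists>J\<in>\<F>. I \<subseteq> J \<or> dual I \<subseteq> J" if "I \<in> L2" for I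
        using that lam_dual[OF L2 that] dual_disjoint[OF lam_good[OF L2 that]] unfolding \<F>_def by blast
    qed
    have pG: "p \<notin> J" "J \<in> L2" if "J \<in> G" for J using that UF unfolding G_def \<F>_def by blast+
    have "G \<notin> leaves L2"
    proof
      assume "G \<in> leaves L2"
      then obtain K where "K \<in> L2" "G = leaf K" unfolding leaves_def by blast
      then show False using pG not_endpoint_cases[OF L2, of K p] pE x unfolding leaf_def by blast
    qed
    then obtain H where H: "gap L1 H" "interleave H G"
      using veering_interleave[OF V] gap unfolding nonleaf_gap_def by blast
    have disj: "pairwise disjnt G" using gap unfolding gap_def by blast
    have good: "\<And>K. K \<in> G \<Longrightarrow> good_interval K" using pG lam_good[OF L2] by blast
    have "leaf (ivl p x) \<in> leaves L1" using x unfolding leaves_def by blast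
    then obtain J where J: "J \<in> H" "lies_on (leaf (ivl p x)) J" using H unfolding gap_def by blast
    \<comment> \<open>One side of the leaf at \<open>p\<close> lies in \<open>J\<close>, so
      \<open>w\<close> is the only vertex of \<open>G\<close> which that side can contain.\<close>
    then obtain w where w: "J \<inter> vertices G = {w}"
      using H(2) unfolding interleave_def is_singleton_def by blast
    have wS: "w \<in> S1" using w unfolding vertices_def by blast
    consider "ivl p x \<subseteq> J" | "ivl x p \<subseteq> J"
      using J x dual_ivl[of p x] unfolding lies_on_def leaf_def by auto
    then have "\<exists>K\<in>G. \<exists>y\<in>S1. y \<noteq> p \<and> (K = ivl p y \<or> K = ivl y p)"
    proof cases
      case 1
      \<comment> \<open>The arc is shortened to stop at the vertex \<open>w\<close>; what remains
        next to \<open>p\<close> is covered by \<open>G\<close>.\<close>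
      define y where "y = (if w \<in> ivl p x then w else x)"
      have y: "y \<in> S1" "p \<noteq> y" using x wS endpoints_notin_ivl[OF x(3,1)] by (auto simp: y_def)
      have "t \<in> ivl p x \<and> t \<noteq> w" if "t \<in> ivl p y" for t
      proof -
        have "t \<in> S1" using that ivl_subset_S1 by blast
        then show ?thesis using that x(1,3) wS unfolding y_def
          by (cases "w \<in> ivl p x"; simp only: if_True if_False mem_ivl_cyc[OF x(3)] S1_eq_iff[OF x(3)] cyc_def; smt (verit))
      qed
      then have cov: "ivl p y \<subseteq> \<Union>G"
        using 1 w ivl_subset_S1 by (intro subset_vertices_cover) blast+
      obtain z where z: "z \<in> ivl p y" using ivl_nonempty[OF x(3) y] by blast
      then obtain K where "K \<in> G" "z \<in> K" using cov by blast
      then show ?thesis using disjoint_cover_endpoint(1)[OF disj good x(3) y _ _ _ z cov] pG by blast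
    next
      case 2
      define y where "y = (if w \<in> ivl x p then w else x)"
      have y: "y \<in> S1" "p \<noteq> y" using x wS endpoints_notin_ivl[OF x(1,3)] by (auto simp: y_def)
      have "t \<in> ivl x p \<and> t \<noteq> w" if "t \<in> ivl y p" for t
      proof -
        have "t \<in> S1" using that ivl_subset_S1 by blast
        then show ?thesis using that x(1,3) wS unfolding y_def
          by (cases "w \<in> ivl x p"; simp only: if_True if_False mem_ivl_cyc[OF x(3)] S1_eq_iff[OF x(3)] cyc_def; smt (verit))
      qed
      then have cov: "ivl y p \<subseteq> \<Union>G"
        using 2 w ivl_subset_S1 by (intro subset_vertices_cover) blast+
      obtain z where z: "z \<in> ivl y p" using ivl_nonempty[OF y(1) x(3)] y by metis
      then obtain K where "K \<in> G" "z \<in> K" using cov by blast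
      then show ?thesis using disjoint_cover_endpoint(2)[OF disj good x(3) y _ _ _ z cov] pG by blast
    qed
    then show False using endpoints_ivl[OF L2] pG pE x(3) by metis
  qed
  then obtain I where I: "I \<in> \<F>" "U I = S1 - {p}" by blast
  \<comment> \<open>The members above \<open>I\<close> form a chain exhausting the circle minus
    \<open>p\<close>, so a single one catches finitely many points.\<close>
  have "\<exists>J\<in>\<F>. I \<subseteq> J \<and> F \<subseteq> J" using F
  proof (induction F rule: finite_induct)
    case empty then show ?case using I by blast
  next
    case (insert a F)
    then obtain J where J: "J \<in> \<F>" "I \<subseteq> J" "F \<subseteq> J" by blast
    have "a \<in> U I" using insert I by blast
    then obtain J' where J': "J' \<in> \<F>" "I \<subseteq> J'" "a \<in> J'" unfolding U_def by blast
    show ?case using chain[OF I(1) J(1) J'(1)] J J' by blast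
  qed
  then obtain J where J: "J \<in> L2" "p \<notin> J" "F \<subseteq> J" unfolding \<F>_def by blast
  show thesis
  proof
    show "dual J \<in> L2" using lam_dual[OF L2] J by blast
    show "p \<in> dual J" using not_endpoint_cases[OF L2] J x pE by blast
    show "F \<subseteq> dual (dual J)" using J lam_good[OF L2] by simp
  qed
qed

subsection \<open>Automorphisms\<close>

definition circ :: "(complex \<Rightarrow> complex) \<Rightarrow> bool" where
  "circ g \<longleftrightarrow> bij_betw g S1 S1 \<and> orientation_preserving g"

definition lam_aut :: "complex set set \<Rightarrow> (complex \<Rightarrow> complex) \<Rightarrow> bool" where
  "lam_aut L g \<longleftrightarrow> circ g \<and> (`) g ` L = L"

lemma circ_S1: "circ g \<Longrightarrow> x \<in> S1 \<Longrightarrow> g x \<in> S1"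
  unfolding circ_def using bij_betwE by blast

lemma circ_eq_iff: "circ g \<Longrightarrow> x \<in> S1 \<Longrightarrow> y \<in> S1 \<Longrightarrow> g x = g y \<longleftrightarrow> x = y"
  unfolding circ_def bij_betw_def using inj_on_eq_iff by metis

lemma circ_surj: assumes "circ g" "y \<in> S1" obtains x where "x \<in> S1" "g x = y"
proof -
  have "y \<in> g ` S1" using assms unfolding circ_def bij_betw_def by simp
  then show thesis using that by blast
qed

lemma circ_ccw:
  assumes g: "circ g" and S: "x \<in> S1" "y \<in> S1" "z \<in> S1"
  shows "ccw (g x) (g y) (g z) \<longleftrightarrow> ccw x y z"
proof
  show "ccw x y z \<Longrightarrow> ccw (g x) (g y) (g z)"
    using assms unfolding circ_def orientation_preserving_def by metis
  assume c: "ccw (g x) (g y) (g z)"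
  note gS = circ_S1[OF g S(1)] circ_S1[OF g S(2)] circ_S1[OF g S(3)]
  have "x \<noteq> y" "y \<noteq> z" "x \<noteq> z" using ccw_distinct[OF gS c] by auto
  moreover have "\<not> ccw x z y"
  proof
    assume "ccw x z y"
    then have "ccw (g x) (g z) (g y)"
      using assms unfolding circ_def orientation_preserving_def by metis
    then show False using c ccw_total[OF gS] ccw_distinct[OF gS c] by blast
  qed
  ultimately show "ccw x y z" using ccw_total[OF S] by blast
qed

lemma circ_mem_image:
  assumes "circ g" "x \<in> S1" "A \<subseteq> S1"
  shows "g x \<in> g ` A \<longleftrightarrow> x \<in> A"
  using assms circ_eq_iff by blast

lemma circ_image_subset_iff:
  assumes "circ g" "A \<subseteq> S1" "B \<subseteq> S1"
  shows "g ` A \<subseteq> g ` B \<longleftrightarrow> A \<subseteq> B"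
  using assms circ_mem_image[OF assms(1)] by blast

lemma circ_image_eq_iff:
  assumes "circ g" "A \<subseteq> S1" "B \<subseteq> S1"
  shows "g ` A = g ` B \<longleftrightarrow> A = B"
  using circ_image_subset_iff assms by (metis subset_antisym order_refl)

lemma circ_ivl:
  assumes g: "circ g" and S: "x \<in> S1" "y \<in> S1"
  shows "g ` ivl x y = ivl (g x) (g y)"
proof
  show "g ` ivl x y \<subseteq> ivl (g x) (g y)"
    using circ_ccw[OF g S(1) _ S(2)] circ_S1[OF g] unfolding ivl_def by blast
  show "ivl (g x) (g y) \<subseteq> g ` ivl x y"
  proof
    fix w assume w: "w \<in> ivl (g x) (g y)"
    then have "w \<in> S1" using ivl_subset_S1 by blast
    then obtain z where z: "z \<in> S1" "g z = w" using circ_surj[OF g] by blast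
    then have "z \<in> ivl x y" using w circ_ccw[OF g S(1) z(1) S(2)] unfolding ivl_def by blast
    then show "w \<in> g ` ivl x y" using z by blast
  qed
qed

lemma circ_mem_ivl:
  assumes "circ g" "x \<in> S1" "y \<in> S1" "z \<in> S1"
  shows "g z \<in> ivl (g x) (g y) \<longleftrightarrow> z \<in> ivl x y"
  using circ_ccw[OF assms(1,2,4,3)] circ_S1 assms unfolding ivl_def by blast

lemma circ_good:
  assumes "circ g" "good_interval I"
  shows "good_interval (g ` I)" "dual (g ` I) = g ` dual I"
proof -
  obtain x y where xy: "x \<in> S1" "y \<in> S1" "x \<noteq> y" "I = ivl x y" "dual I = ivl y x"
    using good_cases[OF assms(2)] by metis
  have g: "g x \<in> S1" "g y \<in> S1" "g x \<noteq> g y" using xy assms circ_S1 circ_eq_iff by auto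
  show "good_interval (g ` I)" using xy g circ_ivl[OF assms(1)] good_ivl by simp
  show "dual (g ` I) = g ` dual I" using xy g circ_ivl[OF assms(1)] dual_ivl by simp
qed

lemma circ_comp: "circ g \<Longrightarrow> circ h \<Longrightarrow> circ (g \<circ> h)"
  unfolding circ_def orientation_preserving_def comp_def
  using bij_betw_trans[of h S1 S1 g S1] bij_betwE[of h S1 S1] by (auto simp: comp_def simp del: mem_sphere_0)

lemma circ_inv:
  assumes "circ g"
  shows "circ (inv_into S1 g)"
  unfolding circ_def orientation_preserving_def
proof (intro conjI ballI impI)
  have b: "bij_betw g S1 S1" using assms unfolding circ_def by blast
  then show "bij_betw (inv_into S1 g) S1 S1" by (rule bij_betw_inv_into)
  fix x y z assume S: "x \<in> S1" "y \<in> S1" "z \<in> S1" and c: "ccw x y z"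
  have i: "inv_into S1 g w \<in> S1" "g (inv_into S1 g w) = w" if "w \<in> S1" for w
    using b that by (metis bij_betw_def inv_into_into, metis bij_betw_def f_inv_into_f)
  show "ccw (inv_into S1 g x) (inv_into S1 g y) (inv_into S1 g z)"
    using circ_ccw[OF assms i(1)[OF S(1)] i(1)[OF S(2)] i(1)[OF S(3)]] c i(2) S by simp
qed

lemma aut_circ: "lam_aut L g \<Longrightarrow> circ g"
  unfolding lam_aut_def by blast

lemma aut_image: "lam_aut L g \<Longrightarrow> I \<in> L \<Longrightarrow> g ` I \<in> L"
  unfolding lam_aut_def using imageI[of I L "(`) g"] by simp

lemma aut_preimage: assumes "lam_aut L g" "I \<in> L" obtains J where "J \<in> L" "I = g ` J"
proof -
  have "I \<in> (`) g ` L" using assms unfolding lam_aut_def by simp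
  then show thesis using that by blast
qed

lemma aut_comp: "lam_aut L g \<Longrightarrow> lam_aut L h \<Longrightarrow> lam_aut L (g \<circ> h)"
proof -
  assume gh: "lam_aut L g" "lam_aut L h"
  have "(`) (g \<circ> h) ` L = (`) g ` (`) h ` L" unfolding image_image image_comp[symmetric] ..
  also have "\<dots> = L" using gh unfolding lam_aut_def by simp
  finally show ?thesis using gh circ_comp unfolding lam_aut_def by simp
qed

lemma aut_gap:
  assumes L: "lamination_system L" and g: "lam_aut L g" and G: "gap L G"
  shows "gap L ((`) g ` G)"
proof -
  have sub: "I \<subseteq> S1" if "I \<in> L" for I using lam_good[OF L that] good_subset_S1 by blast
  have GL: "G \<subseteq> L" using G unfolding gap_def by blast
  have "(`) g ` G \<subseteq> L" using GL aut_image[OF g] by blast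
  moreover have "disjnt (g ` I) (g ` J)" if "I \<in> G" "J \<in> G" "g ` I \<noteq> g ` J" for I J
  proof -
    have "I \<inter> J = {}" using that G unfolding gap_def pairwise_def disjnt_def by metis
    moreover have "inj_on g S1" using aut_circ[OF g] unfolding circ_def bij_betw_def by blast
    moreover have "I \<subseteq> S1" "J \<subseteq> S1" using sub GL that by blast+
    ultimately show ?thesis unfolding disjnt_def by (metis inj_on_image_Int image_empty)
  qed
  then have "pairwise disjnt ((`) g ` G)" by (simp add: pairwise_image pairwise_def)
  moreover have "\<exists>J\<in>(`) g ` G. lies_on l J" if l: "l \<in> leaves L" for l
  proof -
    obtain K where K: "K \<in> L" "l = leaf K" using l unfolding leaves_def by blast
    obtain K' where K': "K' \<in> L" "K = g ` K'" using aut_preimage[OF g K(1)] by blast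
    have "leaf K' \<in> leaves L" using K' unfolding leaves_def by blast
    then obtain J where J: "J \<in> G" "lies_on (leaf K') J" using G unfolding gap_def by blast
    then have "K' \<subseteq> J \<or> dual K' \<subseteq> J" unfolding lies_on_def leaf_def by blast
    then have "K \<subseteq> g ` J \<or> dual K \<subseteq> g ` J"
      using K' circ_good(2)[OF aut_circ[OF g] lam_good[OF L K'(1)]] by blast
    then show ?thesis using J K unfolding lies_on_def leaf_def by blast
  qed
  ultimately show ?thesis unfolding gap_def by simp
qed

text \<open>Applying \<open>g\<close> to an inclusion between sides of the two leaves yields the
  same inclusion between the opposite sides; dualizing reverses it, so it is an equality.\<close>

lemma unique_flipped:
  assumes L: "lamination_system L" and g: "circ g"
    and I: "I \<in> L" "g ` I = dual I" and J: "J \<in> L" "g ` J = dual J"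
  shows "I = J \<or> I = dual J"
proof -
  have gd: "good_interval I" "good_interval J" using lam_good[OF L] I J by blast+
  then have S: "I \<subseteq> S1" "J \<subseteq> S1" "dual I \<subseteq> S1" "dual J \<subseteq> S1"
    using good_subset_S1 good_dual by blast+
  have dI: "g ` dual I = I" "g ` dual J = J"
    using circ_good(2)[OF g] gd I J dual_dual by metis+
  have iff: "A \<subseteq> B \<longleftrightarrow> g ` A \<subseteq> g ` B" if "A \<subseteq> S1" "B \<subseteq> S1" for A B
    using circ_image_subset_iff[OF g that] by simp
  show ?thesis
  proof (rule lam_cases[OF L I(1) J(1)])
    assume "I \<subseteq> J"
    then have "dual I \<subseteq> dual J" using iff[OF S(1,2)] I J by simp
    then show ?thesis using \<open>I \<subseteq> J\<close> dual_subset_iff[OF gd(2,1)] by blast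
  next
    assume "J \<subseteq> I"
    then have "dual J \<subseteq> dual I" using iff[OF S(2,1)] I J by simp
    then show ?thesis using \<open>J \<subseteq> I\<close> dual_subset_iff[OF gd] by blast
  next
    assume a: "I \<subseteq> dual J"
    then have "dual I \<subseteq> J" using iff[OF S(1,4)] I dI by simp
    then have "dual J \<subseteq> I" using dual_subset_iff[OF good_dual[OF gd(1)] gd(2)] gd by simp
    then show ?thesis using a by blast
  next
    assume a: "dual I \<subseteq> J"
    then have "I \<subseteq> dual J" using iff[OF S(3,2)] J dI by simp
    moreover have "dual J \<subseteq> I" using a dual_subset_iff[OF good_dual[OF gd(1)] gd(2)] gd by simp
    ultimately show ?thesis by blast
  qed
qed

subsection \<open>Isolated leaves\<close>

lemma converges_to_chain:
  assumes J: "\<And>k. J k \<in> L" "\<And>k. J k \<subseteq> J (Suc k)" and Un: "(\<Union>k. J k) = I"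
  shows "converges_to L (\<lambda>k. leaf (J k)) I"
proof -
  have mono: "J k \<subseteq> J m" if "k \<le> m" for k m using lift_Suc_mono_le[of J, OF J(2) that] .
  have sub: "J k \<subseteq> I" for k unfolding Un[symmetric] by blast
  have "I \<subseteq> liminf J"
  proof
    fix z assume "z \<in> I"
    then obtain k where "z \<in> J k" unfolding Un[symmetric] by blast
    then have "z \<in> (\<Inter>m\<in>{k..}. J m)" using mono by (meson INT_I atLeast_iff subsetD)
    then show "z \<in> liminf J" unfolding liminf_SUP_INF by blast
  qed
  moreover have "liminf J \<subseteq> limsup J" by (rule Liminf_le_Limsup) simp
  moreover have "limsup J \<subseteq> I"
  proof
    fix z assume "z \<in> limsup J"
    then obtain n where "z \<in> J n" using mem_limsup_iff frequently_ex by metis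
    then show "z \<in> I" using sub[of n] by blast
  qed
  then have "limsup J \<subseteq> closure I" by (rule order_trans[OF _ closure_subset])
  ultimately show ?thesis unfolding converges_to_def by (intro exI[of _ J] conjI allI J(1) refl)
qed

text \<open>Below an isolated \<open>I\<close> the elements properly inside \<open>I\<close> lie in
  maximal ones; these, together with \<open>dual I\<close>, bound the region next to
  \<open>I\<close>. As \<open>I\<close> itself is missing, the gap is not the leaf of
  \<open>I\<close>.\<close>

lemma isolated_gap:
  assumes L: "lamination_system L" and I: "I \<in> L" "isolated L I"
  obtains G where "gap L G" "dual I \<in> G" "I \<notin> G"
proof -
  note gI = lam_good[OF L I(1)]
  obtain u v where uv: "u \<in> S1" "v \<in> S1" "u \<noteq> v" "I = ivl u v" "dual I = ivl v u"
    using good_cases[OF gI] by metis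
  have uvI: "u \<notin> I" "v \<notin> I" using uv endpoints_notin_ivl by blast+
  define \<F> where "\<F> = insert (dual I) {J \<in> L. J \<subset> I}"
  define m where "m K = \<Union>{J \<in> \<F>. K \<subseteq> J}" for K
  obtain q where q: "q \<in> dual I" using good_nonempty[OF good_dual[OF gI]] by blast
  have dis: "I \<inter> dual I = {}" by (rule dual_disjoint[OF gI])
  have ne: "J \<noteq> {}" if "J \<in> L" for J using good_nonempty lam_good[OF L that] by blast
  have FL: "\<F> \<subseteq> L" using lam_dual[OF L I(1)] unfolding \<F>_def by blast
  have nest: "J \<subseteq> K \<or> K \<subseteq> J" if "J \<in> L" "K \<in> L" "J \<subset> I" "K \<subset> I" "z \<in> J" "z \<in> K" for J K z
  proof -
    have "q \<in> dual J" using dual_antimono[OF lam_good[OF L that(1)] gI] that q by blast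
    moreover have "q \<notin> K" using that q dis by blast
    ultimately show ?thesis using lam_nested[OF L that(1,2,5,6)] by blast
  qed
  have m_dual: "m (dual I) = dual I"
  proof -
    have "dual I \<subseteq> J \<and> J \<in> \<F> \<longleftrightarrow> J = dual I" for J
      using dis ne[OF lam_dual[OF L I(1)]] unfolding \<F>_def by blast
    then have "{J \<in> \<F>. dual I \<subseteq> J} = {dual I}" by blast
    then show ?thesis unfolding m_def by simp
  qed
  have mF: "m J \<in> \<F>" if J: "J \<in> \<F>" for J
  proof (cases "J = dual I")
    case True then show ?thesis using m_dual J by simp
  next
    case False
    then have J: "J \<in> L" "J \<subset> I" using J unfolding \<F>_def by blast+
    obtain z where z: "z \<in> J" using ne[OF J(1)] by blast
    define \<K> where "\<K> = {K \<in> L. J \<subseteq> K \<and> K \<subset> I}"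
    have "{K \<in> \<F>. J \<subseteq> K} = \<K>" using J z dis unfolding \<F>_def \<K>_def by blast
    then have mK: "m J = \<Union>\<K>" unfolding m_def by simp
    have KL: "\<K> \<subseteq> L" "\<K> \<noteq> {}" using J unfolding \<K>_def by blast+
    have chain: "A \<subseteq> B \<or> B \<subseteq> A" if "A \<in> \<K>" "B \<in> \<K>" for A B
      using nest[of A B z] z that unfolding \<K>_def by blast
    have sub: "\<Union>\<K> \<subseteq> I" unfolding \<K>_def by blast
    then have "u \<notin> \<Union>\<K>" "v \<notin> \<Union>\<K>" using uvI by blast+
    then have UL: "\<Union>\<K> \<in> L" using uv(1-3) by (intro lam_Union_chain_mem[OF L KL chain])
    \<comment> \<open>The only use of isolation: a chain filling \<open>I\<close> contains a
      sequence of leaves converging to \<open>I\<close> from inside.\<close>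
    have "\<Union>\<K> \<noteq> I"
    proof
      assume eq: "\<Union>\<K> = I"
      have "\<exists>f :: nat \<Rightarrow> complex set.
          (\<forall>n. f n \<in> \<K>) \<and> (\<forall>n. f n \<subseteq> f (Suc n)) \<and> (\<Union>n. f n) = \<Union>\<K>"
        using lam_good[OF L] KL chain by (intro chain_sequence) blast+
      then obtain f :: "nat \<Rightarrow> complex set"
        where "(\<forall>n. f n \<in> \<K>) \<and> (\<forall>n. f n \<subseteq> f (Suc n)) \<and> (\<Union>n. f n) = \<Union>\<K>" ..
      note f = this[THEN conjunct1, THEN spec] this[THEN conjunct2, THEN conjunct1, THEN spec]
        this[THEN conjunct2, THEN conjunct2]
      have fL: "f n \<in> L" "f n \<subset> I" for n using f(1)[of n] unfolding \<K>_def by blast+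
      have "(\<Union>n. f n) = I" using f(3) eq by (rule trans)
      then have "converges_to L (\<lambda>k. leaf (f k)) I" using fL f(2) by (intro converges_to_chain)
      moreover have "leaf (f k) \<in> leaves L \<and> leaf (f k) \<noteq> leaf I \<and> lies_on (leaf (f k)) I" for k
      proof -
        have "f k \<noteq> dual I" using fL[of k] ne[OF fL(1)[of k]] dis by blast
        then have "leaf (f k) \<noteq> leaf I"
          using fL(2)[of k] leaf_eq_iff[OF lam_good[OF L fL(1)[of k]] gI] by blast
        moreover have "lies_on (leaf (f k)) I"
          using fL(2)[of k] unfolding lies_on_def leaf_def by blast
        ultimately show ?thesis using fL(1)[of k] unfolding leaves_def by blast
      qed
      ultimately have "\<exists>l. (\<forall>k. l k \<in> leaves L \<and> l k \<noteq> leaf I \<and> lies_on (l k) I) \<and> converges_to L l I"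
        by (intro exI[of _ "\<lambda>k. leaf (f k)"] conjI allI) blast+
      then show False using I(2) unfolding isolated_def by contradiction
    qed
    then have "m J \<in> L \<and> m J \<subset> I" unfolding mK psubset_eq using UL sub by (intro conjI)
    then show ?thesis unfolding \<F>_def by simp
  qed
  have "gap L (m ` \<F>)"
    unfolding m_def
  proof (rule maximal_gap[OF L FL])
    show "J \<subseteq> K \<or> K \<subseteq> J \<or> J \<inter> K = {}" if "J \<in> \<F>" "K \<in> \<F>" for J K
      using nest that dis unfolding \<F>_def by blast
    show "\<Union>{K \<in> \<F>. J \<subseteq> K} \<in> \<F>" if "J \<in> \<F>" for J using mF[OF that] unfolding m_def .
    show "\<exists>J\<in>\<F>. K \<subseteq> J \<or> dual K \<subseteq> J" if K: "K \<in> L" for K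
    proof (rule lam_cases[OF L K I(1)])
      assume "K \<subseteq> I"
      then show ?thesis using K unfolding \<F>_def by blast
    next
      assume "I \<subseteq> K"
      then have "dual K \<subseteq> dual I" using dual_antimono[OF gI lam_good[OF L K]] by blast
      then show ?thesis unfolding \<F>_def by blast
    next
      assume "K \<subseteq> dual I"
      then show ?thesis unfolding \<F>_def by blast
    next
      assume "dual K \<subseteq> I"
      then show ?thesis using lam_dual[OF L K] lam_good[OF L K] unfolding \<F>_def by (cases "dual K = I") auto
    qed
  qed
  moreover have "dual I \<in> m ` \<F>" using m_dual unfolding \<F>_def by blast
  moreover have "I \<notin> m ` \<F>"
  proof
    assume "I \<in> m ` \<F>"
    then have "I \<in> \<F>" using mF by blast
    then show False using good_neq_dual[OF gI] unfolding \<F>_def by blast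
  qed
  ultimately show thesis by (rule that)
qed

text \<open>Every other member of \<open>G\<close> is disjoint from \<open>J\<close>, hence
  contained in \<open>dual J\<close>, which misses the ends of \<open>J\<close>.\<close>

lemma endpoint_vertex:
  assumes G: "pairwise disjnt G" "\<And>K. K \<in> G \<Longrightarrow> good_interval K"
    and J: "J \<in> G" and u: "u \<in> S1" "u \<notin> J" "u \<notin> dual J"
  shows "u \<in> vertices G"
proof -
  have "u \<notin> K" if "K \<in> G" for K
  proof (cases "K = J")
    case False
    then have "K \<inter> J = {}" using G(1) J that unfolding pairwise_def disjnt_def by blast
    then show ?thesis using good_disjoint_imp_subset_dual G(2) J that u by blast
  qed (use u in blast)
  then show ?thesis using u unfolding vertices_def by blast
qed

lemma flipped_not_isolated:
  assumes L: "lamination_system L" "loose L" and g: "lam_aut L g" and I: "I \<in> L" "g ` I = dual I"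
  shows "\<not> isolated L I"
proof
  assume "isolated L I"
  then obtain G where G: "gap L G" "dual I \<in> G" "I \<notin> G" using isolated_gap[OF L(1) I(1)] by blast
  note gI = lam_good[OF L(1) I(1)]
  have gd: "g ` dual I = I" using circ_good(2)[OF aut_circ[OF g] gI] I dual_dual[OF gI] by metis
  define H where "H = (`) g ` G"
  have H: "gap L H" "I \<in> H" using aut_gap[OF L(1) g G(1)] gd G(2) unfolding H_def by auto
  \<comment> \<open>A leaf has both sides of \<open>I\<close> as members or neither, so a gap with
    exactly one of them as a member is a non-leaf gap. This applies to \<open>G\<close>, which has
    \<open>dual I\<close>, and to its image \<open>H\<close>, which has \<open>I\<close>.\<close>
  have leafI: "dual I \<in> l \<longleftrightarrow> I \<in> l" if l: "l \<in> leaves L" for l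
  proof -
    obtain K where "K \<in> L" "l = {K, dual K}" using l unfolding leaves_def leaf_def by blast
    then show ?thesis
      using dual_dual[OF gI] dual_dual[OF lam_good[OF L(1)], of K] by (metis insert_iff singletonD)
  qed
  have G_nl: "nonleaf_gap L G" using G leafI unfolding nonleaf_gap_def by blast
  have "dual I \<notin> H"
  proof
    assume "dual I \<in> H"
    then obtain J where J: "J \<in> G" "g ` J = dual I" unfolding H_def by auto
    have "good_interval J" using J G(1) lam_good[OF L(1)] unfolding gap_def by blast
    then have "J = I"
      using circ_image_eq_iff[OF aut_circ[OF g] good_subset_S1 good_subset_S1[OF gI]] J I by auto
    then show False using J G by simp
  qed
  then have H_nl: "nonleaf_gap L H" using H leafI unfolding nonleaf_gap_def by blast
  have "G \<noteq> H" using G H by blast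
  then have dis: "vertices G \<inter> vertices H = {}" using L(2) G_nl H_nl unfolding loose_def by blast
  obtain u v where uv: "u \<in> S1" "v \<in> S1" "u \<noteq> v" "I = ivl u v" "dual I = ivl v u"
    using good_cases[OF gI] by metis
  have u: "u \<notin> I" "u \<notin> dual I" using uv endpoints_notin_ivl by blast+
  have gap: "pairwise disjnt K" "\<And>J. J \<in> K \<Longrightarrow> good_interval J" if "gap L K" for K
    using that lam_good[OF L(1)] unfolding gap_def by blast+
  have "u \<in> vertices G"
    by (rule endpoint_vertex[OF gap[OF G(1)] G(2)]) (use uv u dual_dual[OF gI] in auto)
  moreover have "u \<in> vertices H"
    by (rule endpoint_vertex[OF gap[OF H(1)] H(2)]) (use uv u in auto)
  ultimately show False using dis by blast
qed

subsection \<open>Fixed points of automorphisms\<close>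

text \<open>The elements of \<open>L\<close> containing the same fixed points of \<open>h\<close> as \<open>I\<close> form an \<open>h\<close>-invariant chain.\<close>

lemma invariant_hull:
  assumes L: "lamination_system L" and h: "lam_aut L h" and I: "I \<in> L"
    and p: "p \<in> I" "h p = p"
    and q: "q \<in> dual I" "h q = q" and r: "r \<in> dual I" "h r = r" "q \<noteq> r"
  obtains A where "A \<in> L" "I \<subseteq> A" "h ` A = A" "\<And>z. z \<in> S1 \<Longrightarrow> h z = z \<Longrightarrow> z \<in> A \<longleftrightarrow> z \<in> I"
proof -
  note c = aut_circ[OF h]
  have sub: "K \<subseteq> S1" "dual K \<subseteq> S1" if "K \<in> L" for K
    using lam_good[OF L that] good_subset_S1 good_dual by blast+
  \<comment> \<open>Fixed points are recorded on both sides, so \<open>p\<close> and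
    \<open>q\<close> make any two members comparable, while \<open>q\<close> and \<open>r\<close>
    stay outside their union.\<close>
  define \<K> where "\<K> = {K \<in> L. \<forall>z\<in>S1. h z = z \<longrightarrow> (z \<in> K \<longleftrightarrow> z \<in> I) \<and> (z \<in> dual K \<longleftrightarrow> z \<in> dual I)}"
  have S: "p \<in> S1" "q \<in> S1" "r \<in> S1" using sub[OF I] p q r by blast+
  have qr: "q \<notin> I" "r \<notin> I" using dual_disjoint[OF lam_good[OF L I]] q r by blast+
  have IK: "I \<in> \<K>" using I unfolding \<K>_def by blast
  have KL: "\<K> \<subseteq> L" "\<K> \<noteq> {}" using IK unfolding \<K>_def by blast+
  have mem: "z \<in> K \<longleftrightarrow> z \<in> I" "z \<in> dual K \<longleftrightarrow> z \<in> dual I" if "K \<in> \<K>" "z \<in> S1" "h z = z" for z K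
    using that unfolding \<K>_def by blast+
  have chain: "A \<subseteq> B \<or> B \<subseteq> A" if "A \<in> \<K>" "B \<in> \<K>" for A B
  proof (rule lam_nested[OF L])
    show "A \<in> L" "B \<in> L" using that KL(1) by blast+
    show "p \<in> A" "p \<in> B" using mem(1)[OF that(1) S(1) p(2)] mem(1)[OF that(2) S(1) p(2)] p(1) by simp_all
    show "q \<in> dual A" using mem(2)[OF that(1) S(2) q(2)] q(1) by simp
    show "q \<notin> B" using mem(1)[OF that(2) S(2) q(2)] qr(1) by simp
  qed
  have qU: "q \<notin> \<Union>\<K>" "r \<notin> \<Union>\<K>"
    using mem(1)[OF _ S(2) q(2)] mem(1)[OF _ S(3) r(2)] qr by blast+
  have UL: "\<Union>\<K> \<in> L" by (rule lam_Union_chain_mem[OF L KL chain S(2) qU(1) S(3) qU(2) r(3)])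
  have inv: "h ` K \<in> \<K> \<longleftrightarrow> K \<in> \<K>" if K: "K \<in> L" for K
  proof -
    have "z \<in> h ` A \<longleftrightarrow> z \<in> A" if "A \<subseteq> S1" "z \<in> S1" "h z = z" for A z
      using circ_mem_image[OF c that(2,1)] that(3) by simp
    then show ?thesis
      using K sub[OF K] aut_image[OF h K] circ_good(2)[OF c lam_good[OF L K]] unfolding \<K>_def by simp
  qed
  have "h ` \<Union>\<K> \<subseteq> \<Union>\<K>"
  proof
    fix z assume "z \<in> h ` \<Union>\<K>"
    then obtain K where "K \<in> \<K>" "z \<in> h ` K" by blast
    then show "z \<in> \<Union>\<K>" using inv[of K] KL(1) by blast
  qed
  moreover have "\<Union>\<K> \<subseteq> h ` \<Union>\<K>"
  proof
    fix z assume "z \<in> \<Union>\<K>"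
    then obtain K where K: "K \<in> \<K>" "z \<in> K" by blast
    then obtain K' where "K' \<in> L" "K = h ` K'" using aut_preimage[OF h, of K] KL(1) by blast
    then show "z \<in> h ` \<Union>\<K>" using K inv[of K'] by blast
  qed
  ultimately have "h ` \<Union>\<K> = \<Union>\<K>" by (rule subset_antisym)
  \<comment> \<open>Nothing is claimed about \<open>dual A\<close>: the union need not belong to the
    family, as its own ends are fixed by \<open>h\<close>.\<close>
  moreover have "z \<in> \<Union>\<K> \<longleftrightarrow> z \<in> I" if "z \<in> S1" "h z = z" for z
    using mem(1)[OF _ that] IK by blast
  moreover have "I \<subseteq> \<Union>\<K>" using IK by blast
  ultimately show thesis using UL by (intro that[of "\<Union>\<K>"])
qed

lemma invariant_ivl_fixed:
  assumes "circ h" "x \<in> S1" "y \<in> S1" "x \<noteq> y" "h ` ivl x y = ivl x y"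
  shows "h x = x" "h y = y"
  using ivl_inject[of "h x" "h y" x y] circ_S1 circ_eq_iff circ_ivl assms by metis+

text \<open>Otherwise the endpoint would lie in a complementary arc \<open>(\<alpha>, \<beta>)\<close> of the fixed point set with
  \<open>\<alpha>\<close> and \<open>\<beta>\<close> both endpoints of \<open>L1\<close>; expanding a leaf of \<open>L2\<close> around \<open>\<beta>\<close> by the dynamics would make
  \<open>\<alpha>\<close> an endpoint of \<open>L2\<close>.\<close>

lemma endpoint_fixed:
  assumes V: "veering_pair L1 L2" and h1: "lam_aut L1 h" and h2: "lam_aut L2 h"
    and cd: "c \<in> S1" "d \<in> S1" "c \<noteq> d" "ivl c d \<in> L1"
    and p1: "p1 \<in> ivl c d" "h p1 = p1" and p2: "p2 \<in> ivl c d" "h p2 = p2" "p1 \<noteq> p2"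
    and q1: "q1 \<in> ivl d c" "h q1 = q1" and q2: "q2 \<in> ivl d c" "h q2 = q2" "q1 \<noteq> q2"
  shows "h c = c"
proof (rule ccontr)
  assume hc: "h c \<noteq> c"
  note L1 = veering_lam(1)[OF V] and L2 = veering_lam(2)[OF V] and circ = aut_circ[OF h1]
  have S: "p1 \<in> S1" "p2 \<in> S1" "q1 \<in> S1" "q2 \<in> S1" using p1 p2 q1 q2 ivl_subset_S1 by blast+
  have d: "dual (ivl c d) = ivl d c" "dual (ivl d c) = ivl c d" using dual_ivl cd by simp_all
  have dc: "ivl d c \<in> L1" using lam_dual[OF L1 cd(4)] d by simp
  obtain A where A: "A \<in> L1" "ivl c d \<subseteq> A" "h ` A = A"
    and Afix: "\<And>z. z \<in> S1 \<Longrightarrow> h z = z \<Longrightarrow> z \<in> A \<longleftrightarrow> z \<in> ivl c d"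
    using invariant_hull[OF L1 h1 cd(4) p1] q1 q2 d by metis
  obtain B where B: "B \<in> L1" "ivl d c \<subseteq> B" "h ` B = B"
    and Bfix: "\<And>z. z \<in> S1 \<Longrightarrow> h z = z \<Longrightarrow> z \<in> B \<longleftrightarrow> z \<in> ivl d c"
    using invariant_hull[OF L1 h1 dc q1] p1 p2 d by metis
  \<comment> \<open>Both hulls are invariant, so their ends are fixed. Since \<open>c\<close> is not
    fixed, it is interior to both: the hull of \<open>ivl c d\<close> begins at
    \<open>\<alpha>\<close> before \<open>c\<close>, and the hull of \<open>ivl d c\<close> ends at
    \<open>\<beta>\<close> after \<open>c\<close>.\<close>
  obtain \<alpha> \<alpha>' where al: "\<alpha> \<in> S1" "\<alpha>' \<in> S1" "\<alpha> \<noteq> \<alpha>'" "A = ivl \<alpha> \<alpha>'" "dual A = ivl \<alpha>' \<alpha>"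
    using good_cases[OF lam_good[OF L1 A(1)]] by metis
  obtain \<beta>' \<beta> where be: "\<beta>' \<in> S1" "\<beta> \<in> S1" "\<beta>' \<noteq> \<beta>" "B = ivl \<beta>' \<beta>" "dual B = ivl \<beta> \<beta>'"
    using good_cases[OF lam_good[OF L1 B(1)]] by metis
  have fx: "h \<alpha> = \<alpha>" "h \<alpha>' = \<alpha>'" "h \<beta>' = \<beta>'" "h \<beta> = \<beta>"
    using invariant_ivl_fixed[OF circ al(1-3)] invariant_ivl_fixed[OF circ be(1-3)] A(3) B(3) al be by simp_all
  have ends: "\<alpha> \<in> endpoints L1" "\<beta> \<in> endpoints L1"
    using endpoints_ivl[OF L1] A(1) B(1) al be by blast+
  have cA: "c \<in> A"
  proof -
    have "dual A \<subseteq> ivl d c" using dual_antimono[OF lam_good[OF L1 cd(4)] lam_good[OF L1 A(1)] A(2)] d by simp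
    then have "c \<notin> dual A" using endpoints_notin_ivl[OF cd(2,1)] by blast
    then show ?thesis using ivl_cases[OF al(1,2) cd(1)] al fx hc by metis
  qed
  have cB: "c \<in> B"
  proof -
    have "dual B \<subseteq> ivl c d" using dual_antimono[OF lam_good[OF L1 dc] lam_good[OF L1 B(1)] B(2)] d by simp
    then have "c \<notin> dual B" using endpoints_notin_ivl[OF cd(1,2)] by blast
    then show ?thesis using ivl_cases[OF be(1,2) cd(1)] be fx hc by metis
  qed
  have "\<alpha> \<notin> A" "\<beta> \<notin> B" using endpoints_notin_ivl al be by blast+
  then have nal: "\<alpha> \<notin> ivl c d" and nbe: "\<beta> \<notin> ivl d c" using A(2) B(2) by blast+
  have ne: "\<alpha> \<noteq> c" "\<beta> \<noteq> c" using fx hc by blast+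
  have "q1 \<notin> A" using Afix[OF S(3) q1(2)] q1(1) disjoint_ivl_swap[OF cd(1,2)] by blast
  then have ab: "\<alpha> \<noteq> \<beta>"
    using al(1-3) cd(1-3) nal nbe ne cA q1(1) S be(2) unfolding al(4)
    by (simp only: mem_ivl_cyc[OF cd(1)] S1_eq_iff[OF cd(1)] cyc_def) (smt (verit))
  have cab: "c \<in> ivl \<alpha> \<beta>"
    using nal nbe ne ab cd(1-3) al(1) be(2)
    by (simp only: mem_ivl_cyc[OF cd(1)] S1_eq_iff[OF cd(1)] cyc_def) (smt (verit))
  \<comment> \<open>A fixed point between \<open>\<alpha>\<close> and \<open>c\<close> would lie in
    \<open>A\<close>, hence in \<open>ivl c d\<close>, which begins only at \<open>c\<close>; on the
    other side of \<open>c\<close> the same works with \<open>B\<close>.\<close>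
  have no_fix: False if z: "z \<in> ivl \<alpha> \<beta>" "h z = z" for z
  proof -
    have zS: "z \<in> S1" using z ivl_subset_S1 by blast
    have "z \<noteq> c" using z hc by blast
    then consider "z \<in> ivl \<alpha> c" | "z \<in> ivl c \<beta>"
      using z(1) cab cd(1) al(1) be(2) zS
      by (simp only: mem_ivl_cyc[OF cd(1)] S1_eq_iff[OF cd(1)] cyc_def) (smt (verit))
    then show False
    proof cases
      case 1
      then have "z \<in> A" using cA zS al(1,2) cd(1) unfolding al(4)
        by (simp only: mem_ivl_cyc[OF cd(1)] cyc_def) (smt (verit))
      then have "z \<in> ivl c d" using Afix zS z by blast
      then show False using 1 nal ne cd(1,2) zS al(1)
        by (simp only: mem_ivl_cyc[OF cd(1)] S1_eq_iff[OF cd(1)] cyc_def) (smt (verit))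
    next
      case 2
      then have "z \<in> B" using cB zS be(1,2) cd(1) unfolding be(4)
        by (simp only: mem_ivl_cyc[OF cd(1)] cyc_def) (smt (verit))
      then have "z \<in> ivl d c" using Bfix zS z by blast
      then show False using 2 nbe ne cd(1,2) zS be(2)
        by (simp only: mem_ivl_cyc[OF cd(1)] S1_eq_iff[OF cd(1)] cyc_def) (smt (verit))
    qed
  qed
  \<comment> \<open>One of the two given points differs from \<open>\<beta>\<close>. With
    \<open>\<alpha>\<close> it provides the two outer fixed points needed for the hull of an
    interval around \<open>\<beta>\<close>.\<close>
  obtain p' where p': "p' \<in> ivl c d" "h p' = p'" "p' \<noteq> \<beta>" using p1 p2 by metis
  have p'S: "p' \<in> S1" using p' ivl_subset_S1 by blast
  have p'\<alpha>: "p' \<noteq> \<alpha>" using p' nal by blast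
  have "finite {\<alpha>, c, p'}" "{\<alpha>, c, p'} \<subseteq> S1 - {\<beta>}"
    using al(1) cd(1) p'S ab ne p' by (simp_all del: mem_sphere_0)
  then obtain J where J: "J \<in> L2" "\<beta> \<in> J" "{\<alpha>, c, p'} \<subseteq> dual J"
    using rainbow[OF V ends(2)] by blast
  obtain U where U: "U \<in> L2" "J \<subseteq> U" "h ` U = U"
    and Ufix: "\<And>z. z \<in> S1 \<Longrightarrow> h z = z \<Longrightarrow> z \<in> U \<longleftrightarrow> z \<in> J"
    using invariant_hull[OF L2 h2 J(1,2) fx(4), of \<alpha> p'] J(3) fx(1) p'(2) p'\<alpha>[symmetric] by blast
  have "\<alpha> \<notin> U" using Ufix[OF al(1) fx(1)] J(3) dual_disjoint[OF lam_good[OF L2 J(1)]] by blast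
  moreover have "\<beta> \<in> U" using J U by blast
  moreover obtain \<xi> \<xi>' where xi: "\<xi> \<in> S1" "\<xi>' \<in> S1" "\<xi> \<noteq> \<xi>'" "U = ivl \<xi> \<xi>'"
    using good_cases[OF lam_good[OF L2 U(1)]] by metis
  \<comment> \<open>\<open>U\<close> contains \<open>\<beta>\<close> and misses
    \<open>\<alpha>\<close>, so its left end is caught between them; being fixed, it can only be
    \<open>\<alpha>\<close>.\<close>
  ultimately have "\<xi> = \<alpha> \<or> \<xi> \<in> ivl \<alpha> \<beta>"
    using al(1) be(2) ab unfolding xi(4)
    by (simp only: mem_ivl_cyc[OF be(2)] S1_eq_iff[OF be(2)] cyc_def) (smt (verit))
  moreover have "h \<xi> = \<xi>"
    using invariant_ivl_fixed(1)[OF circ xi(1-3)] U(3) unfolding xi(4) by blast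
  ultimately have "\<xi> = \<alpha>" using no_fix by blast
  then have "\<alpha> \<in> endpoints L2" using endpoints_ivl(1)[OF L2] U(1) xi by blast
  then show False using veering_endpoints[OF V ends(1)] by blast
qed

text \<open>The gap consists of the maximal elements of \<open>L\<close> avoiding \<open>u\<close>, where those around \<open>e\<close> are required
  to lie in \<open>(a, b)\<close>.\<close>

lemma fan_gap:
  assumes L: "lamination_system L"
    and S: "u \<in> S1" "a \<in> S1" "b \<in> S1" and PQ: "ivl u a \<in> L" "ivl b u \<in> L"
    and ab: "a \<in> ivl u b" and e: "e \<in> ivl a b" "e \<notin> endpoints L"
  obtains G A where "nonleaf_gap L G" "u \<in> vertices G" "A \<in> G" "ivl u a \<subseteq> A" "e \<notin> A"
proof -
  have ne: "u \<noteq> a" "a \<noteq> b" "u \<noteq> b" using ab S endpoints_notin_ivl ivl_refl by blast+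
  have eS: "e \<in> S1" using e ivl_subset_S1 by blast
  let ?P = "ivl u a" and ?Q = "ivl b u"
  have dP: "dual ?P = ivl a u" and dQ: "dual ?Q = ivl u b" using dual_ivl S ne by simp_all
  have gP: "good_interval ?P" and gQ: "good_interval ?Q" using lam_good[OF L] PQ by blast+
  have uPQ: "u \<notin> ?P" "u \<notin> ?Q" using S endpoints_notin_ivl by blast+
  have ePQ: "e \<notin> ?P" "e \<notin> ?Q"
    using e(1) ab S eS by (simp_all only: mem_ivl_cyc[OF S(1)] cyc_def) (smt (verit))+
  have PQab: "?P \<inter> ivl a b = {}" "dual ?P \<inter> dual ?Q \<subseteq> ivl a b"
  proof -
    have "\<not> (z \<in> ?P \<and> z \<in> ivl a b)" "z \<in> ivl a u \<and> z \<in> ivl u b \<longrightarrow> z \<in> ivl a b" if "z \<in> S1" for z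
      using ab S that by (simp_all only: mem_ivl_cyc[OF S(1)] cyc_def) (smt (verit))+
    then show "?P \<inter> ivl a b = {}" "dual ?P \<inter> dual ?Q \<subseteq> ivl a b"
      unfolding dP dQ using ivl_subset_S1 by blast+
  qed
  define \<F> where "\<F> = {J \<in> L. u \<notin> J \<and> (e \<in> J \<longrightarrow> J \<subseteq> ivl a b)}"
  define m where "m J = \<Union>{K \<in> \<F>. J \<subseteq> K}" for J
  have FL: "\<F> \<subseteq> L" and uF: "\<And>J. J \<in> \<F> \<Longrightarrow> u \<notin> J" unfolding \<F>_def by blast+
  have eF: "e \<in> dual J \<or> J \<subseteq> ivl a b" if "J \<in> \<F>" for J
    using not_endpoint_cases[OF L _ eS e(2)] that unfolding \<F>_def by blast
  have PF: "?P \<in> \<F>" and QF: "?Q \<in> \<F>" using PQ uPQ ePQ unfolding \<F>_def by blast+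
  \<comment> \<open>An interval around \<open>e\<close> with \<open>u\<close> strictly outside
    cannot cross the two leaves ending at \<open>u\<close>, so it is trapped between
    \<open>a\<close> and \<open>b\<close>.\<close>
  have large: "J \<subseteq> ivl a b" if J: "J \<in> L" "u \<notin> J" "u \<in> dual J" "e \<in> J" for J
  proof -
    have gJ: "good_interval J" using lam_good[OF L J(1)] .
    have "J \<subseteq> dual K" if K: "K \<in> L" "e \<notin> K" "u \<notin> K" "u \<notin> dual K" for K
      by (rule lam_cases[OF L J(1) K(1)])
        (use J K dual_antimono[OF lam_good[OF L K(1)] gJ] in blast)+
    then have "J \<subseteq> dual ?P" "J \<subseteq> dual ?Q" using PQ uPQ ePQ S endpoints_notin_ivl unfolding dP dQ
      by (metis dP, metis dQ)
    then show ?thesis using PQab by blast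
  qed
  have tree: "J \<subseteq> K \<or> K \<subseteq> J \<or> J \<inter> K = {}" if JK: "J \<in> \<F>" "K \<in> \<F>" for J K
  proof -
    have gJ: "good_interval J" and gK: "good_interval K" using lam_good[OF L] FL JK by blast+
    have "\<not> dual J \<subseteq> K"
    proof
      assume dJ: "dual J \<subseteq> K"
      then have dK: "dual K \<subseteq> J" using dual_antimono[OF good_dual[OF gJ] gK] dual_dual[OF gJ] by simp
      consider "e \<in> K" | "e \<in> J"
        using not_endpoint_cases[OF L _ eS e(2), of J] FL JK(1) dJ by blast
      then show False
      proof cases
        case 1
        then have "K \<subseteq> ivl a b" using JK unfolding \<F>_def by blast
        then have "ivl b a \<subseteq> dual K"
          using dual_antimono[OF gK good_ivl[OF S(2,3) ne(2)]] dual_ivl[OF S(2,3) ne(2)] by simp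
        moreover have "u \<in> ivl b a" using ab S by (simp only: mem_ivl_cyc[OF S(1)] cyc_def) (smt (verit))
        ultimately show False using dK uF[OF JK(1)] by blast
      next
        case 2
        then have "J \<subseteq> ivl a b" using JK unfolding \<F>_def by blast
        then have "ivl b a \<subseteq> dual J"
          using dual_antimono[OF gJ good_ivl[OF S(2,3) ne(2)]] dual_ivl[OF S(2,3) ne(2)] by simp
        moreover have "u \<in> ivl b a" using ab S by (simp only: mem_ivl_cyc[OF S(1)] cyc_def) (smt (verit))
        ultimately show False using dJ uF[OF JK(2)] by blast
      qed
    qed
    moreover have "J \<inter> K = {}" if "J \<subseteq> dual K" using that dual_disjoint[OF gK] by blast
    ultimately show ?thesis using lam_cases[OF L, of J K] FL JK by blast
  qed
  have mF: "m J \<in> \<F>" if J: "J \<in> \<F>" for J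
  proof -
    let ?K = "{K \<in> \<F>. J \<subseteq> K}"
    obtain z where z: "z \<in> J" using good_nonempty lam_good[OF L] FL J by blast
    have chain: "A \<subseteq> B \<or> B \<subseteq> A" if "A \<in> ?K" "B \<in> ?K" for A B
      using tree[of A B] that z by blast
    have KL: "?K \<subseteq> L" "?K \<noteq> {}" using FL J by blast+
    have uU: "u \<notin> \<Union>?K" using uF by blast
    show ?thesis
    proof (cases "e \<in> \<Union>?K")
      case True
      then obtain K where K: "K \<in> ?K" "e \<in> K" by blast
      have Kab: "K \<subseteq> ivl a b" using K unfolding \<F>_def by blast
      have "A \<subseteq> ivl a b" if A: "A \<in> ?K" for A
      proof (cases "e \<in> A")
        case True then show ?thesis using A unfolding \<F>_def by blast
      next
        case False then show ?thesis using chain[OF A K(1)] K(2) Kab by blast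
      qed
      then have sub: "\<Union>?K \<subseteq> ivl a b" by blast
      then have "a \<notin> \<Union>?K" using endpoints_notin_ivl S by blast
      then have "\<Union>?K \<in> L" using ne(1) by (intro lam_Union_chain_mem[OF L KL chain S(1) uU S(2)])
      then have "m J \<in> L" "m J \<subseteq> ivl a b" "u \<notin> m J" using sub uU unfolding m_def .
      then show ?thesis unfolding \<F>_def by simp
    next
      case False
      have "u \<noteq> e" using e(1) ab S eS
        by (simp only: mem_ivl_cyc[OF S(1)] S1_eq_iff[OF S(1)] cyc_def) (smt (verit))
      then have "\<Union>?K \<in> L" using False by (intro lam_Union_chain_mem[OF L KL chain S(1) uU eS])
      then have "m J \<in> L" "e \<notin> m J" "u \<notin> m J" using False uU unfolding m_def .
      then show ?thesis unfolding \<F>_def by simp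
    qed
  qed
  have sub: "J \<subseteq> m J" if "J \<in> \<F>" for J using that unfolding m_def by blast
  have gap: "gap L (m ` \<F>)"
    unfolding m_def
  proof (rule maximal_gap[OF L FL tree])
    show "\<Union>{K \<in> \<F>. J \<subseteq> K} \<in> \<F>" if "J \<in> \<F>" for J using mF[OF that] unfolding m_def .
    show "\<exists>J\<in>\<F>. K \<subseteq> J \<or> dual K \<subseteq> J" if K: "K \<in> L" for K
    proof -
      have gK: "good_interval K" using lam_good[OF L K] .
      have *: "\<exists>J\<in>\<F>. J = A \<or> J = dual A" if A: "A \<in> L" "u \<notin> A" for A
      proof (cases "u \<in> dual A")
        case True
        then show ?thesis using A large[OF A] unfolding \<F>_def by blast
      next
        case False
        have "e \<notin> A \<or> e \<notin> dual A" using dual_disjoint[OF lam_good[OF L A(1)]] by blast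
        then show ?thesis using A False lam_dual[OF L A(1)] unfolding \<F>_def by blast
      qed
      show ?thesis
      proof (cases "u \<in> K")
        case True
        then have "u \<notin> dual K" using dual_disjoint[OF gK] by blast
        then show ?thesis using *[OF lam_dual[OF L K]] dual_dual[OF gK] by auto
      next
        case False
        then show ?thesis using *[OF K] by auto
      qed
    qed
  qed auto
  have eP: "e \<notin> m ?P"
  proof
    assume "e \<in> m ?P"
    then have "m ?P \<subseteq> ivl a b" using mF[OF PF] unfolding \<F>_def by blast
    then show False using sub[OF PF] PQab(1) good_nonempty[OF gP] by blast
  qed
  \<comment> \<open>The points \<open>u\<close> and \<open>e\<close> separate \<open>?P\<close> from
    \<open>?Q\<close>, and \<open>m ?P\<close> contains neither of them. A leaf with sides
    \<open>m ?P\<close> and \<open>m ?Q\<close> would then have \<open>e\<close> on neither side,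
    although \<open>e\<close> is not an endpoint.\<close>
  have QA: "\<not> ?Q \<subseteq> m ?P"
  proof
    assume Q: "?Q \<subseteq> m ?P"
    obtain s t where st: "s \<in> S1" "t \<in> S1" "m ?P = ivl s t"
      using good_cases[OF lam_good[OF L]] mF[OF PF] FL by (metis subsetD)
    obtain x y where xy: "x \<in> ?P" "y \<in> ?Q" using good_nonempty[OF gP] good_nonempty[OF gQ] by blast
    have xyS: "x \<in> S1" "y \<in> S1" using xy ivl_subset_S1 by blast+
    have "x \<in> ivl s t" "y \<in> ivl s t" "u \<notin> ivl s t" "e \<notin> ivl s t"
      using sub[OF PF] Q xy uF[OF mF[OF PF]] eP st(3) by blast+
    then show False using xy e(1) ab st(1,2) S eS xyS
      by (simp only: mem_ivl_cyc[OF S(1)] cyc_def) (smt (verit))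
  qed
  have "m ` \<F> \<notin> leaves L"
  proof
    assume "m ` \<F> \<in> leaves L"
    then obtain K where K: "K \<in> L" "m ` \<F> = {K, dual K}" unfolding leaves_def leaf_def by blast
    have "m ?P \<noteq> m ?Q" using QA sub[OF QF] by blast
    then have mm: "{m ?P, m ?Q} = {K, dual K}" using K(2) PF QF by blast
    have eQ: "e \<notin> m ?Q"
    proof
      assume eQ: "e \<in> m ?Q"
      then have "m ?Q \<subseteq> ivl a b" using mF[OF QF] unfolding \<F>_def by blast
      then have "?Q \<subseteq> ivl a b" using sub[OF QF] by blast
      moreover have "\<not> (z \<in> ?Q \<and> z \<in> ivl a b)" if "z \<in> S1" for z
        using ab S that by (simp only: mem_ivl_cyc[OF S(1)] cyc_def) (smt (verit))
      ultimately show False using good_nonempty[OF gQ] ivl_subset_S1 by blast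
    qed
    have "e \<notin> K" "e \<notin> dual K" using mm eP eQ by blast+
    then show False using not_endpoint_cases[OF L K(1) eS e(2)] by blast
  qed
  then have "nonleaf_gap L (m ` \<F>)" using gap unfolding nonleaf_gap_def by blast
  moreover have "u \<in> vertices (m ` \<F>)" using mF uF S(1) unfolding vertices_def by blast
  ultimately show thesis using that PF sub[OF PF] eP by blast
qed

text \<open>At most two leaves of \<open>L1\<close> share an end: three would give two non-leaf gaps
  with vertex \<open>u\<close>, equal by looseness. Yet the member of the first that contains
  \<open>ivl u x\<close> misses \<open>e\<close>, while the member of the second contains
  \<open>e\<close> as part of \<open>ivl u y\<close>.\<close>

lemma no_fan:
  assumes V: "veering_pair L1 L2"
    and S: "u \<in> S1" "x \<in> S1" "y \<in> S1" "z \<in> S1"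
    and L: "ivl u x \<in> L1" "ivl u y \<in> L1" "ivl u z \<in> L1" and xyz: "x \<in> ivl u y" "y \<in> ivl u z"
  shows False
proof -
  note L1 = veering_lam(1)[OF V] and L2 = veering_lam(2)[OF V]
  have E: "endpoints L1 \<inter> endpoints L2 = {}" using V unfolding veering_pair_def by blast
  have ne: "u \<noteq> x" "u \<noteq> y" "u \<noteq> z" "x \<noteq> y" "y \<noteq> z"
    using xyz S endpoints_notin_ivl ivl_refl by blast+
  \<comment> \<open>A leaf of \<open>L2\<close> cutting \<open>t\<close> off from \<open>u\<close>
    and \<open>s\<close> has an end between \<open>s\<close> and \<open>t\<close>, and ends of
    \<open>L2\<close> are never endpoints of \<open>L1\<close>.\<close>
  have between: "\<exists>e. e \<in> ivl s t \<and> e \<notin> endpoints L1"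
    if st: "s \<in> S1" "t \<in> S1" "s \<in> ivl u t" "ivl u s \<in> L1" "ivl u t \<in> L1" for s t
  proof -
    have ne: "u \<noteq> s" "u \<noteq> t" "s \<noteq> t" using st S endpoints_notin_ivl ivl_refl by blast+
    have tE: "t \<in> endpoints L1" "s \<in> endpoints L1" using endpoints_ivl(2)[OF L1] S st ne by blast+
    have "finite {u, s}" "{u, s} \<subseteq> S1 - {t}" using S st ne by (simp_all del: mem_sphere_0)
    then obtain J where J: "J \<in> L2" "t \<in> J" "{u, s} \<subseteq> dual J" using rainbow[OF V tE(1)] by blast
    obtain e f where ef: "e \<in> S1" "f \<in> S1" "e \<noteq> f" "J = ivl e f" "dual J = ivl f e"
      using good_cases[OF lam_good[OF L2 J(1)]] by metis
    have eE: "e \<notin> endpoints L1" using endpoints_ivl(1)[OF L2 _ ef(1-3)] J(1) ef(4) E by blast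
    then have "e \<noteq> s" using tE by blast
    moreover have "t \<in> ivl e f" "u \<in> ivl f e" "s \<in> ivl f e" using J(2,3) ef(4,5) by blast+
    ultimately have "e \<in> ivl s t" using ef(1,2) st(1-3) S(1)
      by (simp only: mem_ivl_cyc[OF S(1)] S1_eq_iff[OF S(1)] cyc_def) (smt (verit))
    then show ?thesis using eE by blast
  qed
  obtain e where e: "e \<in> ivl x y" "e \<notin> endpoints L1" using between[OF S(2,3) xyz(1) L(1,2)] by blast
  obtain f where f: "f \<in> ivl y z" "f \<notin> endpoints L1" using between[OF S(3,4) xyz(2) L(2,3)] by blast
  have L': "ivl y u \<in> L1" "ivl z u \<in> L1" using lam_dual[OF L1] L dual_ivl S ne by metis+
  obtain G A where G: "nonleaf_gap L1 G" "u \<in> vertices G" "A \<in> G" "ivl u x \<subseteq> A" "e \<notin> A"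
    using fan_gap[OF L1 S(1-3) L(1) L'(1) xyz(1) e] by blast
  obtain H B where H: "nonleaf_gap L1 H" "u \<in> vertices H" "B \<in> H" "ivl u y \<subseteq> B"
    using fan_gap[OF L1 S(1,3,4) L(2) L'(2) xyz(2) f] by metis
  have "G = H" using V G(1,2) H(1,2) unfolding veering_pair_def loose_def by blast
  have eS: "e \<in> S1" using e ivl_subset_S1 by blast
  have "e \<in> ivl u y" using e(1) xyz(1) S eS
    by (simp only: mem_ivl_cyc[OF S(1)] cyc_def) (smt (verit))
  then have "A \<noteq> B" using H G by blast
  then have "A \<inter> B = {}" using G H \<open>G = H\<close> unfolding nonleaf_gap_def gap_def pairwise_def disjnt_def by metis
  moreover obtain w where w: "w \<in> ivl u x" using ivl_nonempty S ne by metis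
  then have "w \<in> S1" using ivl_subset_S1 by blast
  then have "w \<in> ivl u y" using w xyz(1) S
    by (simp only: mem_ivl_cyc[OF S(1)] cyc_def) (smt (verit))
  ultimately show False using w G H by blast
qed

section \<open>Fixed points inside a real leaf whose ends are fixed\<close>

lemma circ_angle_mono:
  assumes h: "circ h" and u: "u \<in> S1" "h u = u" and xy: "x \<in> S1" "y \<in> S1"
    and le: "Arg2pi (x / u) \<le> Arg2pi (y / u)"
  shows "Arg2pi (h x / u) \<le> Arg2pi (h y / u)"
proof -
  consider "x = y" | "x = u" | "ccw u x y"
    using le S1_eq_iff[OF u(1) xy] S1_eq_iff[OF u(1) xy(1) u(1)] Arg2pi_self[OF u(1)] Arg2pi_ge_0[of "x / u"]
    unfolding ccw_def by linarith
  then show ?thesis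
  proof cases
    case 2
    then show ?thesis using u Arg2pi_self[OF u(1)] Arg2pi_ge_0 by simp
  next
    case 3
    then show ?thesis using circ_ccw[OF h u(1) xy] u(2) unfolding ccw_def by simp
  qed simp
qed

text \<open>Tarski's argument: as \<open>u\<close> is fixed, \<open>h\<close> is monotone in the
  angle from \<open>u\<close>, and the supremum of the points between \<open>c\<close> and
  \<open>d\<close> that are not moved backwards is a fixed point.\<close>

lemma circ_fixed_point:
  assumes h: "circ h" and u: "u \<in> S1" "h u = u" and cd: "c \<in> S1" "d \<in> S1"
    and le: "Arg2pi (c / u) \<le> Arg2pi (d / u)" "Arg2pi (c / u) \<le> Arg2pi (h c / u)"
      "Arg2pi (h d / u) \<le> Arg2pi (d / u)"
  shows "\<exists>z\<in>S1. Arg2pi (c / u) \<le> Arg2pi (z / u) \<and> Arg2pi (z / u) \<le> Arg2pi (d / u) \<and> h z = z"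
proof -
  let ?A = "\<lambda>z. Arg2pi (z / u)"
  note mono = circ_angle_mono[OF h u]
  define Z where "Z = {z \<in> S1. ?A c \<le> ?A z \<and> ?A z \<le> ?A d \<and> ?A z \<le> ?A (h z)}"
  have cZ: "c \<in> Z" using cd le unfolding Z_def by blast
  define s where "s = Sup (?A ` Z)"
  have bdd: "bdd_above (?A ` Z)" unfolding Z_def by (rule bdd_aboveI2[where M = "?A d"]) blast
  have ub: "?A z \<le> s" if "z \<in> Z" for z unfolding s_def using cSUP_upper[OF that bdd] .
  have sd: "s \<le> ?A d" unfolding s_def using cZ by (intro cSUP_least) (auto simp: Z_def)
  have "0 \<le> s" using ub[OF cZ] Arg2pi_ge_0[of "c / u"] by linarith
  moreover have "s < 2 * pi" using sd Arg2pi_lt_2pi[of "d / u"] by linarith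
  ultimately obtain w where w: "w \<in> S1" "?A w = s" using Arg2pi_surj[OF u(1)] by metis
  note hw = circ_S1[OF h w(1)]
  have cw: "?A c \<le> ?A w" using ub[OF cZ] w by simp
  have "s \<le> ?A (h w)" unfolding s_def
  proof (rule cSUP_least)
    fix z assume z: "z \<in> Z"
    then have zS: "z \<in> S1" "?A z \<le> ?A (h z)" unfolding Z_def by blast+
    have "?A z \<le> ?A w" using ub[OF z] w(2) by simp
    then show "?A z \<le> ?A (h w)" using mono[OF zS(1) w(1)] zS(2) by linarith
  qed (use cZ in blast)
  moreover have "h w \<in> Z"
  proof -
    have "?A (h w) \<le> ?A d" using mono[OF w(1) cd(2)] sd w(2) le(3) by linarith
    moreover have "?A (h w) \<le> ?A (h (h w))" using mono[OF w(1) hw] \<open>s \<le> ?A (h w)\<close> w(2) by simp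
    moreover have "?A c \<le> ?A (h w)" using cw \<open>s \<le> ?A (h w)\<close> w(2) by linarith
    ultimately show ?thesis using hw unfolding Z_def by blast
  qed
  ultimately have "?A (h w) = ?A w" using ub w(2) by fastforce
  then have "h w = w" using S1_eq_iff[OF u(1) hw w(1)] by blast
  then show ?thesis using w cw sd by blast
qed

lemma inv_fixed:
  assumes "circ h" "z \<in> S1" "inv_into S1 h z = z"
  shows "h z = z"
  using assms unfolding circ_def by (metis bij_betw_def f_inv_into_f)

text \<open>Some leaf of a sequence converging to \<open>I\<close> has \<open>x\<close> and
  \<open>y\<close> on one side and a chosen point \<open>z\<close> of \<open>dual I\<close>, which
  is outside the closure of \<open>I\<close>, on the other. The position of \<open>z\<close> decides
  that the side with \<open>x\<close> and \<open>y\<close> is the one contained in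
  \<open>I\<close>.\<close>

lemma not_isolated_close:
  assumes L: "lamination_system L" and I: "I \<in> L" "\<not> isolated L I" and xy: "x \<in> I" "y \<in> I"
  obtains K where "K \<in> L" "K \<subseteq> I" "K \<noteq> I" "x \<in> K" "y \<in> K"
proof -
  note gI = lam_good[OF L I(1)]
  obtain l where l: "\<forall>k. l k \<in> leaves L \<and> l k \<noteq> leaf I \<and> lies_on (l k) I" "converges_to L l I"
    using I(2) unfolding isolated_def by blast
  obtain J where J: "\<forall>k. J k \<in> L \<and> l k = leaf (J k)" "I \<subseteq> liminf J" "limsup J \<subseteq> closure I"
    using l(2) unfolding converges_to_def by blast
  have ev: "\<forall>\<^sub>F k in sequentially. z \<in> J k" if "z \<in> I" for z
  proof -
    have "z \<in> (\<Union>n. \<Inter>m\<in>{n..}. J m)" using J(2) that unfolding liminf_SUP_INF by blast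
    then show ?thesis unfolding eventually_sequentially by blast
  qed
  obtain z where z: "z \<in> dual I" using good_nonempty[OF good_dual[OF gI]] by blast
  have "z \<notin> closure I"
  proof
    assume zc: "z \<in> closure I"
    obtain T where T: "open T" "dual I = S1 \<inter> T"
      using openin_good[OF good_dual[OF gI]] unfolding openin_open by blast
    have "T \<inter> I \<noteq> {}" using zc z T open_Int_closure_eq_empty[OF T(1), of I] by blast
    then show False using T(2) good_subset_S1[OF gI] dual_disjoint[OF gI] by blast
  qed
  then have "\<not> (\<exists>\<^sub>F k in sequentially. z \<in> J k)" using J(3) mem_limsup_iff[of z J] by blast
  then have "\<forall>\<^sub>F k in sequentially. z \<notin> J k" unfolding frequently_def by simp
  with ev[OF xy(1)] ev[OF xy(2)] have "\<forall>\<^sub>F k in sequentially. x \<in> J k \<and> y \<in> J k \<and> z \<notin> J k"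
    by eventually_elim blast
  then obtain k where k: "x \<in> J k" "y \<in> J k" "z \<notin> J k"
    using eventually_happens'[OF sequentially_bot] by blast
  have JL: "J k \<in> L" using J(1) by blast
  have "lies_on (leaf (J k)) I" "leaf (J k) \<noteq> leaf I" using l(1) J(1) by metis+
  then have "J k \<subseteq> I \<or> dual (J k) \<subseteq> I" "J k \<noteq> I" unfolding lies_on_def leaf_def by blast+
  moreover have "\<not> dual (J k) \<subseteq> I"
    using dual_antimono[OF good_dual[OF lam_good[OF L JL]] gI] dual_dual[OF lam_good[OF L JL]] z k by auto
  ultimately show thesis using that JL k by blast
qed

text \<open>Reality supplies a smaller interval \<open>K\<close> inside \<open>ivl u v\<close>
  containing both \<open>a\<close> and \<open>h a\<close>. Then \<open>K\<close> and its image share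
  \<open>h a\<close> and are nested. If \<open>K\<close> has an end in common with the given leaf, a
  fan of three leaves arises; otherwise monotonicity gives a fixed point between the ends of
  \<open>K\<close>.\<close>

lemma real_leaf_fixed_point:
  assumes V: "veering_pair L1 L2" and h1: "lam_aut L1 h"
    and uv: "u \<in> S1" "v \<in> S1" "u \<noteq> v" "ivl u v \<in> L1" "\<not> isolated L1 (ivl u v)"
    and fx: "h u = u" "h v = v"
  shows "\<exists>f\<in>ivl u v. h f = f"
proof (rule ccontr)
  assume nf: "\<not> ?thesis"
  note L1 = veering_lam(1)[OF V] and circ = aut_circ[OF h1]
  have hI: "h ` ivl u v = ivl u v" using circ_ivl[OF circ uv(1,2)] fx by simp
  obtain a where a: "a \<in> ivl u v" using ivl_nonempty[OF uv(1-3)] by blast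
  have ha: "h a \<in> ivl u v" using a hI by blast
  obtain K where K: "K \<in> L1" "K \<subseteq> ivl u v" "K \<noteq> ivl u v" "a \<in> K" "h a \<in> K"
    using not_isolated_close[OF L1 uv(4,5) a ha] by blast
  obtain c d where cd: "c \<in> S1" "d \<in> S1" "c \<noteq> d" "K = ivl c d" "dual K = ivl d c"
    using good_cases[OF lam_good[OF L1 K(1)]] by metis
  have hS: "h c \<in> S1" "h d \<in> S1" using circ_S1[OF circ] cd by blast+
  have hK: "h ` K = ivl (h c) (h d)" using circ_ivl[OF circ cd(1,2)] cd by simp
  have hKL: "h ` K \<in> L1" using aut_image[OF h1 K(1)] .
  have dI: "ivl v u \<subseteq> ivl d c"
    using dual_antimono[OF lam_good[OF L1 K(1)] lam_good[OF L1 uv(4)] K(2)] dual_ivl[OF uv(1-3)] cd(5) by simp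
  obtain q where q: "q \<in> ivl v u" using ivl_nonempty uv by metis
  have qS: "q \<in> S1" and aS: "a \<in> S1" using q a ivl_subset_S1 by blast+
  have nest: "K \<subseteq> h ` K \<or> h ` K \<subseteq> K"
  proof (rule lam_nested[OF L1 K(1) hKL])
    show "h a \<in> K" "h a \<in> h ` K" using K by blast+
    show "q \<in> dual K" using q dI cd(5) by blast
    show "q \<notin> h ` K" using K(2) hI q disjoint_ivl_swap[OF uv(1,2)] by blast
  qed
  have cdI: "c = u \<or> c \<in> ivl u v" "d = v \<or> d \<in> ivl u v"
  proof -
    have "q \<in> ivl d c" "a \<in> ivl c d" using q dI K cd by blast+
    moreover have "c \<notin> ivl v u" "d \<notin> ivl v u" using dI endpoints_notin_ivl[OF cd(2,1)] by blast+
    moreover have "v \<notin> ivl c d" "u \<notin> ivl c d" using K(2) cd(4) endpoints_notin_ivl[OF uv(1,2)] by blast+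
    ultimately show "c = u \<or> c \<in> ivl u v" "d = v \<or> d \<in> ivl u v"
      using a q uv(1-3) cd(1-3) qS aS
      by (simp_all only: mem_ivl_cyc[OF uv(1)] S1_eq_iff[OF uv(1)] cyc_def) (smt (verit))+
  qed
  have himg: "h z \<in> ivl u v" if "z \<in> ivl u v" for z using that hI by blast
  show False
  proof (cases "c = u")
    case True
    then have d: "d \<in> ivl u v" using cdI K(3) cd(4) by blast
    have hd: "h d \<noteq> d" "h d \<in> ivl u v" using nf d himg by blast+
    have KL: "ivl u d \<in> L1" "ivl u (h d) \<in> L1" using K(1) hKL hK cd(4) True fx by simp_all
    \<comment> \<open>The leaves from \<open>u\<close> to \<open>d\<close>, \<open>h d\<close> and
      \<open>v\<close> are different, as \<open>d\<close> is not fixed; only the order of the first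
      two is open.\<close>
    have "d \<in> ivl u (h d) \<or> h d \<in> ivl u d"
      using d hd cd(2) hS(2) uv(1,2)
      by (simp only: mem_ivl_cyc[OF uv(1)] S1_eq_iff[OF uv(1)] cyc_def) (smt (verit))
    then show False
      using no_fan[OF V uv(1) cd(2) hS(2) uv(2) KL uv(4) _ hd(2)]
        no_fan[OF V uv(1) hS(2) cd(2) uv(2) KL(2,1) uv(4) _ d] by blast
  next
    case False
    then have c: "c \<in> ivl u v" using cdI by blast
    have hc: "h c \<noteq> c" "h c \<in> ivl u v" using nf c himg by blast+
    show False
    proof (cases "d = v")
      case True
      have vu: "ivl v u \<in> L1" using lam_dual[OF L1 uv(4)] dual_ivl uv by simp
      have KL: "ivl v c \<in> L1" using lam_dual[OF L1 K(1)] cd(5) True by simp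
      then have hKL': "ivl v (h c) \<in> L1" using aut_image[OF h1 KL] circ_ivl[OF circ uv(2) cd(1)] fx by simp
      have "u \<in> ivl v c" "u \<in> ivl v (h c)" "c \<in> ivl v (h c) \<or> h c \<in> ivl v c"
        using c hc cd(1) hS(1) uv(1-3)
        by (simp_all only: mem_ivl_cyc[OF uv(1)] S1_eq_iff[OF uv(1)] cyc_def) (smt (verit))+
      then show False
        using no_fan[OF V uv(2,1) cd(1) hS(1) vu KL hKL']
          no_fan[OF V uv(2,1) hS(1) cd(1) vu hKL' KL] by blast
    next
      case False
      then have d: "d \<in> ivl u v" using cdI by blast
      let ?A = "\<lambda>z. Arg2pi (z / u)"
      have u0: "?A u = 0" using Arg2pi_self uv(1) by blast
      have pos: "0 < ?A c" "0 < ?A d" "?A c < ?A v" "?A d < ?A v"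
        using c d unfolding ivl_def ccw_def by auto
      have "u \<notin> ivl c d" "u \<notin> ivl (h c) (h d)"
        using K(2) hI hK cd(4) endpoints_notin_ivl[OF uv(1,2)] by blast+
      moreover have "h a \<in> ivl c d" "h a \<in> ivl (h c) (h d)" using K hK cd(4) by blast+
      moreover have "0 < ?A (h c)" "0 < ?A (h d)"
        using hc himg[OF d] unfolding ivl_def ccw_def by auto
      moreover have haS: "h a \<in> S1" using ha ivl_subset_S1 by blast
      ultimately have cdle: "?A c < ?A d" "?A (h c) < ?A (h d)"
        using pos uv(1) cd(1,2) hS u0
        by (simp_all only: mem_ivl_cyc[OF uv(1)] cyc_def) (smt (verit))+
      have mem: "z \<in> ivl c d \<longleftrightarrow> ?A c < ?A z \<and> ?A z < ?A d" "z \<in> ivl (h c) (h d) \<longleftrightarrow> ?A (h c) < ?A z \<and> ?A z < ?A (h d)"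
        if "z \<in> S1" for z
        using that uv(1) cd(1,2) hS cdle by (simp_all only: mem_ivl_cyc[OF uv(1)] cyc_def) (smt (verit))+
      have ends: "?A x \<le> ?A x' \<and> ?A y' \<le> ?A y"
        if sub: "ivl x' y' \<subseteq> ivl x y" and S: "x \<in> S1" "y \<in> S1" "x' \<in> S1" "y' \<in> S1"
          and l: "?A x' < ?A y'" "?A x < ?A y" "0 < ?A x" "0 < ?A x'" for x y x' y'
      proof -
        have dd: "ivl y x \<subseteq> ivl y' x'"
          using dual_antimono[OF good_ivl good_ivl sub] dual_ivl S l by (metis less_irrefl)
        have "x' \<notin> ivl y x" "y' \<notin> ivl y x" using dd endpoints_notin_ivl[OF S(4,3)] by blast+
        then show ?thesis using S l uv(1) by (simp_all only: mem_ivl_cyc[OF uv(1)] cyc_def) (smt (verit))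
      qed
      have "\<exists>z\<in>S1. ?A c \<le> ?A z \<and> ?A z \<le> ?A d \<and> h z = z"
        using nest
      proof
        assume "h ` K \<subseteq> K"
        then have "?A c \<le> ?A (h c) \<and> ?A (h d) \<le> ?A d"
          using cdle pos \<open>0 < ?A (h c)\<close> cd hS unfolding hK by (intro ends) simp_all
        then show ?thesis using cdle cd by (intro circ_fixed_point[OF circ uv(1) fx(1)]) auto
      next
        \<comment> \<open>The interval is expanded, so the fixed point argument is applied to the
          inverse map.\<close>
        assume "K \<subseteq> h ` K"
        then have le: "?A (h c) \<le> ?A c \<and> ?A d \<le> ?A (h d)"
          using cdle pos \<open>0 < ?A (h c)\<close> cd hS unfolding hK by (intro ends) simp_all
        let ?k = "inv_into S1 h"
        note k = circ_inv[OF circ]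
        have inj: "inj_on h S1" using circ unfolding circ_def bij_betw_def by blast
        have kh: "?k (h z) = z" if "z \<in> S1" for z using inv_into_f_f[OF inj that] .
        have ku: "?k u = u" using kh[OF uv(1)] fx by simp
        have "?A c \<le> ?A (?k c)" "?A (?k d) \<le> ?A d"
          using circ_angle_mono[OF k uv(1) ku hS(1) cd(1)] circ_angle_mono[OF k uv(1) ku cd(2) hS(2)] le kh cd(1,2)
          by simp_all
        then have "\<exists>z\<in>S1. ?A c \<le> ?A z \<and> ?A z \<le> ?A d \<and> ?k z = z"
          using cdle cd by (intro circ_fixed_point[OF k uv(1) ku]) auto
        then show ?thesis using inv_fixed[OF circ] by blast
      qed
      then obtain z where z: "z \<in> S1" "?A c \<le> ?A z" "?A z \<le> ?A d" "h z = z" by blast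
      then have "z \<in> ivl u v" using pos unfolding ivl_def ccw_def by auto
      then show False using nf z by blast
    qed
  qed
qed

subsection \<open>Involutions\<close>

text \<open>The product of two involutions flipping the same leaf fixes a point on each of its sides, hence
  preserves every leaf crossing it that is flipped by one of them.\<close>

lemma flipped_leaf_unique:
  assumes V: "veering_pair L1 L2"
    and g: "lam_aut L1 g" "lam_aut L2 g" "\<And>x. x \<in> S1 \<Longrightarrow> g (g x) = x"
    and k: "lam_aut L1 k" "lam_aut L2 k" "\<And>x. x \<in> S1 \<Longrightarrow> k (k x) = x"
    and uv: "u \<in> S1" "v \<in> S1" "ivl u v \<in> L1" "\<not> isolated L1 (ivl u v)"
    and gk: "g u = v" "k u = v"
    and ab: "ivl a b \<in> L2" "a \<in> ivl u v" "b \<in> ivl v u" "g a = b"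
    and ab': "ivl a' b' \<in> L2" "a' \<in> ivl u v" "b' \<in> ivl v u" "k a' = b'"
  shows "a = a' \<and> b = b'"
proof -
  note L1 = veering_lam(1)[OF V] and L2 = veering_lam(2)[OF V]
  note cg = aut_circ[OF g(1)] and ck = aut_circ[OF k(1)]
  have S: "a \<in> S1" "b \<in> S1" "a' \<in> S1" "b' \<in> S1" using ab ab' ivl_subset_S1 by blast+
  have uv': "u \<noteq> v" using ab(2) uv ivl_refl by blast
  have anb: "a \<noteq> b" "a' \<noteq> b'" using ab ab' disjoint_ivl_swap[OF uv(1,2)] by blast+
  define h where "h = k \<circ> g"
  have h: "lam_aut L1 h" "lam_aut L2 h" unfolding h_def using aut_comp g k by blast+
  have gv: "g v = u" "k v = u" using g(3)[OF uv(1)] k(3)[OF uv(1)] gk by simp_all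
  have gb: "g b = a" "k b' = a'" using g(3)[OF S(1)] k(3)[OF S(3)] ab(4) ab'(4) by simp_all
  have fx: "h u = u" "h v = v" unfolding h_def using gk gv by simp_all
  obtain f where f: "f \<in> ivl u v" "h f = f"
    using real_leaf_fixed_point[OF V h(1) uv(1,2) uv' uv(3,4) fx] by blast
  have fS: "f \<in> S1" using f ivl_subset_S1 by blast
  have gfS: "g f \<in> S1" using circ_S1[OF cg fS] .
  have "k (g f) = f" using f unfolding h_def by simp
  then have "k f = g f" using k(3)[OF gfS] by simp
  \<comment> \<open>The fixed point \<open>f\<close> of \<open>k \<circ> g\<close> satisfies
    \<open>k f = g f\<close>, so \<open>g f\<close> is fixed as well, and \<open>g\<close> puts it
    on the other side of the leaf.\<close>
  then have hgf: "h (g f) = g f" unfolding h_def using g(3)[OF fS] by simp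
  have gf: "g f \<in> ivl v u" using circ_mem_ivl[OF cg uv(1,2) fS] f gk gv by simp
  have "h a = a"
  proof (cases "f = a")
    case False
    \<comment> \<open>The fixed points \<open>u\<close> and \<open>v\<close> lie on different sides
      of the leaf with ends \<open>a\<close> and \<open>b\<close>, and so do \<open>f\<close> and
      \<open>g f\<close>. The position of \<open>f\<close> relative to \<open>a\<close> decides
      which of them go together.\<close>
    then consider "f \<in> ivl u a" | "f \<in> ivl a v" using f ab(2) uv fS S
      by (simp only: mem_ivl_cyc[OF uv(1)] S1_eq_iff[OF uv(1)] cyc_def) (smt (verit))
    then show ?thesis
    proof cases
      case 1
      have "g f \<in> ivl v b" using circ_mem_ivl[OF cg uv(1) S(1) fS] 1 gk ab(4) by simp
      then have "v \<in> ivl a b" "g f \<in> ivl a b" "u \<in> ivl b a" "f \<in> ivl b a" "v \<noteq> g f" "u \<noteq> f"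
        using 1 f gf ab(2,3) uv(1,2) uv' fS gfS S
        by (simp_all only: mem_ivl_cyc[OF uv(1)] S1_eq_iff[OF uv(1)] cyc_def) (smt (verit))+
      then show ?thesis
        using endpoint_fixed[OF veering_sym[OF V] h(2,1) S(1,2) anb(1) ab(1), of v "g f" u f] fx f hgf by blast
    next
      case 2
      have "g f \<in> ivl b u" using circ_mem_ivl[OF cg S(1) uv(2) fS] 2 gv ab(4) by simp
      then have "v \<in> ivl a b" "f \<in> ivl a b" "u \<in> ivl b a" "g f \<in> ivl b a" "v \<noteq> f" "u \<noteq> g f"
        using 2 f gf ab(2,3) uv(1,2) uv' fS gfS S
        by (simp_all only: mem_ivl_cyc[OF uv(1)] S1_eq_iff[OF uv(1)] cyc_def) (smt (verit))+
      then show ?thesis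
        using endpoint_fixed[OF veering_sym[OF V] h(2,1) S(1,2) anb(1) ab(1), of v f u "g f"] fx f hgf by blast
    qed
  qed (use f in blast)
  \<comment> \<open>So \<open>k\<close> flips this leaf as well as the one with ends
    \<open>a'\<close> and \<open>b'\<close>, and an automorphism flips only one leaf of a
    lamination.\<close>
  then have kb: "k b = a" unfolding h_def using ab(4) by simp
  then have ka: "k a = b" using k(3)[OF S(2)] by simp
  have "ivl a b = ivl a' b' \<or> ivl a b = dual (ivl a' b')"
  proof (rule unique_flipped[OF L2 ck ab(1) _ ab'(1)])
    show "k ` ivl a b = dual (ivl a b)" using circ_ivl[OF ck S(1,2)] dual_ivl[OF S(1,2) anb(1)] ka kb by simp
    show "k ` ivl a' b' = dual (ivl a' b')"
      using circ_ivl[OF ck S(3,4)] dual_ivl[OF S(3,4) anb(2)] gb ab'(4) by simp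
  qed
  then have "ivl a b = ivl a' b' \<or> ivl a b = ivl b' a'" using dual_ivl[OF S(3,4) anb(2)] by simp
  then have "a = a' \<and> b = b' \<or> a = b' \<and> b = a'"
    using ivl_inject[OF S anb(1) anb(2)] ivl_inject[OF S(1,2,4,3) anb(1) anb(2)[symmetric]] by blast
  moreover have "a \<noteq> b'" using ab(2) ab'(3) disjoint_ivl_swap[OF uv(1,2)] by blast
  ultimately show ?thesis by blast
qed

subsection \<open>Limits of leaves\<close>

lemma limit_not_ccw:
  assumes "F \<noteq> bot" "(x \<longlongrightarrow> a) F" "(y \<longlongrightarrow> b) F" "(z \<longlongrightarrow> c) F" "a \<in> S1" "b \<in> S1" "c \<in> S1"
    and "\<forall>\<^sub>F k in F. \<not> ccw (x k) (y k) (z k)"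
  shows "\<not> ccw a b c"
proof
  assume "ccw a b c"
  then have "\<forall>\<^sub>F k in F. ccw (x k) (y k) (z k)" using eventually_ccw assms(2-7) by blast
  with assms(8) have "\<forall>\<^sub>F k in F. False" by eventually_elim simp
  then show False using assms(1) by simp
qed

lemma lam_unlinked:
  assumes L: "lamination_system L" and S: "a \<in> S1" "b \<in> S1" "c \<in> S1" "d \<in> S1"
    and IJ: "ivl a b \<in> L" "ivl c d \<in> L" and link: "c \<in> ivl a b" "d \<in> ivl b a"
  shows False
proof -
  have ne: "a \<noteq> b" "c \<noteq> d" using link S ivl_refl disjoint_ivl_swap[OF S(1,2)] by blast+
  note d = dual_ivl[OF S(1,2) ne(1)] dual_ivl[OF S(3,4) ne(2)]
  note n = endpoints_notin_ivl[OF S(3,4)] endpoints_notin_ivl[OF S(4,3)]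
  show False
  proof (rule lam_cases[OF L IJ])
    assume "ivl c d \<subseteq> ivl a b"
    then have "ivl b a \<subseteq> ivl d c" using dual_antimono[OF lam_good[OF L IJ(2)] lam_good[OF L IJ(1)]] d by simp
    then show False using link n by blast
  qed (use link n d in auto)
qed

text \<open>All elements of \<open>L\<close> inside \<open>ivl \<alpha> \<beta>\<close> that contain
  a chosen point \<open>p\<close> form a chain; the converging ones reach every point of the
  interval, so the chain fills it.\<close>

lemma lam_closed_inside:
  assumes L: "lamination_system L"
    and lim: "(x \<longlongrightarrow> \<alpha>) F" "(y \<longlongrightarrow> \<beta>) F" and S: "\<alpha> \<in> S1" "\<beta> \<in> S1" "\<alpha> \<noteq> \<beta>"
    and fr: "\<exists>\<^sub>F k in F. ivl (x k) (y k) \<in> L \<and> ivl (x k) (y k) \<subseteq> ivl \<alpha> \<beta>"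
  shows "ivl \<alpha> \<beta> \<in> L"
proof -
  obtain p where p: "p \<in> ivl \<alpha> \<beta>" using ivl_nonempty S by metis
  obtain q where q: "q \<in> ivl \<beta> \<alpha>" using ivl_nonempty S by metis
  have ex: "\<exists>k. ivl (x k) (y k) \<in> L \<and> ivl (x k) (y k) \<subseteq> ivl \<alpha> \<beta> \<and> p \<in> ivl (x k) (y k) \<and> z \<in> ivl (x k) (y k)"
    if z: "z \<in> ivl \<alpha> \<beta>" for z
  proof -
    have ev: "\<forall>\<^sub>F k in F. w \<in> ivl (x k) (y k)" if w: "w \<in> ivl \<alpha> \<beta>" for w
    proof -
      have "w \<in> S1" "ccw \<alpha> w \<beta>" using w by (simp_all add: ivl_def)
      then have "\<forall>\<^sub>F k in F. ccw (x k) w (y k)"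
        using lim S by (intro eventually_ccw[OF lim(1) tendsto_const lim(2)])
      then show ?thesis by eventually_elim (use \<open>w \<in> S1\<close> in \<open>simp add: ivl_def\<close>)
    qed
    have "\<exists>\<^sub>F k in F. (ivl (x k) (y k) \<in> L \<and> ivl (x k) (y k) \<subseteq> ivl \<alpha> \<beta>) \<and> p \<in> ivl (x k) (y k) \<and> z \<in> ivl (x k) (y k)"
      using frequently_eventually_frequently[OF fr eventually_conj[OF ev[OF p] ev[OF z]]] .
    then show ?thesis using frequently_ex by blast
  qed
  define \<K> where "\<K> = {J \<in> L. J \<subseteq> ivl \<alpha> \<beta> \<and> p \<in> J}"
  have gI: "good_interval (ivl \<alpha> \<beta>)" using good_ivl S by blast
  have KL: "\<K> \<subseteq> L" "\<K> \<noteq> {}" using ex[OF p] unfolding \<K>_def by blast+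
  have chain: "A \<subseteq> B \<or> B \<subseteq> A" if "A \<in> \<K>" "B \<in> \<K>" for A B
  proof (rule lam_nested[OF L])
    show "A \<in> L" "B \<in> L" "p \<in> A" "p \<in> B" using that unfolding \<K>_def by blast+
    have "ivl \<beta> \<alpha> \<subseteq> dual A"
      using dual_antimono[OF lam_good[OF L] gI, of A] that(1) dual_ivl[OF S] unfolding \<K>_def by auto
    then show "q \<in> dual A" using q by blast
    show "q \<notin> B" using that(2) q disjoint_ivl_swap[OF S(1,2)] unfolding \<K>_def by blast
  qed
  have sub: "\<Union>\<K> \<subseteq> ivl \<alpha> \<beta>" unfolding \<K>_def by blast
  then have "\<alpha> \<notin> \<Union>\<K>" "\<beta> \<notin> \<Union>\<K>" using endpoints_notin_ivl[OF S(1,2)] by blast+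
  then have "\<Union>\<K> \<in> L" using S by (intro lam_Union_chain_mem[OF L KL chain])
  moreover have "ivl \<alpha> \<beta> \<subseteq> \<Union>\<K>"
  proof
    fix z assume "z \<in> ivl \<alpha> \<beta>"
    then show "z \<in> \<Union>\<K>" using ex[of z] unfolding \<K>_def by blast
  qed
  ultimately show ?thesis using subset_antisym[OF sub] by simp
qed

text \<open>The closure axiom only sees limits from inside, so the approximating side has to be
  found: as leaves do not cross, from some point on either \<open>ivl (x k) (y k)\<close> lies in
  \<open>ivl \<alpha> \<beta>\<close> or its dual lies in the dual interval, and one of the two
  happens frequently.\<close>

lemma lam_closed:
  assumes L: "lamination_system L" and F: "F \<noteq> bot"
    and lim: "(x \<longlongrightarrow> \<alpha>) F" "(y \<longlongrightarrow> \<beta>) F" and S: "\<alpha> \<in> S1" "\<beta> \<in> S1" "\<alpha> \<noteq> \<beta>"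
    and xS: "\<And>k. x k \<in> S1" "\<And>k. y k \<in> S1" and xyL: "\<And>k. ivl (x k) (y k) \<in> L"
  shows "ivl \<alpha> \<beta> \<in> L"
proof -
  obtain p where p: "p \<in> ivl \<alpha> \<beta>" using ivl_nonempty S by metis
  obtain q where q: "q \<in> ivl \<beta> \<alpha>" using ivl_nonempty S by metis
  have pqS: "p \<in> S1" "q \<in> S1" using p q ivl_subset_S1 by blast+
  have pq: "ccw \<alpha> p \<beta>" "ccw \<beta> q \<alpha>" using p q by (simp_all add: ivl_def)
  have xy: "x k \<noteq> y k" for k using good_nonempty[OF lam_good[OF L xyL[of k]]] ivl_refl[OF xS(1)[of k]] by metis
  have yxL: "ivl (y k) (x k) \<in> L" for k using lam_dual[OF L xyL[of k]] dual_ivl[OF xS(1,2) xy] by simp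
  have ev: "\<forall>\<^sub>F k in F. ccw (x k) p (y k) \<and> ccw (y k) q (x k)"
    using pq pqS S
    by (intro eventually_conj eventually_ccw[OF lim(1) tendsto_const lim(2)]
        eventually_ccw[OF lim(2) tendsto_const lim(1)])
  have "\<forall>\<^sub>F k in F. ivl (x k) (y k) \<subseteq> ivl \<alpha> \<beta> \<or> ivl (y k) (x k) \<subseteq> ivl \<beta> \<alpha>"
    using ev
  proof eventually_elim
    case (elim k)
    note kS = xS(1)[of k] xS(2)[of k]
    \<comment> \<open>If both ends of a leaf lagged behind their limits, a later leaf, closer to the
      limits, would cross it. Both ends running ahead is excluded in the same way, which leaves
      nested positions.\<close>
    have "\<not> (ccw q (x k) \<alpha> \<and> ccw p (y k) \<beta>)"
    proof
      assume A: "ccw q (x k) \<alpha> \<and> ccw p (y k) \<beta>"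
      then have "ccw (x k) \<alpha> p" "ccw (y k) \<beta> q"
        using pq elim kS pqS S
        by (simp_all only: ccw_cyc[OF pqS(1)] S1_eq_iff[OF pqS(1)] cyc_def) (smt (verit))+
      then have "\<forall>\<^sub>F j in F. ccw (x k) (x j) p \<and> ccw (y k) (y j) q"
        using pqS S kS
        by (intro eventually_conj eventually_ccw[OF tendsto_const lim(1) tendsto_const]
            eventually_ccw[OF tendsto_const lim(2) tendsto_const])
      then have "\<forall>\<^sub>F j in F. False"
        using ev
      proof eventually_elim
        case (elim j)
        note jS = xS(1)[of j] xS(2)[of j]
        have "x j \<in> ivl (x k) (y k)" "y j \<in> ivl (y k) (x k)"
          using elim \<open>ccw (x k) p (y k) \<and> ccw (y k) q (x k)\<close> pqS kS jS
          by (simp_all only: mem_ivl_ccw ccw_cyc[OF pqS(1)] cyc_def simp_thms) (smt (verit))+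
        then show False using lam_unlinked[OF L kS jS xyL xyL] by blast
      qed
      then show False using F by simp
    qed
    moreover have "\<not> (ccw \<alpha> (x k) p \<and> ccw \<beta> (y k) q)"
    proof
      assume A: "ccw \<alpha> (x k) p \<and> ccw \<beta> (y k) q"
      then have "ccw q \<alpha> (x k)" "ccw p \<beta> (y k)"
        using pq elim kS pqS S
        by (simp_all only: ccw_cyc[OF pqS(1)] S1_eq_iff[OF pqS(1)] cyc_def) (smt (verit))+
      then have "\<forall>\<^sub>F j in F. ccw q (x j) (x k) \<and> ccw p (y j) (y k)"
        using pqS S kS
        by (intro eventually_conj eventually_ccw[OF tendsto_const lim(1) tendsto_const]
            eventually_ccw[OF tendsto_const lim(2) tendsto_const])
      then have "\<forall>\<^sub>F j in F. False"
        using ev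
      proof eventually_elim
        case (elim j)
        note jS = xS(1)[of j] xS(2)[of j]
        have "y j \<in> ivl (x k) (y k)" "x j \<in> ivl (y k) (x k)"
          using elim \<open>ccw (x k) p (y k) \<and> ccw (y k) q (x k)\<close> pqS kS jS
          by (simp_all only: mem_ivl_ccw ccw_cyc[OF pqS(1)] cyc_def simp_thms) (smt (verit))+
        then show False using lam_unlinked[OF L kS jS(2,1) xyL yxL] by blast
      qed
      then show False using F by simp
    qed
    ultimately have "(\<forall>z\<in>S1. ccw (x k) z (y k) \<longrightarrow> ccw \<alpha> z \<beta>) \<or> (\<forall>z\<in>S1. ccw (y k) z (x k) \<longrightarrow> ccw \<beta> z \<alpha>)"
    proof -
      assume n: "\<not> (ccw q (x k) \<alpha> \<and> ccw p (y k) \<beta>)" "\<not> (ccw \<alpha> (x k) p \<and> ccw \<beta> (y k) q)"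
      have "(ccw (x k) z (y k) \<longrightarrow> ccw \<alpha> z \<beta>) \<or> (ccw (y k) w (x k) \<longrightarrow> ccw \<beta> w \<alpha>)"
        if "z \<in> S1" "w \<in> S1" for z w
        using that n elim pq pqS kS S
        by (simp only: ccw_cyc[OF pqS(1)] S1_eq_iff[OF pqS(1)] cyc_def) (smt (verit))
      then show ?thesis by blast
    qed
    then show ?case unfolding ivl_def by blast
  qed
  then have "(\<exists>\<^sub>F k in F. ivl (x k) (y k) \<subseteq> ivl \<alpha> \<beta>) \<or> (\<exists>\<^sub>F k in F. ivl (y k) (x k) \<subseteq> ivl \<beta> \<alpha>)"
    using eventually_frequently[OF F] frequently_disj_iff by blast
  then show ?thesis
  proof
    assume "\<exists>\<^sub>F k in F. ivl (x k) (y k) \<subseteq> ivl \<alpha> \<beta>"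
    then show ?thesis using xyL by (intro lam_closed_inside[OF L lim S]) simp
  next
    assume "\<exists>\<^sub>F k in F. ivl (y k) (x k) \<subseteq> ivl \<beta> \<alpha>"
    then have "ivl \<beta> \<alpha> \<in> L" using yxL S by (intro lam_closed_inside[OF L lim(2,1)]) simp_all
    then show ?thesis using lam_dual[OF L] dual_ivl S by metis
  qed
qed

subsection \<open>Accumulation of flipped stitches\<close>

text \<open>A net of flipped stitches \<open>({us k, vs k}, {as k, bs k})\<close> converging to the stitch
  \<open>({u, v}, {a, b})\<close>, together with a pointwise limit \<open>\<gamma>\<close> of the involutions \<open>g k\<close> flipping them.\<close>

locale flipped_stitches =
  fixes L1 L2 :: "complex set set" and u a v b :: complex and F :: "'i filter"
    and g :: "'i \<Rightarrow> complex \<Rightarrow> complex" and \<gamma> :: "complex \<Rightarrow> complex"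
    and us as vs bs :: "'i \<Rightarrow> complex"
  assumes V: "veering_pair L1 L2" and F: "F \<noteq> bot"
    and S: "u \<in> S1" "a \<in> S1" "v \<in> S1" "b \<in> S1"
    and lvs: "ivl u v \<in> L1" "ivl a b \<in> L2" and cross: "a \<in> ivl u v" "b \<in> ivl v u"
    and aut: "\<And>k. lam_aut L1 (g k)" "\<And>k. lam_aut L2 (g k)"
    and invol: "\<And>k x. x \<in> S1 \<Longrightarrow> g k (g k x) = x"
    and Sk: "\<And>k. us k \<in> S1" "\<And>k. as k \<in> S1" "\<And>k. vs k \<in> S1" "\<And>k. bs k \<in> S1"
    and lvk: "\<And>k. ivl (us k) (vs k) \<in> L1" "\<And>k. ivl (as k) (bs k) \<in> L2"
    and gk: "\<And>k. g k (us k) = vs k" "\<And>k. g k (as k) = bs k"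
    and lim: "(us \<longlongrightarrow> u) F" "(as \<longlongrightarrow> a) F" "(vs \<longlongrightarrow> v) F" "(bs \<longlongrightarrow> b) F"
    and gam: "\<And>x. x \<in> S1 \<Longrightarrow> \<gamma> x \<in> S1" "\<And>x. x \<in> S1 \<Longrightarrow> ((\<lambda>k. g k x) \<longlongrightarrow> \<gamma> x) F"
begin

lemma lams: "lamination_system L1" "lamination_system L2"
  using veering_lam V by blast+

lemma circ: "circ (g k)" using aut_circ aut by blast

lemma gk': "g k (vs k) = us k" "g k (bs k) = as k"
  using invol[OF Sk(1)] invol[OF Sk(2)] gk by metis+

lemma gS: "x \<in> S1 \<Longrightarrow> g k x \<in> S1" using circ_S1[OF circ] .

lemma image_g_g: "A \<subseteq> S1 \<Longrightarrow> g k ` g k ` A = A"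
proof -
  assume "A \<subseteq> S1"
  then have "(\<lambda>x. g k (g k x)) ` A = (\<lambda>x. x) ` A" using invol by (intro image_cong) blast+
  then show ?thesis by (simp add: image_image)
qed

lemma distinct: "u \<noteq> v" "a \<noteq> b" "u \<noteq> a" "u \<noteq> b" "v \<noteq> a" "v \<noteq> b"
  using cross S disjoint_ivl_swap[OF S(1,3)] endpoints_notin_ivl ivl_refl by blast+

lemma distinct_k: "us k \<noteq> vs k" "as k \<noteq> bs k"
  using good_nonempty[OF lam_good[OF lams(1) lvk(1)[of k]]] good_nonempty[OF lam_good[OF lams(2) lvk(2)[of k]]]
    ivl_refl[OF Sk(1)[of k]] ivl_refl[OF Sk(2)[of k]] by metis+

lemma order: "ccw u a v" "ccw v b u" "ccw a v b" "ccw b u a"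
  using cross S by (simp_all only: mem_ivl_ccw ccw_cyc[OF S(1)] cyc_def simp_thms) (smt (verit))+

lemma duals: "dual (ivl u v) = ivl v u" "dual (ivl a b) = ivl b a"
  "dual (ivl (us k) (vs k)) = ivl (vs k) (us k)" "dual (ivl (as k) (bs k)) = ivl (bs k) (as k)"
  using dual_ivl S Sk distinct distinct_k by simp_all

lemma lvs': "ivl v u \<in> L1" "ivl b a \<in> L2" "ivl (vs k) (us k) \<in> L1" "ivl (bs k) (as k) \<in> L2"
  using lam_dual lams lvs lvk duals by metis+

text \<open>The points \<open>u\<close>, \<open>a\<close>, \<open>v\<close>, \<open>b\<close> occur
  in this counter-clockwise order, so shifting their names by one place is a quarter turn that
  exchanges the laminations.\<close>

lemma rotate: "flipped_stitches L2 L1 a v b u F g \<gamma> as vs bs us"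
proof
  show "veering_pair L2 L1" using veering_sym V by blast
  show "v \<in> ivl a b" "u \<in> ivl b a" using order S by (simp_all add: ivl_def)
qed (fact F S lvs lvs' aut invol Sk lvk gk gk' lim gam)+

lemma ends: "u \<in> endpoints L1" "v \<in> endpoints L1" "a \<in> endpoints L2" "b \<in> endpoints L2"
  using endpoints_ivl lams lvs S distinct by blast+

lemma disjoint_ends: "p \<in> endpoints L1 \<Longrightarrow> p \<notin> endpoints L2"
  using veering_endpoints V by blast

lemma crossing: "\<forall>\<^sub>F k in F. ccw (bs k) (us k) (as k) \<and> ccw (as k) (vs k) (bs k)"
  using order S by (intro eventually_conj eventually_ccw[OF lim(4,1,2)] eventually_ccw[OF lim(2,3,4)])

end

text \<open>No leaf of \<open>L\<close> separating \<open>u\<close> from \<open>v\<close> on the side of \<open>u\<close> is squeezed into \<open>v\<close> by the limit \<open>\<gamma>\<close>.\<close>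

definition good_end :: "complex set set \<Rightarrow> complex \<Rightarrow> complex \<Rightarrow> 'i filter \<Rightarrow> (complex \<Rightarrow> complex) \<Rightarrow>
    ('i \<Rightarrow> complex) \<Rightarrow> ('i \<Rightarrow> complex) \<Rightarrow> bool" where
  "good_end L u v F \<gamma> as bs \<longleftrightarrow> (\<forall>x\<in>S1. \<forall>y\<in>S1. x \<noteq> y \<and> ivl x y \<in> L \<and> u \<in> ivl x y \<and> v \<in> ivl y x \<and>
     (\<forall>\<^sub>F k in F. ivl x y \<subseteq> ivl (bs k) (as k)) \<longrightarrow> \<gamma> x \<noteq> v \<and> \<gamma> y \<noteq> v)"

context flipped_stitches
begin

text \<open>The map \<open>g k\<close> carries the leaf around \<open>us k\<close> to one around
  \<open>vs k\<close> inside \<open>ivl (as k) (bs k)\<close>. In the limit its ends lie between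
  \<open>a\<close> and \<open>v\<close> and between \<open>v\<close> and \<open>b\<close>; not being
  \<open>v\<close>, they are distinct, and closedness of \<open>L2\<close> makes them the ends of a
  leaf around \<open>v\<close>.\<close>

lemma near_limit:
  assumes xy: "x \<in> S1" "y \<in> S1" "x \<noteq> y" "ivl x y \<in> L2" "u \<in> ivl x y"
    and sub: "\<forall>\<^sub>F k in F. ivl x y \<subseteq> ivl (bs k) (as k)" and ne: "\<gamma> x \<noteq> v" "\<gamma> y \<noteq> v"
  shows "\<gamma> x \<in> endpoints L2" "\<gamma> y \<in> endpoints L2" "ccw (\<gamma> x) v (\<gamma> y)" "\<not> ccw v (\<gamma> x) a" "\<not> ccw b (\<gamma> y) v"
proof -
  note GS = gam(1)[OF xy(1)] gam(1)[OF xy(2)]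
  have "ccw x u y" using xy(5) by (simp add: ivl_def)
  then have "\<forall>\<^sub>F k in F. ccw x (us k) y"
    using xy S by (intro eventually_ccw[OF tendsto_const lim(1) tendsto_const])
  with sub have "\<forall>\<^sub>F k in F. ccw (g k x) (vs k) (g k y) \<and> \<not> ccw (vs k) (g k x) (as k) \<and> \<not> ccw (bs k) (g k y) (vs k)"
  proof eventually_elim
    case (elim k)
    note gkS = gS[OF xy(1), of k] gS[OF xy(2), of k]
    have 1: "ccw (g k x) (vs k) (g k y)" using circ_ccw[OF circ[of k] xy(1) Sk(1)[of k] xy(2)] gk(1)[of k] elim(2) by simp
    have "g k ` ivl x y \<subseteq> g k ` ivl (bs k) (as k)" using elim by blast
    then have "ivl (g k x) (g k y) \<subseteq> ivl (as k) (bs k)"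
      using circ_ivl[OF circ] xy Sk gk gk' by simp
    then have "as k \<notin> ivl (g k x) (g k y)" "bs k \<notin> ivl (g k x) (g k y)"
      using endpoints_notin_ivl[OF Sk(2,4)] by blast+
    then show ?case using 1 gkS Sk[of k]
      by (simp only: mem_ivl_ccw ccw_cyc[OF Sk(1)[of k]] cyc_def simp_thms) (smt (verit))
  qed
  then have ev: "\<forall>\<^sub>F k in F. ccw (g k x) (vs k) (g k y)" "\<forall>\<^sub>F k in F. \<not> ccw (vs k) (g k x) (as k)"
    "\<forall>\<^sub>F k in F. \<not> ccw (bs k) (g k y) (vs k)"
    by (simp_all add: eventually_conj_iff)
  show 1: "\<not> ccw v (\<gamma> x) a"
    by (rule limit_not_ccw[OF F lim(3) gam(2)[OF xy(1)] lim(2) S(3) GS(1) S(2) ev(2)])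
  show 2: "\<not> ccw b (\<gamma> y) v"
    by (rule limit_not_ccw[OF F lim(4) gam(2)[OF xy(2)] lim(3) S(4) GS(2) S(3) ev(3)])
  have ne': "\<gamma> x \<noteq> \<gamma> y"
    using 1 2 ne order S GS
    by (simp only: ccw_cyc[OF S(1)] S1_eq_iff[OF S(1)] cyc_def) (smt (verit))
  have "ivl (g k x) (g k y) \<in> L2" for k
    using aut_image[OF aut(2) xy(4)] circ_ivl[OF circ xy(1,2)] by simp
  then have "ivl (\<gamma> x) (\<gamma> y) \<in> L2"
    using gS xy by (intro lam_closed[OF lams(2) F gam(2) gam(2) GS ne']) 
  then show "\<gamma> x \<in> endpoints L2" "\<gamma> y \<in> endpoints L2" using endpoints_ivl[OF lams(2)] GS ne' by blast+
  have "\<forall>\<^sub>F k in F. \<not> ccw (g k x) (g k y) (vs k)"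
    using ev(1)
  proof eventually_elim
    case (elim k)
    then show ?case using gS[OF xy(1), of k] gS[OF xy(2), of k] Sk[of k]
      by (simp only: ccw_cyc[OF Sk(1)[of k]] cyc_def) (smt (verit))
  qed
  then have "\<not> ccw (\<gamma> x) (\<gamma> y) v"
    using limit_not_ccw[OF F gam(2)[OF xy(1)] gam(2)[OF xy(2)] lim(3) GS S(3)] by blast
  then show "ccw (\<gamma> x) v (\<gamma> y)" using ne ne' not_ccw_iff[OF GS S(3)] by metis
qed

text \<open>If \<open>g k\<close> squeezed a leaf around \<open>u\<close> into \<open>v\<close> and one around \<open>v\<close> into \<open>u\<close>, the square of \<open>g k\<close> would
  shrink the first one.\<close>

lemma good_end_cases: "good_end L2 u v F \<gamma> as bs \<or> good_end L2 v u F \<gamma> bs as"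
proof (rule ccontr)
  assume "\<not> ?thesis"
  then obtain x y x' y' where
    xy: "x \<in> S1" "y \<in> S1" "x \<noteq> y" "ivl x y \<in> L2" "u \<in> ivl x y" "v \<in> ivl y x"
      "\<forall>\<^sub>F k in F. ivl x y \<subseteq> ivl (bs k) (as k)" "\<not> (\<gamma> x \<noteq> v \<and> \<gamma> y \<noteq> v)" and
    xy': "x' \<in> S1" "y' \<in> S1" "x' \<noteq> y'" "ivl x' y' \<in> L2" "v \<in> ivl x' y'" "u \<in> ivl y' x'"
      "\<not> (\<gamma> x' \<noteq> u \<and> \<gamma> y' \<noteq> u)"
    unfolding good_end_def by blast
  define J where "J = ivl x y"
  define J' where "J' = ivl x' y'"
  \<comment> \<open>An end of the leaf around \<open>u\<close> that converges to \<open>v\<close>;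
    \<open>e'\<close> plays the same role with \<open>u\<close> and \<open>v\<close>
    exchanged.\<close>
  obtain e where e: "e \<in> {x, y}" "\<gamma> e = v" using xy by blast
  obtain e' where e': "e' \<in> {x', y'}" "\<gamma> e' = u" using xy' by blast
  have eS: "e \<in> S1" "e' \<in> S1" using e e' xy xy' by blast+
  have eJ: "e \<notin> J" "e' \<notin> J'"
    unfolding J_def J'_def using e e' endpoints_notin_ivl[OF xy(1,2)] endpoints_notin_ivl[OF xy'(1,2)] by blast+
  have mem: "\<forall>\<^sub>F k in F. z k \<in> ivl s t" if "z0 \<in> ivl s t" "(z \<longlongrightarrow> z0) F" "s \<in> S1" "t \<in> S1" "\<And>k. z k \<in> S1" for z z0 s t
  proof -
    have "z0 \<in> S1" "ccw s z0 t" using that(1) by (simp_all add: ivl_def)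
    then have "\<forall>\<^sub>F k in F. ccw s (z k) t" using that by (intro eventually_ccw[OF tendsto_const that(2) tendsto_const])
    then show ?thesis by eventually_elim (use that(5) in \<open>simp add: ivl_def\<close>)
  qed
  have "\<forall>\<^sub>F k in F. (g k e \<in> J' \<and> g k e' \<in> J) \<and> (us k \<in> J \<and> vs k \<in> J') \<and> us k \<in> ivl y' x' \<and> vs k \<in> ivl y x"
    unfolding J_def J'_def
    using xy xy' e e' gam(2)[OF eS(1)] gam(2)[OF eS(2)] gS eS lim Sk
    by (intro eventually_conj mem) simp_all
  then obtain k where k: "g k e \<in> J'" "g k e' \<in> J" "us k \<in> J" "vs k \<in> J'" "us k \<in> ivl y' x'" "vs k \<in> ivl y x"
    using eventually_happens'[OF F] by blast
  have JL: "J \<in> L2" "J' \<in> L2" unfolding J_def J'_def using xy xy' by blast+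
  have JS: "J \<subseteq> S1" "J' \<subseteq> S1" unfolding J_def J'_def using ivl_subset_S1 by blast+
  have d: "dual J = ivl y x" "dual J' = ivl y' x'" unfolding J_def J'_def using dual_ivl xy xy' by simp_all
  have gJL: "g k ` J \<in> L2" "g k ` J' \<in> L2" using aut_image[OF aut(2)] JL by blast+
  have iff: "g k z \<in> g k ` A \<longleftrightarrow> z \<in> A" if "z \<in> S1" "A \<subseteq> S1" for z A
    using circ_mem_image[OF circ that] .
  have vJ: "vs k \<notin> J" using k(6) disjoint_ivl_swap[OF xy(1,2)] unfolding J_def by blast
  have uJ': "us k \<notin> J'" using k(5) disjoint_ivl_swap[OF xy'(1,2)] unfolding J'_def by blast
  have m: "vs k \<in> g k ` J" "us k \<in> g k ` J'" "us k \<notin> g k ` J" "vs k \<notin> g k ` J'"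
    using iff[OF Sk(1) JS(1), of k] iff[OF Sk(3) JS(2), of k] iff[OF Sk(3) JS(1), of k] iff[OF Sk(1) JS(2), of k]
      gk[of k] gk'[of k] k vJ uJ' by simp_all
  \<comment> \<open>Since \<open>e\<close> is moved into \<open>J'\<close> but not into the image of
    \<open>J\<close>, nesting forces the image of \<open>J\<close> into \<open>J'\<close>. Applying
    \<open>g k\<close> again puts \<open>J\<close> into the image of \<open>J'\<close>, which misses
    the point \<open>g k e'\<close> of \<open>J\<close>.\<close>
  have "J' \<subseteq> g k ` J \<or> g k ` J \<subseteq> J'"
    using lam_nested[OF lams(2) JL(2) gJL(1) k(4) m(1), of "us k"] k(5) m(3) d by blast
  moreover have "\<not> J' \<subseteq> g k ` J" using k(1) iff[OF eS(1) JS(1)] eJ by blast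
  moreover have "J \<subseteq> g k ` J' \<or> g k ` J' \<subseteq> J"
    using lam_nested[OF lams(2) JL(1) gJL(2) k(3) m(2), of "vs k"] k(6) m(4) d by blast
  moreover have nJ: "\<not> J \<subseteq> g k ` J'" using k(2) iff[OF eS(2) JS(2)] eJ by blast
  ultimately have "g k ` J \<subseteq> J'" by blast
  then have "g k ` g k ` J \<subseteq> g k ` J'" by blast
  then show False using nJ image_g_g[OF JS(1)] by simp
qed

text \<open>The intervals \<open>X\<close> and \<open>Y\<close> constructed below are consecutive among the elements of \<open>L2\<close> around \<open>u\<close>
  avoiding \<open>v\<close>, with the endpoint \<open>c\<close> of \<open>L1\<close> between them. Their images under \<open>g k\<close> and \<open>g j\<close> are again
  consecutive and, for large \<open>k\<close> and \<open>j\<close>, too close to be different. So \<open>g j \<circ> g k\<close> has enough fixed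
  points for \<open>endpoint_fixed\<close> to apply to the leaves of the stitches.\<close>

lemma stitches_equal:
  assumes good: "good_end L2 u v F \<gamma> as bs" "good_end L1 a b F \<gamma> vs us"
  shows "\<forall>\<^sub>F k in F. \<forall>\<^sub>F j in F. us k = us j \<and> vs k = vs j \<and> as k = as j \<and> bs k = bs j"
proof -
  interpret R: flipped_stitches L2 L1 a v b u F g \<gamma> as vs bs us by (rule rotate)
  have vE: "v \<notin> endpoints L2" "u \<notin> endpoints L2" using disjoint_ends ends by blast+
  have "finite {u, v}" "{u, v} \<subseteq> S1 - {a}" using S distinct by (simp_all del: mem_sphere_0)
  \<comment> \<open>Its end \<open>c\<close> lies between \<open>u\<close> and \<open>a\<close>.
    Being an endpoint of \<open>L1\<close>, it is strictly on one side of each leaf of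
    \<open>L2\<close>, so it cuts the chain \<open>C\<close> below into two parts.\<close>
  then obtain K where K: "K \<in> L1" "a \<in> K" "{u, v} \<subseteq> dual K" using rainbow[OF R.V ends(3)] by blast
  obtain c d where cd: "c \<in> S1" "d \<in> S1" "c \<noteq> d" "K = ivl c d" "dual K = ivl d c"
    using good_cases[OF lam_good[OF lams(1) K(1)]] by metis
  have uvK: "ccw d u c" "ccw d v c" "ccw c a d" using K cd by (simp_all add: ivl_def)
  have cE: "c \<in> endpoints L1" using endpoints_ivl[OF lams(1)] K(1) cd by blast
  then have cE2: "c \<notin> endpoints L2" by (rule disjoint_ends)
  have ord_c: "ccw u c a" "ccw c a v" "ccw b c a" "ccw d b c" "ccw u c v" "c \<noteq> u" "c \<noteq> v"
    using uvK order S cd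
    by (simp_all only: ccw_cyc[OF S(1)] S1_eq_iff[OF S(1)] cyc_def) (smt (verit))+
  have "\<forall>\<^sub>F k in F. ccw d (us k) c \<and> ccw d (vs k) c \<and> ccw (us k) a (vs k)"
    using uvK cd S order
    by (intro eventually_conj eventually_ccw[OF tendsto_const lim(1) tendsto_const]
        eventually_ccw[OF tendsto_const lim(3) tendsto_const] eventually_ccw[OF lim(1) tendsto_const lim(3)])
  then have Ksub: "\<forall>\<^sub>F k in F. ivl c d \<subseteq> ivl (us k) (vs k)"
  proof eventually_elim
    case (elim k)
    then have "us k \<notin> ivl c d" "vs k \<notin> ivl c d"
      using disjoint_ivl_swap[OF cd(1,2)] Sk unfolding ivl_def by blast+
    moreover have "a \<in> ivl c d" "a \<in> ivl (us k) (vs k)" using elim uvK S unfolding ivl_def by blast+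
    ultimately show ?case using ivl_around_subset[OF S(2) cd(1,2) Sk(1,3)] by blast
  qed
  have bK: "b \<in> ivl d c" using ord_c S by (simp add: ivl_def)
  have "\<gamma> c \<noteq> b \<and> \<gamma> d \<noteq> b"
    using good(2) cd(1-3) K(1,2) bK Ksub unfolding good_end_def cd(4) by blast
  then have gc: "\<gamma> c \<in> endpoints L1" "\<not> ccw b (\<gamma> c) v"
    using R.near_limit[OF cd(1-3) _ _ Ksub] K(1,2) cd(4) by blast+
  define C where "C = {J \<in> L2. u \<in> J \<and> v \<in> dual J}"
  have nest: "I \<subseteq> J \<or> J \<subseteq> I" if "I \<in> C" "J \<in> C" for I J
    using lam_nested[OF lams(2), of I J u v] that dual_disjoint[OF lam_good[OF lams(2)], of J] unfolding C_def by blast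
  have dis: "J \<inter> dual J = {}" if "J \<in> C" for J using dual_disjoint lam_good[OF lams(2)] that unfolding C_def by blast
  have "finite {c, v}" "{c, v} \<subseteq> S1 - {u}" using S distinct cd ord_c by (simp_all del: mem_sphere_0)
  then obtain J0 where J0: "J0 \<in> L2" "u \<in> J0" "{c, v} \<subseteq> dual J0" using rainbow[OF V ends(1)] by blast
  have J0C: "J0 \<in> C" "c \<in> dual J0" using J0 unfolding C_def by blast+
  have MC: "ivl b a \<in> C" "c \<in> ivl b a"
    using lvs'(2) order ord_c S cd dual_ivl[OF S(4,2)] distinct unfolding C_def by (simp_all add: ivl_def)
  \<comment> \<open>The largest member of \<open>C\<close> without \<open>c\<close>; the interval
    \<open>J0\<close> shows that there is one.\<close>
  define X where "X = \<Union>{J \<in> C. c \<in> dual J}"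
  \<comment> \<open>The smallest member of \<open>C\<close> with \<open>c\<close> would be an
    intersection, so it is built as the dual of a union; \<open>ivl b a\<close> is a member to start
    from.\<close>
  define Y' where "Y' = \<Union>(dual ` {J \<in> C. c \<in> J})"
  have XL: "X \<in> L2" unfolding X_def
  proof (rule lam_Union_chain_mem[OF lams(2) _ _ _ S(3) _ cd(1)])
    show "{J \<in> C. c \<in> dual J} \<subseteq> L2" unfolding C_def by blast
    show "{J \<in> C. c \<in> dual J} \<noteq> {}" using J0C by blast
    show "I \<subseteq> J \<or> J \<subseteq> I" if "I \<in> {J \<in> C. c \<in> dual J}" "J \<in> {J \<in> C. c \<in> dual J}" for I J
      using nest that by blast
    show "v \<notin> \<Union>{J \<in> C. c \<in> dual J}" using dis unfolding C_def by blast
    show "c \<notin> \<Union>{J \<in> C. c \<in> dual J}" using dis by blast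
    show "v \<noteq> c" using ord_c by blast
  qed
  have Y'L: "Y' \<in> L2" unfolding Y'_def
  proof (rule lam_Union_chain_mem[OF lams(2) _ _ _ S(1) _ cd(1)])
    show "dual ` {J \<in> C. c \<in> J} \<subseteq> L2" using lam_dual[OF lams(2)] unfolding C_def by blast
    show "dual ` {J \<in> C. c \<in> J} \<noteq> {}" using MC by blast
    show "I \<subseteq> J \<or> J \<subseteq> I" if IJ: "I \<in> dual ` {J \<in> C. c \<in> J}" "J \<in> dual ` {J \<in> C. c \<in> J}" for I J
    proof -
      obtain I' J' where "I' \<in> C" "J' \<in> C" "I = dual I'" "J = dual J'" using IJ by blast
      then show ?thesis
        using nest[of I' J'] dual_antimono lam_good[OF lams(2), of I'] lam_good[OF lams(2), of J']
        unfolding C_def by blast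
    qed
    show "u \<notin> \<Union>(dual ` {J \<in> C. c \<in> J})" using dis unfolding C_def by blast
    show "c \<notin> \<Union>(dual ` {J \<in> C. c \<in> J})" using dis by blast
    show "u \<noteq> c" using ord_c by blast
  qed
  define Y where "Y = dual Y'"
  note gX = lam_good[OF lams(2) XL] and gY' = lam_good[OF lams(2) Y'L]
  have YL: "Y \<in> L2" and dY: "dual Y = Y'" unfolding Y_def using lam_dual[OF lams(2) Y'L] gY' by simp_all
  note gY = lam_good[OF lams(2) YL]
  have uX: "u \<in> X" using J0C unfolding X_def C_def by blast
  have vX: "v \<in> dual X"
    using not_endpoint_cases[OF lams(2) XL S(3) vE(1)] dis unfolding X_def C_def by blast
  have cX: "c \<in> dual X"
    using not_endpoint_cases[OF lams(2) XL cd(1) cE2] dis unfolding X_def by blast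
  have cY: "c \<in> Y"
    unfolding Y_def using not_endpoint_cases[OF lams(2) Y'L cd(1) cE2] dis unfolding Y'_def by blast
  have vY: "v \<in> dual Y" unfolding dY Y'_def using MC(1,2) unfolding C_def by blast
  have "X \<inter> Y' = {}"
  proof -
    have "J \<inter> dual J' = {}" if J: "J \<in> C" "c \<in> dual J" "J' \<in> C" "c \<in> J'" for J J'
      using nest[OF J(1,3)] dis[OF J(1)] dis[OF J(3)] J by blast
    then show ?thesis unfolding X_def Y'_def by blast
  qed
  then have XY: "X \<subseteq> Y" unfolding Y_def by (rule good_disjoint_imp_subset_dual[OF gX gY'])
  have uY: "u \<in> Y" using uX XY by blast
  have Ymin: "Y \<subseteq> J" if "J \<in> C" "c \<in> J" for J
  proof -
    have "dual J \<subseteq> Y'" using that unfolding Y'_def by blast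
    then show ?thesis
      using dual_subset_iff[OF gY, of J] dY lam_good[OF lams(2)] that(1) unfolding C_def by blast
  qed
  have cover: "J = X \<or> J = Y" if J: "J \<in> L2" "X \<subseteq> J" "J \<subseteq> Y" for J
  proof -
    have "dual Y \<subseteq> dual J" using dual_antimono[OF lam_good[OF lams(2) J(1)] gY J(3)] .
    then have JC: "J \<in> C" using J uX vY unfolding C_def by blast
    show ?thesis
    proof (cases "c \<in> J")
      case True then show ?thesis using Ymin[OF JC] J(3) by blast
    next
      case False
      then have "c \<in> dual J" using not_endpoint_cases[OF lams(2) J(1) cd(1) cE2] by blast
      then have "J \<subseteq> X" using JC unfolding X_def by blast
      then show ?thesis using J(2) by blast
    qed
  qed
  obtain x y where xy: "x \<in> S1" "y \<in> S1" "x \<noteq> y" "X = ivl x y" "dual X = ivl y x" using good_cases[OF gX] by metis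
  obtain x' y' where xy': "x' \<in> S1" "y' \<in> S1" "x' \<noteq> y'" "Y = ivl x' y'" "dual Y = ivl y' x'" using good_cases[OF gY] by metis
  have m: "ccw x u y" "ccw y v x" "ccw y c x" "ccw x' u y'" "ccw x' c y'" "ccw y' v x'"
    using uX vX cX uY cY vY xy(4,5) xy'(4,5) by (simp_all add: ivl_def)
  have ord_y: "ccw u y v" "ccw u y' v" "y \<noteq> y'" "ccw y c v" "ccw b y a"
    using m ord_c order S xy(1,2) xy'(1,2) cd(1)
    by (simp_all only: ccw_cyc[OF S(1)] S1_eq_iff[OF S(1)] cyc_def) (smt (verit))+
  have "\<forall>\<^sub>F k in F. (ccw (bs k) (us k) (as k) \<and> ccw (as k) (vs k) (bs k)) \<and>
      (ccw (bs k) u (as k) \<and> ccw (as k) v (bs k) \<and> ccw (bs k) c (as k))"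
    using order ord_c S cd
    by (intro eventually_conj[OF crossing] eventually_conj eventually_ccw[OF lim(4) tendsto_const lim(2)]
        eventually_ccw[OF lim(2) tendsto_const lim(4)])
  then have Ysub: "\<forall>\<^sub>F k in F. Y \<subseteq> ivl (bs k) (as k)"
  proof eventually_elim
    case (elim k)
    have "ivl (bs k) (as k) \<in> C" "c \<in> ivl (bs k) (as k)"
      using elim lvs'(4)[of k] S cd(1) dual_ivl[OF Sk(4,2) distinct_k(2)[symmetric]] unfolding C_def by (simp_all add: ivl_def)
    then show ?case by (rule Ymin)
  qed
  then have Xsub: "\<forall>\<^sub>F k in F. ivl x y \<subseteq> ivl (bs k) (as k)"
    by (rule eventually_mono) (use XY xy(4) in blast)
  have "\<gamma> x \<noteq> v \<and> \<gamma> y \<noteq> v"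
    using good(1) xy(1-3) XL uX vX Xsub xy(5) unfolding good_end_def xy(4) by blast
  then have gy: "\<gamma> y \<in> endpoints L2" "ccw (\<gamma> x) v (\<gamma> y)" "\<not> ccw b (\<gamma> y) v"
    using near_limit[OF xy(1-3) _ _ Xsub] XL uX xy(4) by blast+
  note GS = gam(1)[OF xy(1)] gam(1)[OF xy(2)] gam(1)[OF cd(1)]
  have "\<forall>\<^sub>F k in F. ccw y c (vs k)"
    using ord_y S cd xy by (intro eventually_ccw[OF tendsto_const tendsto_const lim(3)])
  then have "\<forall>\<^sub>F k in F. \<not> ccw (g k y) (us k) (g k c)"
  proof eventually_elim
    case (elim k)
    then have "ccw (g k y) (g k c) (us k)" using circ_ccw[OF circ xy(2) cd(1) Sk(3)] gk'[of k] by metis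
    then show ?case using gS[OF xy(2), of k] gS[OF cd(1), of k] Sk[of k]
      by (simp only: ccw_cyc[OF Sk(1)[of k]] cyc_def) (smt (verit))
  qed
  then have "\<not> ccw (\<gamma> y) u (\<gamma> c)"
    by (rule limit_not_ccw[OF F gam(2)[OF xy(2)] lim(1) gam(2)[OF cd(1)] GS(2) S(1) GS(3)])
  moreover have "\<gamma> y \<noteq> \<gamma> c" using gy gc disjoint_ends by metis
  \<comment> \<open>Here both hypotheses meet: \<open>\<gamma> y\<close> is an endpoint of
    \<open>L2\<close> and \<open>\<gamma> c\<close> one of \<open>L1\<close>. The resulting strict
    order of \<open>\<gamma> y\<close>, \<open>\<gamma> c\<close>, \<open>u\<close> is an open
    condition, so it persists for nearby maps.\<close>
  moreover have "\<gamma> y \<noteq> u" using gy vE by blast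
  moreover have "\<gamma> c \<noteq> u" using gc(2) order S by (metis ccw_rotate)
  ultimately have gyc: "ccw (\<gamma> y) (\<gamma> c) u" using not_ccw_iff[OF GS(2,3) S(1)] by metis
  \<comment> \<open>Two conditions compare \<open>g k\<close> with the limit
    \<open>\<gamma>\<close>: once \<open>k\<close> is fixed, \<open>\<gamma>\<close> may be replaced
    in them by \<open>g j\<close> for all large \<open>j\<close>.\<close>
  define E where "E k \<longleftrightarrow> ccw (g k x) v (g k y) \<and> Y \<subseteq> ivl (bs k) (as k) \<and> ccw (bs k) u (as k) \<and>
    ccw (g k y) (\<gamma> c) u \<and> ccw (\<gamma> y) (g k c) u \<and> ccw (us k) y (vs k) \<and> ccw (us k) y' (vs k) \<and>
    ccw (bs k) y (as k) \<and> ccw (bs k) (us k) (as k) \<and> us k \<noteq> v \<and> as k \<noteq> b" for k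
  have evE: "\<forall>\<^sub>F k in F. E k"
    unfolding E_def
    by (intro eventually_conj Ysub eventually_ccw[OF gam(2)[OF xy(1)] tendsto_const gam(2)[OF xy(2)] GS(1) S(3) GS(2) gy(2)]
      eventually_ccw[OF lim(4) tendsto_const lim(2) S(4,1,2) order(4)]
      eventually_ccw[OF gam(2)[OF xy(2)] tendsto_const tendsto_const GS(2,3) S(1) gyc]
      eventually_ccw[OF tendsto_const gam(2)[OF cd(1)] tendsto_const GS(2,3) S(1) gyc]
      eventually_ccw[OF lim(1) tendsto_const lim(3) S(1) xy(2) S(3) ord_y(1)]
      eventually_ccw[OF lim(1) tendsto_const lim(3) S(1) xy'(2) S(3) ord_y(2)]
      eventually_ccw[OF lim(4) tendsto_const lim(2) S(4) xy(2) S(2) ord_y(5)]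
      eventually_ccw[OF lim(4,1,2) S(4,1,2) order(4)]
      tendsto_imp_eventually_ne[OF lim(1) distinct(1)] tendsto_imp_eventually_ne[OF lim(2) distinct(2)])
  have XS: "X \<subseteq> S1" "Y \<subseteq> S1" using good_subset_S1 gX gY by blast+
  have gL: "g k ` X \<in> L2" "g k ` Y \<in> L2" for k using aut_image[OF aut(2)] XL YL by blast+
  have gXY: "g k ` X \<subseteq> g k ` Y" for k using XY by blast
  have gXi: "g k ` X = ivl (g k x) (g k y)" "g k ` Y = ivl (g k x') (g k y')" for k
    using circ_ivl[OF circ] xy xy' by simp_all
  have base: "v \<in> g k ` X" "v \<in> g k ` Y" "u \<in> dual (g k ` X)" "u \<in> dual (g k ` Y)" "u \<notin> g k ` X" "u \<notin> g k ` Y"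
    if "E k" for k
  proof -
    show v: "v \<in> g k ` X" using that S unfolding E_def gXi ivl_def by blast
    then show "v \<in> g k ` Y" using gXY by blast
    have "g k ` Y \<subseteq> g k ` ivl (bs k) (as k)" using that unfolding E_def by blast
    then have "g k ` Y \<subseteq> ivl (as k) (bs k)" using circ_ivl[OF circ Sk(4,2)] gk gk' by simp
    then have "ivl (bs k) (as k) \<subseteq> dual (g k ` Y)"
      using dual_antimono[OF lam_good[OF lams(2) gL(2)] lam_good[OF lams(2) lvk(2)]] duals(4) by metis
    moreover have "u \<in> ivl (bs k) (as k)" using that S unfolding E_def ivl_def by blast
    ultimately show uY: "u \<in> dual (g k ` Y)" by blast
    then show uX: "u \<in> dual (g k ` X)"
      using dual_antimono[OF lam_good[OF lams(2) gL(1)] lam_good[OF lams(2) gL(2)] gXY] by blast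
    show "u \<notin> g k ` X" "u \<notin> g k ` Y"
      using dual_disjoint[OF lam_good[OF lams(2) gL(1)]] dual_disjoint[OF lam_good[OF lams(2) gL(2)]] uX uY by blast+
  qed
  have coverg: "J = g k ` X \<or> J = g k ` Y" if J: "J \<in> L2" "g k ` X \<subseteq> J" "J \<subseteq> g k ` Y" for J k
  proof -
    have JS: "J \<subseteq> S1" using good_subset_S1 lam_good[OF lams(2) J(1)] by blast
    have "g k ` g k ` X \<subseteq> g k ` J" "g k ` J \<subseteq> g k ` g k ` Y" using J by blast+
    then have "g k ` J = X \<or> g k ` J = Y"
      using cover[OF aut_image[OF aut(2) J(1)]] image_g_g[OF XS(1)] image_g_g[OF XS(2)] by metis
    then show ?thesis using image_g_g[OF JS] by metis
  qed
  \<comment> \<open>No element lies strictly between the images of \<open>X\<close> and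
    \<open>Y\<close> under \<open>g k\<close>, so a strictly larger \<open>g j\<close>
    X\<open>would contain all of\<close>g k \<open>Y\<close>. But \<open>g k c\<close> lies beyond
    the end \<open>g j y\<close>.\<close>
  have step: "\<not> g k ` X \<subset> g j ` X" if E: "E k" "E j" and jk: "ccw (g j y) (g k c) u" for j k
  proof
    assume sub: "g k ` X \<subset> g j ` X"
    have "g k ` Y \<subseteq> g j ` X \<or> g j ` X \<subseteq> g k ` Y"
      using lam_nested[OF lams(2) gL(2) gL(1) base(2)[OF E(1)] base(1)[OF E(2)] base(4)[OF E(1)] base(5)[OF E(2)]] .
    then have "g k ` Y \<subseteq> g j ` X" using coverg[OF gL(1), of k j] sub by blast
    then have "g k c \<in> ivl (g j x) (g j y)" using cY gXi by blast
    moreover have "u \<notin> ivl (g j x) (g j y)" using base(5)[OF E(2)] gXi by simp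
    ultimately show False
      using jk gS[OF xy(1), of j] gS[OF xy(2), of j] gS[OF cd(1), of k] S(1)
      by (simp only: mem_ivl_ccw ccw_cyc[OF S(1)] cyc_def simp_thms) (smt (verit))
  qed
  have main: "us k = us j \<and> vs k = vs j \<and> as k = as j \<and> bs k = bs j"
    if E: "E k" "E j" and jk: "ccw (g j y) (g k c) u" "ccw (g k y) (g j c) u"
      and ne: "vs j \<noteq> us k" "bs j \<noteq> as k" for j k
  proof -
    have "g k ` X \<subseteq> g j ` X \<or> g j ` X \<subseteq> g k ` X"
      using lam_nested[OF lams(2) gL(1) gL(1) base(1)[OF E(1)] base(1)[OF E(2)] base(3)[OF E(1)] base(5)[OF E(2)]] .
    then have eqX: "g k ` X = g j ` X" using step[OF E jk(1)] step[OF E(2,1) jk(2)] by blast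
    have nXY: "g i ` X \<noteq> g i ` Y" for i
    proof
      assume "g i ` X = g i ` Y"
      then have "X = Y" using circ_image_eq_iff[OF circ XS] by blast
      then show False using cX cY dual_disjoint[OF gY] by blast
    qed
    have "g k ` Y \<subseteq> g j ` Y \<or> g j ` Y \<subseteq> g k ` Y"
      using lam_nested[OF lams(2) gL(2) gL(2) base(2)[OF E(1)] base(2)[OF E(2)] base(4)[OF E(1)] base(6)[OF E(2)]] .
    then have eqY: "g k ` Y = g j ` Y"
    proof
      assume "g k ` Y \<subseteq> g j ` Y"
      then have "g k ` Y = g j ` X \<or> g k ` Y = g j ` Y"
        using gXY[of k] unfolding eqX by (intro coverg[OF gL(2)])
      then show ?thesis using nXY[of k] eqX by metis
    next
      assume "g j ` Y \<subseteq> g k ` Y"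
      then have "g j ` Y = g k ` X \<or> g j ` Y = g k ` Y"
        using gXY[of j] unfolding eqX[symmetric] by (intro coverg[OF gL(2)])
      then show ?thesis using nXY[of j] eqX by metis
    qed
    have "ivl (g k x) (g k y) = ivl (g j x) (g j y)" "ivl (g k x') (g k y') = ivl (g j x') (g j y')"
      using eqX eqY gXi by simp_all
    moreover have "g i x \<noteq> g i y" "g i x' \<noteq> g i y'" for i using circ_eq_iff[OF circ] xy xy' by simp_all
    ultimately have gy: "g k y = g j y" "g k y' = g j y'"
      using ivl_inject[of "g k x" "g k y" "g j x" "g j y"] ivl_inject[of "g k x'" "g k y'" "g j x'" "g j y'"]
        gS xy(1,2) xy'(1,2) by simp_all
    \<comment> \<open>The maps agree on the right ends \<open>y\<close> and \<open>y'\<close> and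
      are involutions, so \<open>h\<close> fixes these points and their images: two fixed points on
      each side of the leaf with ends \<open>us k\<close> and \<open>vs k\<close>.\<close>
    define h where "h = g j \<circ> g k"
    have h: "lam_aut L1 h" "lam_aut L2 h" unfolding h_def using aut_comp aut by blast+
    have hfix: "h y = y" "h y' = y'" "h (g k y) = g k y" "h (g k y') = g k y'"
      unfolding h_def comp_apply using gy invol[OF xy(2)] invol[OF xy'(2)] by metis+
    note gyS = gS[OF xy(2), of k] gS[OF xy'(2), of k]
    have yin: "y \<in> ivl (us k) (vs k)" "y' \<in> ivl (us k) (vs k)"
      using E(1) xy(2) xy'(2) unfolding E_def ivl_def by blast+
    have gyin: "g k y \<in> ivl (vs k) (us k)" "g k y' \<in> ivl (vs k) (us k)"
      using circ_mem_ivl[OF circ[of k] Sk(1)[of k] Sk(3)[of k] xy(2)]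
        circ_mem_ivl[OF circ[of k] Sk(1)[of k] Sk(3)[of k] xy'(2)] yin gk[of k] gk'[of k] by simp_all
    have gne: "g k y \<noteq> g k y'" using ord_y(3) circ_eq_iff[OF circ xy(2) xy'(2)] by blast
    have hu: "h (us k) = us k"
      by (rule endpoint_fixed[OF V h Sk(1,3) distinct_k(1) lvk(1) yin(1) hfix(1) yin(2) hfix(2) ord_y(3)
          gyin(1) hfix(3) gyin(2) hfix(4) gne])
    have hv: "h (vs k) = vs k"
      by (rule endpoint_fixed[OF V h Sk(3,1) distinct_k(1)[symmetric] lvs'(3) gyin(1) hfix(3) gyin(2) hfix(4) gne
          yin(1) hfix(1) yin(2) hfix(2) ord_y(3)])
    have "g j (vs k) = us k" "g j (us k) = vs k" using hu hv gk(1)[of k] gk'(1)[of k] unfolding h_def by simp_all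
    then have "g j ` ivl (us k) (vs k) = dual (ivl (us k) (vs k))" "g j ` ivl (us j) (vs j) = dual (ivl (us j) (vs j))"
      using circ_ivl[OF circ] Sk duals(3) gk gk' by simp_all
    then have "ivl (us k) (vs k) = ivl (us j) (vs j) \<or> ivl (us k) (vs k) = ivl (vs j) (us j)"
      using unique_flipped[OF lams(1) circ lvk(1) _ lvk(1)] duals(3) by metis
    then have uv: "us k = us j \<and> vs k = vs j"
      using ivl_inject[OF Sk(1)[of k] Sk(3)[of k] Sk(1)[of j] Sk(3)[of j]]
        ivl_inject[OF Sk(1)[of k] Sk(3)[of k] Sk(3)[of j] Sk(1)[of j]] distinct_k ne by metis
    \<comment> \<open>The ends of the leaf of \<open>L1\<close> are now fixed too. With
      \<open>y\<close> and \<open>g k y\<close> they give two fixed points on each side of the leaf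
      of \<open>L2\<close>.\<close>
    have cr: "us k \<in> ivl (bs k) (as k)" "y \<in> ivl (bs k) (as k)"
      using E(1) Sk xy(2) unfolding E_def ivl_def by blast+
    have cr': "vs k \<in> ivl (as k) (bs k)" "g k y \<in> ivl (as k) (bs k)"
      using circ_mem_ivl[OF circ[of k] Sk(4)[of k] Sk(2)[of k] Sk(1)[of k]]
        circ_mem_ivl[OF circ[of k] Sk(4)[of k] Sk(2)[of k] xy(2)] cr gk[of k] gk'[of k] by simp_all
    have ne2: "us k \<noteq> y" "vs k \<noteq> g k y" 
      using yin(1) gyin(1) endpoints_notin_ivl(1)[OF Sk(1)[of k] Sk(3)[of k]]
        endpoints_notin_ivl(1)[OF Sk(3)[of k] Sk(1)[of k]] by metis+
    have ha: "h (as k) = as k"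
      by (rule endpoint_fixed[OF R.V h(2,1) Sk(2,4) distinct_k(2) lvk(2) cr'(1) hv cr'(2) hfix(3) ne2(2)
          cr(1) hu cr(2) hfix(1) ne2(1)])
    have hb: "h (bs k) = bs k"
      by (rule endpoint_fixed[OF R.V h(2,1) Sk(4,2) distinct_k(2)[symmetric] lvs'(4) cr(1) hu cr(2) hfix(1) ne2(1)
          cr'(1) hv cr'(2) hfix(3) ne2(2)])
    have "g j (bs k) = as k" "g j (as k) = bs k" using ha hb gk(2)[of k] gk'(2)[of k] unfolding h_def by simp_all
    then have "g j ` ivl (as k) (bs k) = dual (ivl (as k) (bs k))" "g j ` ivl (as j) (bs j) = dual (ivl (as j) (bs j))"
      using circ_ivl[OF circ] Sk duals(4) gk gk' by simp_all
    then have "ivl (as k) (bs k) = ivl (as j) (bs j) \<or> ivl (as k) (bs k) = ivl (bs j) (as j)"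
      using unique_flipped[OF lams(2) circ lvk(2) _ lvk(2)] duals(4) by metis
    then have "as k = as j \<and> bs k = bs j"
      using ivl_inject[OF Sk(2)[of k] Sk(4)[of k] Sk(2)[of j] Sk(4)[of j]]
        ivl_inject[OF Sk(2)[of k] Sk(4)[of k] Sk(4)[of j] Sk(2)[of j]] distinct_k ne by metis
    then show ?thesis using uv by blast
  qed
  show ?thesis
    using evE
  proof eventually_elim
    case (elim k)
    note gkS = gS[OF xy(2), of k] gS[OF cd(1), of k]
    have k: "ccw (\<gamma> y) (g k c) u" "ccw (g k y) (\<gamma> c) u" "v \<noteq> us k" "b \<noteq> as k" using elim unfolding E_def by metis+
    have "\<forall>\<^sub>F j in F. E j \<and> (ccw (g j y) (g k c) u \<and> ccw (g k y) (g j c) u) \<and> vs j \<noteq> us k \<and> bs j \<noteq> as k"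
      by (intro eventually_conj evE
        eventually_ccw[OF gam(2)[OF xy(2)] tendsto_const tendsto_const GS(2) gkS(2) S(1) k(1)]
        eventually_ccw[OF tendsto_const gam(2)[OF cd(1)] tendsto_const gkS(1) GS(3) S(1) k(2)]
        tendsto_imp_eventually_ne[OF lim(3) k(3)] tendsto_imp_eventually_ne[OF lim(4) k(4)])
    then show ?case by eventually_elim (use main[OF elim] in blast)
  qed
qed

text \<open>Each lamination has a good end in one of two opposite directions, and the four
  combinations are the four rotations. A value equal to all later ones equals the limit.\<close>

lemma eventually_equal:
  "\<forall>\<^sub>F k in F. us k = u \<and> vs k = v \<and> as k = a \<and> bs k = b"
proof -
  interpret R1: flipped_stitches L2 L1 a v b u F g \<gamma> as vs bs us by (rule rotate)
  interpret R2: flipped_stitches L1 L2 v b u a F g \<gamma> vs bs us as by (rule R1.rotate)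
  interpret R3: flipped_stitches L2 L1 b u a v F g \<gamma> bs us as vs by (rule R2.rotate)
  have "\<forall>\<^sub>F k in F. \<forall>\<^sub>F j in F. us k = us j \<and> vs k = vs j \<and> as k = as j \<and> bs k = bs j"
    using good_end_cases R1.good_end_cases stitches_equal R1.stitches_equal R2.stitches_equal R3.stitches_equal
    by (auto elim!: eventually_mono)
  then show ?thesis
  proof eventually_elim
    case (elim k)
    have eq: "c = l" if "(f \<longlongrightarrow> l) F" "\<forall>\<^sub>F j in F. c = f j" for f and c l :: complex
      using that tendsto_eventually[of f c F] tendsto_unique[OF F that(1)] by (metis (mono_tags, lifting) eventually_mono)
    show ?case
      by (intro conjI eq[OF lim(1)] eq[OF lim(2)] eq[OF lim(3)] eq[OF lim(4)] eventually_mono[OF elim]) blast+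
  qed
qed

end

section \<open>Pointwise limits of circle maps along a filter\<close>

lemma compact_S1_functions: "compact {f :: complex \<Rightarrow> complex. \<forall>x. f x \<in> S1}"
proof -
  have "compactin (product_topology (\<lambda>i::complex. euclidean) UNIV) (PiE UNIV (\<lambda>i. S1 :: complex set))"
    unfolding compactin_PiE by simp
  then have "compact (PiE UNIV (\<lambda>i::complex. S1 :: complex set))"
    unfolding euclidean_product_topology by simp
  moreover have "PiE UNIV (\<lambda>i::complex. S1 :: complex set) = {f. \<forall>x. f x \<in> S1}"
    by (auto simp: PiE_iff simp del: mem_sphere_0)
  ultimately show ?thesis by simp
qed

lemma pointwise_limit_filter:
  fixes g :: "nat \<Rightarrow> complex \<Rightarrow> complex"
  assumes g: "\<And>k x. x \<in> S1 \<Longrightarrow> g k x \<in> S1"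
  obtains F \<gamma> where "F \<noteq> bot" "F \<le> sequentially" "\<And>x. x \<in> S1 \<Longrightarrow> \<gamma> x \<in> S1"
    "\<And>x. x \<in> S1 \<Longrightarrow> ((\<lambda>k. g k x) \<longlongrightarrow> \<gamma> x) F"
proof -
  \<comment> \<open>The value 1 outside the circle keeps all coordinates in the circle, so that
    \<open>f k\<close> lies in the compact product.\<close>
  define f where "f k = (\<lambda>x. if x \<in> S1 then g k x else 1)" for k
  have fS: "f k \<in> {f. \<forall>x. f x \<in> S1}" for k using g unfolding f_def by auto
  have ne: "filtermap f sequentially \<noteq> bot" by (simp add: filtermap_bot_iff)
  have "eventually (\<lambda>h. h \<in> {f. \<forall>x. f x \<in> S1}) (filtermap f sequentially)"
    unfolding eventually_filtermap using fS by (intro always_eventually allI)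
  then obtain \<gamma> where gam: "\<gamma> \<in> {f. \<forall>x. f x \<in> S1}" "inf (nhds \<gamma>) (filtermap f sequentially) \<noteq> bot"
    using compact_S1_functions[unfolded compact_filter] ne by blast
  \<comment> \<open>A cluster point of the sequence need not be the limit of a subsequence in an
    uncountable product; pulling back its neighbourhoods gives a finer filter along which the maps
    do converge.\<close>
  define F where "F = inf sequentially (filtercomap f (nhds \<gamma>))"
  have "F \<noteq> bot"
  proof
    assume "F = bot"
    then have "eventually (\<lambda>k. False) F" by simp
    then obtain P Q where PQ: "eventually P sequentially" "eventually Q (filtercomap f (nhds \<gamma>))"
      "\<And>k. P k \<Longrightarrow> Q k \<Longrightarrow> False" unfolding F_def eventually_inf by blast
    obtain R where R: "eventually R (nhds \<gamma>)" "\<And>k. R (f k) \<Longrightarrow> Q k"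
      using PQ(2) unfolding eventually_filtercomap by blast
    have "eventually (\<lambda>k. \<not> R (f k)) sequentially"
      using PQ(1) by (rule eventually_mono) (use PQ(3) R(2) in blast)
    then have "eventually (\<lambda>h. \<not> R h) (filtermap f sequentially)" unfolding eventually_filtermap .
    then have "eventually (\<lambda>h. False) (inf (nhds \<gamma>) (filtermap f sequentially))"
      using R(1) unfolding eventually_inf by blast
    then show False using gam(2) by (simp add: eventually_False)
  qed
  moreover have "F \<le> sequentially" unfolding F_def by simp
  moreover have "\<gamma> x \<in> S1" for x using gam(1) by blast
  moreover have "((\<lambda>k. g k x) \<longlongrightarrow> \<gamma> x) F" if x: "x \<in> S1" for x
  proof -
    have "(f \<longlongrightarrow> \<gamma>) F" unfolding filterlim_iff_le_filtercomap F_def by simp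
    then have "((\<lambda>k. f k x) \<longlongrightarrow> \<gamma> x) F"
      by (rule continuous_on_tendsto_compose[OF continuous_on_product_coordinates]) simp_all
    moreover have "f k x = g k x" for k unfolding f_def using x by simp
    ultimately show ?thesis by simp
  qed
  ultimately show thesis by (intro that[of F \<gamma>])
qed

subsection \<open>Stitches flipped by an involution\<close>

text \<open>What the geometry retains of an elliptic element of order 2;
  \<open>elliptic_flip\<close> supplies the absence of fixed points.\<close>

definition flip :: "complex set set \<Rightarrow> complex set set \<Rightarrow> (complex \<Rightarrow> complex) \<Rightarrow> bool" where
  "flip L1 L2 g \<longleftrightarrow> lam_aut L1 g \<and> lam_aut L2 g \<and> (\<forall>x\<in>S1. g (g x) = x) \<and> (\<forall>x\<in>S1. g x \<noteq> x)"

lemma flip_sym: "flip L1 L2 g \<Longrightarrow> flip L2 L1 g"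
  unfolding flip_def by blast

lemma stitches_sym: "(l, m) \<in> stitches L1 L2 \<Longrightarrow> (m, l) \<in> stitches L2 L1"
  unfolding stitches_def interleave_def by blast

text \<open>Cut open at \<open>p\<close>, the map is an increasing involution of a line: a point
  moved forwards would be moved forwards again and never return.\<close>

lemma involution_fixed_point:
  assumes g: "circ g" "\<And>x. x \<in> S1 \<Longrightarrow> g (g x) = x" and p: "p \<in> S1" "g p = p" and x: "x \<in> S1"
  shows "g x = x"
proof (rule ccontr)
  assume ne: "g x \<noteq> x"
  note gx = circ_S1[OF g(1) x]
  have "p \<noteq> x" "p \<noteq> g x" using ne p g(2)[OF x] by auto
  then consider "ccw p x (g x)" | "ccw p (g x) x" using not_ccw_iff[OF p(1) x gx] ne by metis
  then show False
  proof cases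
    case 1
    then have "ccw p (g x) x" using circ_ccw[OF g(1) p(1) x gx] p(2) g(2)[OF x] by simp
    then show False using 1 ccw_total[OF p(1) x gx] ccw_distinct[OF p(1) x gx] by blast
  next
    case 2
    then have "ccw p x (g x)" using circ_ccw[OF g(1) p(1) gx x] p(2) g(2)[OF x] by simp
    then show False using 2 ccw_total[OF p(1) x gx] ccw_distinct[OF p(1) x gx] by blast
  qed
qed

lemma flip_swaps:
  assumes g: "flip L1 L2 g" and uv: "u \<in> S1" "v \<in> S1" "u \<noteq> v"
    and l: "(`) g ` leaf (ivl u v) = leaf (ivl u v)"
  shows "g u = v" "g v = u"
proof -
  have c: "circ g" using g aut_circ unfolding flip_def by blast
  have "g ` ivl u v \<in> (`) g ` leaf (ivl u v)" unfolding leaf_def by blast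
  then have "g ` ivl u v \<in> leaf (ivl u v)" using l by simp
  then have "ivl (g u) (g v) = ivl u v \<or> ivl (g u) (g v) = ivl v u"
    using circ_ivl[OF c uv(1,2)] dual_ivl[OF uv] unfolding leaf_def by simp
  moreover have "g u \<noteq> u" using g uv unfolding flip_def by blast
  moreover have "g u \<in> S1" "g v \<in> S1" "g u \<noteq> g v" using circ_S1[OF c] circ_eq_iff[OF c] uv by simp_all
  ultimately show "g u = v" "g v = u" using ivl_inject uv by metis+
qed

lemma stitch_crossing:
  assumes L2: "lamination_system L2" and s: "(leaf (ivl u v), m) \<in> stitches L1 L2"
    and uv: "u \<in> S1" "v \<in> S1" "u \<noteq> v"
  obtains a b where "m = leaf (ivl a b)" "ivl a b \<in> L2" "a \<in> ivl u v" "b \<in> ivl v u"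
proof -
  obtain J where J: "J \<in> L2" "m = leaf J" using s unfolding stitches_def leaves_def by blast
  obtain p q where pq: "p \<in> S1" "q \<in> S1" "p \<noteq> q" "J = ivl p q" "dual J = ivl q p"
    using good_cases[OF lam_good[OF L2 J(1)]] by metis
  have vert: "vertices m = {p, q}" using vertices_leaf_ivl pq J by simp
  have "is_singleton (ivl u v \<inter> {p, q})" "is_singleton (ivl v u \<inter> {p, q})"
    using s dual_ivl[OF uv] unfolding stitches_def interleave_def leaf_def by (auto simp: vert)
  then obtain c d where cd: "ivl u v \<inter> {p, q} = {c}" "ivl v u \<inter> {p, q} = {d}"
    unfolding is_singleton_def by blast
  have "p \<in> ivl u v \<and> q \<in> ivl v u \<or> q \<in> ivl u v \<and> p \<in> ivl v u"
  proof -
    have "c \<in> ivl u v \<inter> {p, q}" "d \<in> ivl v u \<inter> {p, q}" unfolding cd by simp_all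
    then show ?thesis using disjoint_ivl_swap[OF uv(1,2)] by blast
  qed
  moreover have "m = leaf (ivl p q)" "m = leaf (ivl q p)" "ivl p q \<in> L2" "ivl q p \<in> L2"
    using J pq leaf_dual[OF lam_good[OF L2 J(1)]] lam_dual[OF L2 J(1)] by auto
  ultimately show thesis using that by blast
qed

lemma leaf_gap:
  assumes L: "lamination_system L" and I: "I \<in> L"
  shows "gap L (leaf I)"
proof -
  have "\<exists>J\<in>leaf I. lies_on l J" if l: "l \<in> leaves L" for l
  proof -
    obtain K where "K \<in> L" "l = leaf K" using l unfolding leaves_def by blast
    then show ?thesis using L I unfolding lamination_system_def leaf_def[of I] by blast
  qed
  moreover have "pairwise disjnt (leaf I)"
    using dual_disjoint[OF lam_good[OF L I]] unfolding leaf_def pairwise_def disjnt_def by blast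
  ultimately show ?thesis unfolding gap_def using I lam_dual[OF L I] unfolding leaf_def by blast
qed

lemma flipped_real:
  assumes L: "lamination_system L" "loose L" and g: "flip L L' g" and l: "l \<in> leaves L" "(`) g ` l = l"
  shows "real_gap L l"
proof -
  obtain I where I: "I \<in> L" "l = leaf I" using l unfolding leaves_def by blast
  have ga: "lam_aut L g" using g unfolding flip_def by blast
  obtain u v where uv: "u \<in> S1" "v \<in> S1" "u \<noteq> v" "I = ivl u v" "dual I = ivl v u"
    using good_cases[OF lam_good[OF L(1) I(1)]] by metis
  have "g u = v" "g v = u" using flip_swaps[OF g uv(1-3)] l I uv by simp_all
  then have "g ` I = dual I" "g ` dual I = dual (dual I)"
    using circ_ivl[OF aut_circ[OF ga]] uv dual_dual[OF lam_good[OF L(1) I(1)]] by simp_all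
  then have "\<not> isolated L I" "\<not> isolated L (dual I)"
    using flipped_not_isolated[OF L ga] I lam_dual[OF L(1) I(1)] by blast+
  then show ?thesis using leaf_gap[OF L(1) I(1)] I(2) unfolding real_gap_def leaf_def by blast
qed

lemma flipped_crossing_unique:
  assumes V: "veering_pair L1 L2"
    and s: "(l, m) \<in> stitches L1 L2" "flip L1 L2 g" "stitch_act g (l, m) = (l, m)"
    and t: "(l, n) \<in> stitches L1 L2" "flip L1 L2 k" "stitch_act k (l, n) = (l, n)"
  shows "m = n"
proof -
  note L1 = veering_lam(1)[OF V] and L2 = veering_lam(2)[OF V]
  have "l \<in> leaves L1" using s unfolding stitches_def by blast
  then obtain I where I: "I \<in> L1" "l = leaf I" unfolding leaves_def by blast
  obtain u v where uv: "u \<in> S1" "v \<in> S1" "u \<noteq> v" "I = ivl u v"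
    using good_cases[OF lam_good[OF L1 I(1)]] by metis
  have loose: "loose L1" using V unfolding veering_pair_def by blast
  have fx: "(`) g ` l = l" "(`) g ` m = m" "(`) k ` l = l" "(`) k ` n = n"
    using s t unfolding stitch_act_def by simp_all
  have "real_gap L1 l" by (rule flipped_real[OF L1 loose s(2) \<open>l \<in> leaves L1\<close> fx(1)])
  then have ni: "\<not> isolated L1 (ivl u v)" using I uv unfolding real_gap_def leaf_def by blast
  obtain a b where ab: "m = leaf (ivl a b)" "ivl a b \<in> L2" "a \<in> ivl u v" "b \<in> ivl v u"
    using stitch_crossing[OF L2 _ uv(1-3)] s(1) I uv(4) by metis
  obtain c d where cd: "n = leaf (ivl c d)" "ivl c d \<in> L2" "c \<in> ivl u v" "d \<in> ivl v u"
    using stitch_crossing[OF L2 _ uv(1-3)] t(1) I uv(4) by metis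
  have S: "a \<in> S1" "b \<in> S1" "c \<in> S1" "d \<in> S1" using ab cd ivl_subset_S1 by blast+
  have ne: "a \<noteq> b" "c \<noteq> d" using ab cd disjoint_ivl_swap[OF uv(1,2)] by blast+
  have sw: "g u = v" "k u = v" "g a = b" "k c = d"
    using flip_swaps(1)[OF s(2) uv(1-3)] flip_swaps(1)[OF t(2) uv(1-3)]
      flip_swaps(1)[OF s(2) S(1,2) ne(1)] flip_swaps(1)[OF t(2) S(3,4) ne(2)]
      fx I uv(4) ab(1) cd(1) by simp_all
  have "a = c \<and> b = d"
    using flipped_leaf_unique[OF V _ _ _ _ _ _ uv(1,2) _ ni sw(1,2) ab(2-4) sw(3) cd(2-4) sw(4)]
      s(2) t(2) I uv(4) unfolding flip_def by blast
  then show ?thesis using ab cd by simp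
qed

subsection \<open>The topology of the stitch space\<close>

definition pairs_near :: "complex \<Rightarrow> complex \<Rightarrow> real \<Rightarrow> complex set set" where
  "pairs_near u v e = {{x, y} | x y. x \<in> S1 \<and> y \<in> S1 \<and> x \<noteq> y \<and> dist x u < e \<and> dist y v < e}"

lemma doubleton_near_iff:
  "{x, y} \<in> pairs_near u v e \<longleftrightarrow> x \<in> S1 \<and> y \<in> S1 \<and> x \<noteq> y \<and>
     (dist x u < e \<and> dist y v < e \<or> dist y u < e \<and> dist x v < e)"
  unfolding pairs_near_def mem_Collect_eq doubleton_eq_iff by blast

text \<open>A two-point set comes from two ordered pairs, so the preimage consists of two products
  of balls, one for each order.\<close>

lemma openin_pairs_near: "openin two_point_space (pairs_near u v e)"
  unfolding openin_two_point_space
proof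
  show "pairs_near u v e \<subseteq> (\<lambda>(x, y). {x, y}) ` ordered_pairs" unfolding pairs_near_def by blast
  have *: "(x, y) \<in> ordered_pairs \<and> {x, y} \<in> pairs_near u v e \<longleftrightarrow>
      (x, y) \<in> ordered_pairs \<inter> (ball u e \<times> ball v e \<union> ball v e \<times> ball u e)" for x y
    unfolding doubleton_near_iff by (auto simp: dist_commute)
  have "{p \<in> ordered_pairs. (case p of (x, y) \<Rightarrow> {x, y}) \<in> pairs_near u v e} =
      ordered_pairs \<inter> (ball u e \<times> ball v e \<union> ball v e \<times> ball u e)"
  proof (rule Set.set_eqI)
    fix p :: "complex \<times> complex"
    obtain x y where "p = (x, y)" by (cases p)
    then show "p \<in> {p \<in> ordered_pairs. (case p of (x, y) \<Rightarrow> {x, y}) \<in> pairs_near u v e} \<longleftrightarrow>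
        p \<in> ordered_pairs \<inter> (ball u e \<times> ball v e \<union> ball v e \<times> ball u e)"
      using *[of x y] by (simp only: mem_Collect_eq[of "(x, y)"] prod.case)
  qed
  then show "openin (top_of_set ordered_pairs) {p \<in> ordered_pairs. (case p of (x, y) \<Rightarrow> {x, y}) \<in> pairs_near u v e}"
    by (simp add: openin_open_Int open_Times open_Un)
qed

definition stitches_near :: "complex set set \<Rightarrow> complex set set \<Rightarrow> complex \<Rightarrow> complex \<Rightarrow> complex \<Rightarrow> complex \<Rightarrow> real \<Rightarrow> stitch set" where
  "stitches_near L1 L2 u v a b e =
     {s \<in> stitches L1 L2. vertices (fst s) \<in> pairs_near u v e \<and> vertices (snd s) \<in> pairs_near a b e}"

lemma openin_stitches_near: "openin (stitch_space L1 L2) (stitches_near L1 L2 u v a b e)"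
proof -
  have o: "openin (leaf_space L) (vertices -` pairs_near x y e \<inter> leaves L)" for L x y
    unfolding leaf_space_def openin_pullback_topology using openin_pairs_near by blast
  have "openin (prod_topology (leaf_space L1) (leaf_space L2))
     ((vertices -` pairs_near u v e \<inter> leaves L1) \<times> (vertices -` pairs_near a b e \<inter> leaves L2))"
    using o by (simp add: openin_prod_Times_iff)
  then have "openin (stitch_space L1 L2) (((vertices -` pairs_near u v e \<inter> leaves L1) \<times>
      (vertices -` pairs_near a b e \<inter> leaves L2)) \<inter> stitches L1 L2)"
    unfolding stitch_space_def by (rule openin_subtopology_Int)
  moreover have "((vertices -` pairs_near u v e \<inter> leaves L1) \<times>
      (vertices -` pairs_near a b e \<inter> leaves L2)) \<inter> stitches L1 L2 = stitches_near L1 L2 u v a b e"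
    unfolding stitches_near_def stitches_def by auto
  ultimately show ?thesis by simp
qed

lemma leaf_of_vertices:
  assumes L: "lamination_system L" and l: "l \<in> leaves L" and v: "vertices l = {x, y}"
  shows "l = leaf (ivl x y)" "ivl x y \<in> L" "x \<in> S1" "y \<in> S1" "x \<noteq> y"
proof -
  obtain I where I: "I \<in> L" "l = leaf I" using l unfolding leaves_def by blast
  obtain p q where pq: "p \<in> S1" "q \<in> S1" "p \<noteq> q" "I = ivl p q" "dual I = ivl q p"
    using good_cases[OF lam_good[OF L I(1)]] by metis
  have "{p, q} = {x, y}" using v I pq vertices_leaf_ivl by simp
  then have "p = x \<and> q = y \<or> p = y \<and> q = x" by (simp add: doubleton_eq_iff)
  then show "l = leaf (ivl x y)" "ivl x y \<in> L" "x \<in> S1" "y \<in> S1" "x \<noteq> y"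
    using I pq leaf_dual[OF lam_good[OF L I(1)]] lam_dual[OF L I(1)] by auto
qed

text \<open>The stitch \<open>s\<close> is not assumed to be in \<open>M\<close>: for
  \<open>s\<close> in \<open>M\<close> this gives discreteness, for \<open>s\<close> outside it
  gives closedness.\<close>

lemma flipped_stitches_isolated:
  assumes V: "veering_pair L1 L2" and s: "s \<in> stitches L1 L2"
    and M: "\<And>t. t \<in> M \<Longrightarrow> t \<in> stitches L1 L2 \<and> (\<exists>g. flip L1 L2 g \<and> stitch_act g t = t)"
  shows "\<exists>U. openin (stitch_space L1 L2) U \<and> s \<in> U \<and> U \<inter> M \<subseteq> {s}"
proof (rule ccontr)
  assume neg: "\<not> ?thesis"
  note L1 = veering_lam(1)[OF V] and L2 = veering_lam(2)[OF V]
  obtain l m where lm: "s = (l, m)" "l \<in> leaves L1" "m \<in> leaves L2" using s unfolding stitches_def by blast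
  then obtain I where I: "I \<in> L1" "l = leaf I" unfolding leaves_def by blast
  obtain u v where uv: "u \<in> S1" "v \<in> S1" "u \<noteq> v" "I = ivl u v"
    using good_cases[OF lam_good[OF L1 I(1)]] by metis
  obtain a b where ab: "m = leaf (ivl a b)" "ivl a b \<in> L2" "a \<in> ivl u v" "b \<in> ivl v u"
    using stitch_crossing[OF L2 _ uv(1-3)] s lm I uv(4) by metis
  have abS: "a \<in> S1" "b \<in> S1" using ab ivl_subset_S1 by blast+
  have abne: "a \<noteq> b" using ab disjoint_ivl_swap[OF uv(1,2)] by blast
  have vert: "vertices l = {u, v}" "vertices m = {a, b}"
    using vertices_leaf_ivl uv I ab abS abne by simp_all
  have near: "s \<in> stitches_near L1 L2 u v a b e" if e: "e > 0" for e
    using e s uv abS abne unfolding stitches_near_def lm(1) by (simp add: vert doubleton_near_iff)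
  \<comment> \<open>Failure on the neighbourhood of radius \<open>1 / (k + 1)\<close> yields a
    flipped stitch other than \<open>s\<close>, with ends named after the nearby ends of
    \<open>s\<close>.\<close>
  have "\<exists>t g x y c d. t \<in> stitches L1 L2 \<and> t \<noteq> s \<and> flip L1 L2 g \<and> stitch_act g t = t \<and>
      vertices (fst t) = {x, y} \<and> vertices (snd t) = {c, d} \<and>
      dist x u < inverse (real (Suc k)) \<and> dist y v < inverse (real (Suc k)) \<and>
      dist c a < inverse (real (Suc k)) \<and> dist d b < inverse (real (Suc k))" for k
  proof -
    let ?N = "stitches_near L1 L2 u v a b (inverse (real (Suc k)))"
    have "\<not> ?N \<inter> M \<subseteq> {s}" using neg openin_stitches_near near[of "inverse (real (Suc k))"] by auto
    then obtain t where t: "t \<in> ?N" "t \<in> M" "t \<noteq> s" by blast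
    obtain g where "flip L1 L2 g" "stitch_act g t = t" using M[OF t(2)] by blast
    moreover have "t \<in> stitches L1 L2" using M[OF t(2)] by blast
    ultimately show ?thesis using t unfolding stitches_near_def pairs_near_def by blast
  qed
  then obtain t g us vs as bs where t: "\<And>k. t k \<in> stitches L1 L2" "\<And>k. t k \<noteq> s"
    and g: "\<And>k. flip L1 L2 (g k)" "\<And>k. stitch_act (g k) (t k) = t k"
    and vt: "\<And>k. vertices (fst (t k)) = {us k, vs k}" "\<And>k. vertices (snd (t k)) = {as k, bs k}"
    and dist: "\<And>k. dist (us k) u < inverse (real (Suc k))" "\<And>k. dist (vs k) v < inverse (real (Suc k))"
      "\<And>k. dist (as k) a < inverse (real (Suc k))" "\<And>k. dist (bs k) b < inverse (real (Suc k))"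
    by metis
  have tl: "fst (t k) \<in> leaves L1" "snd (t k) \<in> leaves L2" for k
    using t(1)[of k] unfolding stitches_def by auto
  note fl = leaf_of_vertices[OF L1 tl(1) vt(1)] and sl = leaf_of_vertices[OF L2 tl(2) vt(2)]
  have act: "(`) (g k) ` fst (t k) = fst (t k)" "(`) (g k) ` snd (t k) = snd (t k)" for k
    using g(2)[of k] unfolding stitch_act_def by (cases "t k"; simp)+
  have sw: "g k (us k) = vs k" "g k (as k) = bs k" for k
    using flip_swaps(1)[OF g(1) fl(3-5)[of k]] flip_swaps(1)[OF g(1) sl(3-5)[of k]]
      act[of k] fl(1)[of k] sl(1)[of k] by metis+
  have gS: "x \<in> S1 \<Longrightarrow> g k x \<in> S1" for k x using g(1)[of k] circ_S1 aut_circ unfolding flip_def by blast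
  obtain F \<gamma> where F: "F \<noteq> bot" "F \<le> sequentially" "\<And>x. x \<in> S1 \<Longrightarrow> \<gamma> x \<in> S1"
    "\<And>x. x \<in> S1 \<Longrightarrow> ((\<lambda>k. g k x) \<longlongrightarrow> \<gamma> x) F"
    using pointwise_limit_filter[of g] gS by blast
  have conv: "(f \<longlongrightarrow> p) F" if "\<And>k. dist (f k) p < inverse (real (Suc k))" for f and p :: complex
  proof -
    have "(\<lambda>k. dist (f k) p) \<longlonglongrightarrow> 0"
      by (rule real_tendsto_sandwich[OF _ _ tendsto_const LIMSEQ_inverse_real_of_nat])
        (use that in \<open>auto intro!: always_eventually less_imp_le\<close>)
    then have "f \<longlonglongrightarrow> p" using tendsto_dist_iff by blast
    then show ?thesis using F(2) filterlim_mono by blast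
  qed
  interpret flipped_stitches L1 L2 u a v b F g \<gamma> us as vs bs
    by unfold_locales
      (use V F uv I ab abS g fl sl sw dist in \<open>auto simp: flip_def intro!: conv simp del: mem_sphere_0\<close>)
  obtain k where k: "us k = u" "vs k = v" "as k = a" "bs k = b"
    using eventually_happens'[OF F(1) eventually_equal] by blast
  have "t k = (leaf (ivl u v), leaf (ivl a b))" using fl(1)[of k] sl(1)[of k] k by (metis prod.collapse)
  then show False using t(2)[of k] lm(1) I uv(4) ab(1) by simp
qed

subsection \<open>The group of automorphisms\<close>

lemma veering_Aut_carrier:
  assumes "g \<in> carrier (veering_Aut L1 L2)"
  shows "lam_aut L1 g" "lam_aut L2 g" "g \<in> extensional S1" "g \<in> Bij S1"
proof -
  obtain h where h: "homeomorphism S1 S1 g h" and g: "g \<in> extensional S1" "orientation_preserving g"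
    "(`) g ` L1 = L1" "(`) g ` L2 = L2"
    using assms unfolding veering_Aut_def by auto
  have b: "bij_betw g S1 S1"
    using h unfolding homeomorphism_def by (intro bij_betw_byWitness[where f' = h]) auto
  show "lam_aut L1 g" "lam_aut L2 g" "g \<in> extensional S1" "g \<in> Bij S1"
    using b g unfolding lam_aut_def circ_def Bij_def by simp_all
qed

lemma veering_Aut_mult:
  assumes "g \<in> carrier (veering_Aut L1 L2)" "h \<in> carrier (veering_Aut L1 L2)"
  shows "g \<otimes>\<^bsub>veering_Aut L1 L2\<^esub> h = compose S1 g h"
  using veering_Aut_carrier(4)[OF assms(1)] veering_Aut_carrier(4)[OF assms(2)]
  by (simp add: veering_Aut_def BijGroup_def)

lemma veering_Aut_one: "\<one>\<^bsub>veering_Aut L1 L2\<^esub> = (\<lambda>x\<in>S1. x)"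
  by (simp add: veering_Aut_def BijGroup_def)

lemma elliptic_flip:
  assumes V: "veering_pair L1 L2" and g: "elliptic L1 L2 g" "group.ord (veering_Aut L1 L2) g = 2"
  shows "flip L1 L2 g"
proof -
  interpret group "veering_Aut L1 L2" by (rule group_veering_Aut) (use veering_lam[OF V] in auto)
  have gc: "g \<in> carrier (veering_Aut L1 L2)" and ne: "g \<noteq> \<one>\<^bsub>veering_Aut L1 L2\<^esub>"
    using g unfolding elliptic_def by blast+
  have "g [^]\<^bsub>veering_Aut L1 L2\<^esub> (2::nat) = \<one>\<^bsub>veering_Aut L1 L2\<^esub>"
    using pow_ord_eq_1[OF gc] g(2) by simp
  then have "g \<otimes>\<^bsub>veering_Aut L1 L2\<^esub> g = \<one>\<^bsub>veering_Aut L1 L2\<^esub>"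
    using gc by (simp add: numeral_2_eq_2)
  then have "compose S1 g g = (\<lambda>x\<in>S1. x)" unfolding veering_Aut_mult[OF gc gc] veering_Aut_one .
  then have inv: "g (g x) = x" if "x \<in> S1" for x using that by (metis compose_eq restrict_apply')
  have nofix: "g x \<noteq> x" if x: "x \<in> S1" for x
  proof
    assume "g x = x"
    then have "g y = y" if "y \<in> S1" for y
      using involution_fixed_point[OF aut_circ[OF veering_Aut_carrier(1)[OF gc]] inv x _ that] by blast
    then have "g = (\<lambda>x\<in>S1. x)" using veering_Aut_carrier(3)[OF gc] by (intro extensionalityI) auto
    then show False using ne veering_Aut_one by metis
  qed
  show ?thesis using veering_Aut_carrier(1,2)[OF gc] inv nofix unfolding flip_def by blast
qed

lemma stitch_subset_S1:
  assumes "lamination_system L1" "lamination_system L2" "s \<in> stitches L1 L2" "I \<in> fst s \<or> I \<in> snd s"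
  shows "I \<subseteq> S1"
proof -
  obtain A B where "s = (leaf A, leaf B)" "A \<in> L1" "B \<in> L2"
    using assms(3) unfolding stitches_def leaves_def by blast
  then obtain J where "J \<in> L1 \<or> J \<in> L2" "I = J \<or> I = dual J"
    using assms(4) unfolding leaf_def by auto
  then show ?thesis using lam_good assms(1,2) good_dual good_subset_S1 by metis
qed

text \<open>The group product is composition restricted to the circle, so it acts as plain
  composition only because members of leaves are subsets of the circle.\<close>

lemma stitch_act_compose:
  assumes L: "lamination_system L1" "lamination_system L2" and s: "s \<in> stitches L1 L2"
    and g: "g \<in> carrier (veering_Aut L1 L2)" "h \<in> carrier (veering_Aut L1 L2)"
  shows "stitch_act (g \<otimes>\<^bsub>veering_Aut L1 L2\<^esub> h) s = stitch_act g (stitch_act h s)"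
proof -
  have *: "compose S1 g h ` I = g ` h ` I" if "I \<subseteq> S1" for I
  proof -
    have "compose S1 g h ` I = (\<lambda>x. g (h x)) ` I" using that by (intro image_cong) (auto simp: compose_def)
    then show ?thesis by (simp add: image_image)
  qed
  have act: "(`) (compose S1 g h) ` l = (`) g ` (`) h ` l" if "\<And>I. I \<in> l \<Longrightarrow> I \<subseteq> S1" for l
  proof -
    have "(`) (compose S1 g h) ` l = (\<lambda>I. g ` h ` I) ` l" by (rule image_cong[OF refl]) (rule *[OF that])
    then show ?thesis by (simp add: image_image)
  qed
  note sub = stitch_subset_S1[OF L s]
  have "(`) (compose S1 g h) ` fst s = (`) g ` (`) h ` fst s" by (rule act, rule sub, rule disjI1)
  moreover have "(`) (compose S1 g h) ` snd s = (`) g ` (`) h ` snd s" by (rule act, rule sub, rule disjI2)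
  ultimately show ?thesis unfolding veering_Aut_mult[OF g] stitch_act_def by (cases s) simp
qed

lemma stitch_act_one:
  assumes L: "lamination_system L1" "lamination_system L2" and s: "s \<in> stitches L1 L2"
  shows "stitch_act \<one>\<^bsub>veering_Aut L1 L2\<^esub> s = s"
proof -
  have *: "(\<lambda>x\<in>S1. x) ` I = I" if "I \<subseteq> S1" for I
  proof -
    have "(\<lambda>x\<in>S1. x) ` I = (\<lambda>x. x) ` I" using that by (intro image_cong) auto
    then show ?thesis by simp
  qed
  have act: "(`) (\<lambda>x\<in>S1. x) ` l = l" if "\<And>I. I \<in> l \<Longrightarrow> I \<subseteq> S1" for l
  proof -
    have "(`) (\<lambda>x\<in>S1. x) ` l = (\<lambda>I. I) ` l" by (rule image_cong[OF refl]) (rule *[OF that])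
    then show ?thesis by simp
  qed
  note sub = stitch_subset_S1[OF L s]
  have "(`) (\<lambda>x\<in>S1. x) ` fst s = fst s" by (rule act, rule sub, rule disjI1)
  moreover have "(`) (\<lambda>x\<in>S1. x) ` snd s = snd s" by (rule act, rule sub, rule disjI2)
  ultimately show ?thesis unfolding veering_Aut_one stitch_act_def by (cases s) simp
qed

lemma image_leaf:
  assumes "lamination_system L" "lam_aut L g" "l \<in> leaves L"
  shows "(`) g ` l \<in> leaves L"
proof -
  obtain I where I: "I \<in> L" "l = leaf I" using assms(3) unfolding leaves_def by blast
  then have "(`) g ` l = leaf (g ` I)"
    unfolding leaf_def using circ_good(2)[OF aut_circ[OF assms(2)] lam_good[OF assms(1)]] by simp
  then show ?thesis using aut_image[OF assms(2) I(1)] unfolding leaves_def by blast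
qed

lemma interleave_image:
  assumes g: "circ g" and S: "\<And>I. I \<in> A \<Longrightarrow> I \<subseteq> S1" "\<And>I. I \<in> B \<Longrightarrow> I \<subseteq> S1" and i: "interleave A B"
  shows "interleave ((`) g ` A) ((`) g ` B)"
proof -
  have b: "bij_betw g S1 S1" using g unfolding circ_def by blast
  then have inj: "inj_on g S1" and im: "g ` S1 = S1" unfolding bij_betw_def by blast+
  have vert: "vertices ((`) g ` C) = g ` vertices C" if "\<And>I. I \<in> C \<Longrightarrow> I \<subseteq> S1" for C
  proof -
    have "\<Union>C \<subseteq> S1" using that by blast
    then have "g ` (S1 - \<Union>C) = S1 - g ` \<Union>C" using inj_on_image_set_diff[OF inj, of S1 "\<Union>C"] im by simp
    then show ?thesis unfolding vertices_def by (simp add: image_Union)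
  qed
  have "is_singleton (g ` I \<inter> vertices ((`) g ` C))"
    if that: "I \<subseteq> S1" "\<And>I. I \<in> C \<Longrightarrow> I \<subseteq> S1" and sg: "is_singleton (I \<inter> vertices C)" for I C
  proof -
    have "vertices C \<subseteq> S1" unfolding vertices_def by blast
    then have "g ` I \<inter> vertices ((`) g ` C) = g ` (I \<inter> vertices C)"
      using vert[OF that(2)] inj_on_image_Int[OF inj that(1)] by simp
    moreover obtain w where "I \<inter> vertices C = {w}" using sg unfolding is_singleton_def by blast
    ultimately show ?thesis by simp
  qed
  then show ?thesis using i S unfolding interleave_def by blast
qed

lemma stitch_act_stitches:
  assumes L: "lamination_system L1" "lamination_system L2" and s: "s \<in> stitches L1 L2"
    and g: "lam_aut L1 g" "lam_aut L2 g"
  shows "stitch_act g s \<in> stitches L1 L2"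
proof -
  obtain l m where lm: "s = (l, m)" "l \<in> leaves L1" "m \<in> leaves L2" "interleave l m"
    using s unfolding stitches_def by blast
  have "interleave ((`) g ` l) ((`) g ` m)"
    using interleave_image[OF aut_circ[OF g(1)] _ _ lm(4)] stitch_subset_S1[OF L s] lm(1) by simp
  then show ?thesis
    using image_leaf[OF L(1) g(1) lm(2)] image_leaf[OF L(2) g(2) lm(3)] lm(1)
    unfolding stitches_def stitch_act_def by simp
qed

section \<open>Conjugation of involutions and invariance under the group\<close>

lemma (in group) conj_pow:
  assumes "x \<in> carrier G" "y \<in> carrier G"
  shows "(x \<otimes> y \<otimes> inv x) [^] (n::nat) = x \<otimes> y [^] n \<otimes> inv x"
proof (induction n)
  case 0
  then show ?case using assms by simp
next
  case (Suc n)
  have "x \<otimes> y [^] n \<otimes> inv x \<otimes> (x \<otimes> y \<otimes> inv x) = x \<otimes> y [^] n \<otimes> (inv x \<otimes> x) \<otimes> y \<otimes> inv x"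
    using assms by (simp only: m_assoc inv_closed m_closed nat_pow_closed)
  then show ?case using Suc assms by (simp add: m_assoc)
qed

lemma (in group) ord_conj:
  assumes "x \<in> carrier G" "y \<in> carrier G"
  shows "ord (x \<otimes> y \<otimes> inv x) = ord y"
proof -
  have "(x \<otimes> y \<otimes> inv x) [^] n = \<one> \<longleftrightarrow> y [^] n = \<one>" for n :: nat
  proof
    assume "(x \<otimes> y \<otimes> inv x) [^] n = \<one>"
    then have "x \<otimes> y [^] n \<otimes> inv x = \<one>" using conj_pow[OF assms] by simp
    then have "x \<otimes> y [^] n = x" using assms by (metis inv_closed inv_equality inv_inv m_closed nat_pow_closed)
    then show "y [^] n = \<one>" using assms by (metis l_cancel_one' nat_pow_closed)
  qed (use conj_pow[OF assms] assms in simp)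
  then show ?thesis using assms by (subst ord_unique) (simp_all add: pow_eq_id)
qed

text \<open>If \<open>g\<close> fixes \<open>s\<close>, its conjugate by \<open>f\<close> fixes the
  image of \<open>s\<close>, lies in the subgroup and has the same order.\<close>

lemma fixed_stitches_invariant:
  assumes V: "veering_pair L1 L2" and G: "subgroup G (veering_Aut L1 L2)" and f: "f \<in> G"
    and s: "s \<in> fixed_stitches L1 L2 G"
  shows "stitch_act f s \<in> fixed_stitches L1 L2 G"
proof -
  note L = veering_lam[OF V]
  let ?A = "veering_Aut L1 L2"
  interpret A: group ?A by (rule group_veering_Aut) (use L in auto)
  obtain g where sS: "s \<in> stitches L1 L2" and g: "g \<in> G" "elliptic L1 L2 g" "A.ord g = 2" "stitch_act g s = s"
    using s unfolding fixed_stitches_def by blast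
  have c: "f \<in> carrier ?A" "g \<in> carrier ?A" using subgroup.mem_carrier[OF G] f g by blast+
  define h where "h = f \<otimes>\<^bsub>?A\<^esub> g \<otimes>\<^bsub>?A\<^esub> inv\<^bsub>?A\<^esub> f"
  have hG: "h \<in> G" unfolding h_def using G f g by (simp add: subgroup.m_closed subgroup.m_inv_closed)
  have hc: "h \<in> carrier ?A" using subgroup.mem_carrier[OF G hG] .
  have ord: "A.ord h = 2" unfolding h_def using A.ord_conj[OF c] g by simp
  have "h \<noteq> \<one>\<^bsub>?A\<^esub>" using ord A.ord_eq_1[OF hc] by simp
  moreover have "h [^]\<^bsub>?A\<^esub> (2::nat) = \<one>\<^bsub>?A\<^esub>" using A.pow_ord_eq_1[OF hc] ord by simp
  ultimately have ell: "elliptic L1 L2 h" unfolding elliptic_def using hc by (intro conjI exI[of _ 2]) simp_all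
  have fs: "stitch_act f s \<in> stitches L1 L2"
    using stitch_act_stitches[OF L sS] veering_Aut_carrier[OF c(1)] by blast
  have "h \<otimes>\<^bsub>?A\<^esub> f = f \<otimes>\<^bsub>?A\<^esub> g" unfolding h_def using c by (simp add: A.m_assoc)
  then have "stitch_act h (stitch_act f s) = stitch_act f (stitch_act g s)"
    using stitch_act_compose[OF L sS hc c(1)] stitch_act_compose[OF L sS c] by simp
  then show ?thesis using fs hG ell ord g(4) unfolding fixed_stitches_def by auto
qed

theorem corollary15p30:
  fixes L1 L2 :: "complex set set" and G :: "(complex \<Rightarrow> complex) set"
  assumes "veering_pair L1 L2"
    and "subgroup G (veering_Aut L1 L2)"
  shows "marking L1 L2 (fixed_stitches L1 L2 G) \<and>
    (\<forall>g\<in>G. stitch_act g ` fixed_stitches L1 L2 G = fixed_stitches L1 L2 G)"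
proof
  note V = assms(1) and L = veering_lam[OF assms(1)]
  let ?A = "veering_Aut L1 L2" and ?M = "fixed_stitches L1 L2 G" and ?S = "stitch_space L1 L2"
  interpret A: group ?A by (rule group_veering_Aut) (use L in auto)
  have loose: "loose L1" "loose L2" using V unfolding veering_pair_def by blast+
  have M: "t \<in> stitches L1 L2 \<and> (\<exists>g. flip L1 L2 g \<and> stitch_act g t = t)" if "t \<in> ?M" for t
    using that elliptic_flip[OF V] unfolding fixed_stitches_def by blast
  have iso: "\<exists>U. openin ?S U \<and> s \<in> U \<and> U \<inter> ?M \<subseteq> {s}" if "s \<in> stitches L1 L2" for s
    using flipped_stitches_isolated[OF V that M] .
  have top: "topspace ?S = stitches L1 L2"
  proof
    show "topspace ?S \<subseteq> stitches L1 L2" unfolding stitch_space_def topspace_subtopology by blast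
    show "stitches L1 L2 \<subseteq> topspace ?S" using iso openin_subset by blast
  qed
  show "marking L1 L2 ?M"
    unfolding marking_def
  proof (intro conjI ballI)
    show sub: "?M \<subseteq> stitches L1 L2" using M by blast
    fix s assume s: "s \<in> ?M"
    obtain g where g: "s \<in> stitches L1 L2" "flip L1 L2 g" "stitch_act g s = s" using M[OF s] by blast
    obtain l m where lm: "s = (l, m)" "l \<in> leaves L1" "m \<in> leaves L2" using g(1) unfolding stitches_def by blast
    have fx: "(`) g ` l = l" "(`) g ` m = m" using g(3) lm unfolding stitch_act_def by simp_all
    show "genuine L1 L2 s"
      using g lm flipped_real[OF L(1) loose(1) g(2) lm(2) fx(1)]
        flipped_real[OF L(2) loose(2) flip_sym[OF g(2)] lm(3) fx(2)] unfolding genuine_def by simp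
  next
    have sub: "?M \<subseteq> stitches L1 L2" using M by blast
    have "openin (subtopology ?S ?M) {s}" if s: "s \<in> ?M" for s
    proof -
      obtain U where U: "openin ?S U" "s \<in> U" "U \<inter> ?M \<subseteq> {s}" using iso s sub by blast
      then have "{s} = U \<inter> ?M" using s by blast
      then show ?thesis using U(1) unfolding openin_subtopology by blast
    qed
    moreover have "topspace (subtopology ?S ?M) = ?M" using sub top by auto
    ultimately show "subtopology ?S ?M = discrete_topology ?M"
      using discrete_topology_unique[of ?M "subtopology ?S ?M"] by simp
    have "openin ?S (topspace ?S - ?M)"
    proof (subst openin_subopen, intro ballI)
      fix s assume s: "s \<in> topspace ?S - ?M"
      then obtain U where U: "openin ?S U" "s \<in> U" "U \<inter> ?M \<subseteq> {s}" using iso top by blast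
      then show "\<exists>T. openin ?S T \<and> s \<in> T \<and> T \<subseteq> topspace ?S - ?M"
        using s openin_subset[OF U(1)] by blast
    qed
    then show "closedin ?S ?M" using sub top unfolding closedin_def by simp
    show "inj_on fst ?M"
    proof (rule inj_onI)
      fix s t assume st: "s \<in> ?M" "t \<in> ?M" "fst s = fst t"
      obtain g k where g: "s \<in> stitches L1 L2" "flip L1 L2 g" "stitch_act g s = s"
        and k: "t \<in> stitches L1 L2" "flip L1 L2 k" "stitch_act k t = t" using M st by metis
      obtain l m n where "s = (l, m)" "t = (l, n)" using st(3) by (metis prod.collapse)
      then show "s = t" using flipped_crossing_unique[OF V] g k by blast
    qed
    show "inj_on snd ?M"
    proof (rule inj_onI)
      fix s t assume st: "s \<in> ?M" "t \<in> ?M" "snd s = snd t"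
      obtain g k where g: "s \<in> stitches L1 L2" "flip L1 L2 g" "stitch_act g s = s"
        and k: "t \<in> stitches L1 L2" "flip L1 L2 k" "stitch_act k t = t" using M st by metis
      obtain l m n where lmn: "s = (m, l)" "t = (n, l)" using st(3) by (metis prod.collapse)
      have "stitch_act g (l, m) = (l, m)" "stitch_act k (l, n) = (l, n)"
        using g k lmn unfolding stitch_act_def by simp_all
      then have "m = n"
        using flipped_crossing_unique[OF veering_sym[OF V], of l m g n k] stitches_sym flip_sym g k lmn by blast
      then show "s = t" using lmn by simp
    qed
  qed
  show "\<forall>g\<in>G. stitch_act g ` ?M = ?M"
  proof
    fix f assume f: "f \<in> G"
    have inv: "inv\<^bsub>?A\<^esub> f \<in> G" using subgroup.m_inv_closed[OF assms(2) f] .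
    have c: "f \<in> carrier ?A" "inv\<^bsub>?A\<^esub> f \<in> carrier ?A" using subgroup.mem_carrier[OF assms(2)] f inv by blast+
    \<comment> \<open>Equality, not only inclusion: the preimage of \<open>s\<close> is its image
      under the inverse of \<open>f\<close>, which is in the set by invariance.\<close>
    have "s \<in> stitch_act f ` ?M" if s: "s \<in> ?M" for s
    proof -
      have sS: "s \<in> stitches L1 L2" using M[OF s] by blast
      have "stitch_act f (stitch_act (inv\<^bsub>?A\<^esub> f) s) = stitch_act (f \<otimes>\<^bsub>?A\<^esub> inv\<^bsub>?A\<^esub> f) s"
        by (rule stitch_act_compose[OF L sS c, symmetric])
      also have "\<dots> = s" using A.r_inv[OF c(1)] stitch_act_one[OF L sS] by simp
      finally show ?thesis using fixed_stitches_invariant[OF V assms(2) inv s] by (metis imageI)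
    qed
    then show "stitch_act f ` ?M = ?M" using fixed_stitches_invariant[OF V assms(2) f] by blast
  qed
qed

end
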